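(* Let $m,n,r,d$ be integers with $m,n\ge2$, $d\ge1$ and $0<r<\min\{m,n\}$, and for $0\le a\le rd$ let $d_R=\lfloor a/r\rfloor$, $t_R=a\bmod r$, $\alpha=\lfloor a/(n-r)\rfloor$, $s=a\bmod(n-r)$, $\beta=\lfloor (rd-a)/(m-r)\rfloor$, $t=(rd-a)\bmod(m-r)$. Let $\mathcal{B}_a$ be the set of products $L(\lambda)R(\lambda)$ with $L\in\mathbb{C}[\lambda]^{m\times r}$, $R\in\mathbb{C}[\lambda]^{r\times n}$, $\deg(R_{i*})=d_R+1$ for $1\le i\le t_R$, $\deg(R_{i*})=d_R$ for $t_R<i\le r$, and $\deg(L_{*i})=d-\deg(R_{i*})$ for $1\le i\le r$. Let $\mathcal{M}_a$ be the set of products $L(\lambda)R(\lambda)$ with factors $L,R$ satisfying these same conditions and additionally such that the columns of $L$ form a minimal basis and the rows of $R$ form a minimal basis. Let $\mathcal{MH}_a$ be the set of products $L(\lambda)R(\lambda)$ with factors $L,R$ satisfying the conditions defining $\mathcal{M}_a$ and additionally such that the left nullspace $\mathcal{N}_\ell(L)$ has minimal indices $\beta+1$ ($t$ times) and $\beta$ ($m-r-t$ times), and the right nullspace $\mathcal{N}_r(R)$ has minimal indices $\alpha+1$ ($s$ times) and $\alpha$ ($n-r-s$ times). Then: (i) $\mathcal{MH}_a\subseteq\mathcal{M}_a\subseteq\mathcal{B}_a$ for $a=0,\dots,rd$; (ii) $\overline{\mathcal{MH}_a}=\overline{\mathcal{M}_a}=\overline{\mathcal{B}_a}$ for $a=0,\dots,rd$;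 (iii) $\mathbb{C}[\lambda]^{m\times n}_{d,r}=\bigcup_{0\le a\le rd}\overline{\mathcal{MH}_a}=\bigcup_{0\le a\le rd}\overline{\mathcal{M}_a}$; (iv) for every $P(\lambda)\in\mathbb{C}[\lambda]^{m\times n}_{d,r}$ there is an integer $a$ with $P(\lambda)\in\overline{\mathcal{MH}_a}=\overline{\mathcal{M}_a}$.
   Context: $\mathbb{C}[\lambda]^{m\times n}_{d,r}$ is the set of complex $m\times n$ polynomial matrices of degree at most $d$ and normal rank (rank over $\mathbb{C}(\lambda)$) at most $r$. Degrees of polynomial vectors are the maximum degree of entries, $\deg 0=-\infty$; $L_{*i}$ is the $i$th column of $L$, $R_{i*}$ the $i$th row of $R$. A minimal basis of a rational subspace (subspace of $\mathbb{C}(\lambda)^k$) is a basis of polynomial vectors with minimal sum of degrees among polynomial bases; the minimal indices of the subspace are the degrees of the vectors in any minimal basis (this list is independent of the minimal basis). $\mathcal{N}_\ell(L)=\{y\in\mathbb{C}(\lambda)^{1\times m}: yL=0\}$, $\mathcal{N}_r(R)=\{x\in\mathbb{C}(\lambda)^{n\times1}:Rx=0\}$. Closures are taken in $\mathbb{C}[\lambda]^{m\times n}_d$ (polynomial matrices of degree at most $d$) with the metric $\mathrm{dist}(P,Q)=(\sum_{i=0}^d\|P_i-Q_i\|_F^2)^{1/2}$, where $P_i,Q_i$ are the coefficients of $\lambda^i$. *)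

theory Defs
  imports "Jordan_Normal_Form.DL_Rank" "HOL-Computational_Algebra.Polynomial"
    "HOL-Computational_Algebra.Fraction_Field" "HOL-Library.Extended_Real"
    "HOL-Library.Multiset"
begin

type_synonym cpoly = "complex poly"
type_synonym cratf = "complex poly fract"

definition rf :: "cpoly \<Rightarrow> cratf" where "rf p = Fract p 1"
definition rf_vec :: "cpoly vec \<Rightarrow> cratf vec" where "rf_vec v = map_vec rf v"
definition rf_mat :: "cpoly mat \<Rightarrow> cratf mat" where "rf_mat A = map_mat rf A"

definition pvdeg :: "cpoly vec \<Rightarrow> ereal" where
  "pvdeg v = (if (\<forall>i<dim_vec v. v $ i = 0) then -\<infinity>
              else ereal (real (Max {degree (v $ i) | i. i < dim_vec v \<and> v $ i \<noteq> 0})))"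

definition polymats :: "nat \<Rightarrow> nat \<Rightarrow> nat \<Rightarrow> cpoly mat set" where
  "polymats m n d = {P \<in> carrier_mat m n. \<forall>i<m. \<forall>j<n. degree (P $$ (i,j)) \<le> d}"

definition normal_rank :: "cpoly mat \<Rightarrow> nat" where
  "normal_rank P = vec_space.rank (dim_row P) (rf_mat P)"

definition polymats_rank :: "nat \<Rightarrow> nat \<Rightarrow> nat \<Rightarrow> nat \<Rightarrow> cpoly mat set" where
  "polymats_rank m n d r = {P \<in> polymats m n d. normal_rank P \<le> r}"

definition pm_dist :: "nat \<Rightarrow> cpoly mat \<Rightarrow> cpoly mat \<Rightarrow> real" where
  "pm_dist d P Q = sqrt (\<Sum>k\<le>d. \<Sum>i<dim_row P. \<Sum>j<dim_col P.
       (cmod (coeff (P $$ (i,j)) k - coeff (Q $$ (i,j)) k))\<^sup>2)"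

definition pm_closure :: "nat \<Rightarrow> nat \<Rightarrow> nat \<Rightarrow> cpoly mat set \<Rightarrow> cpoly mat set" where
  "pm_closure m n d S = {P \<in> polymats m n d.
       \<forall>e>0. \<exists>Q\<in>S \<inter> polymats m n d. pm_dist d P Q < e}"

definition rat_lin_indpt :: "nat \<Rightarrow> cratf vec set \<Rightarrow> bool" where
  "rat_lin_indpt k S = LinearCombinations.module.lin_indpt class_ring (module_vec TYPE(cratf) k) S"

definition rat_span :: "nat \<Rightarrow> cratf vec set \<Rightarrow> cratf vec set" where
  "rat_span k S = LinearCombinations.module.span class_ring (module_vec TYPE(cratf) k) S"

definition poly_basis :: "nat \<Rightarrow> cratf vec set \<Rightarrow> cpoly vec list \<Rightarrow> bool" where
  "poly_basis k V bs \<longleftrightarrow> set bs \<subseteq> carrier_vec k \<and> distinct (map rf_vec bs)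
     \<and> rat_lin_indpt k (rf_vec ` set bs) \<and> rat_span k (rf_vec ` set bs) = V"

definition deg_sum :: "cpoly vec list \<Rightarrow> ereal" where
  "deg_sum bs = sum_list (map pvdeg bs)"

definition minimal_basis :: "nat \<Rightarrow> cratf vec set \<Rightarrow> cpoly vec list \<Rightarrow> bool" where
  "minimal_basis k V bs \<longleftrightarrow> poly_basis k V bs \<and>
     (\<forall>bs'. poly_basis k V bs' \<longrightarrow> deg_sum bs \<le> deg_sum bs')"

text \<open>"V has minimal indices given by the multiset D" (independent of the chosen minimal basis).\<close>
definition has_minimal_indices :: "nat \<Rightarrow> cratf vec set \<Rightarrow> ereal multiset \<Rightarrow> bool" where
  "has_minimal_indices k V D \<longleftrightarrow> (\<exists>bs. minimal_basis k V bs \<and> mset (map pvdeg bs) = D)"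

definition cols_minimal_basis :: "cpoly mat \<Rightarrow> bool" where
  "cols_minimal_basis L \<longleftrightarrow>
     minimal_basis (dim_row L) (rat_span (dim_row L) (rf_vec ` set (cols L))) (cols L)"

definition rows_minimal_basis :: "cpoly mat \<Rightarrow> bool" where
  "rows_minimal_basis R \<longleftrightarrow>
     minimal_basis (dim_col R) (rat_span (dim_col R) (rf_vec ` set (rows R))) (rows R)"

definition left_null :: "cpoly mat \<Rightarrow> cratf vec set" where
  "left_null L = {y \<in> carrier_vec (dim_row L). transpose_mat (rf_mat L) *\<^sub>v y = 0\<^sub>v (dim_col L)}"

definition right_null :: "cpoly mat \<Rightarrow> cratf vec set" where
  "right_null R = {x \<in> carrier_vec (dim_col R). rf_mat R *\<^sub>v x = 0\<^sub>v (dim_row R)}"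

text \<open>Degree conditions on the factors (indices shifted to start at 0).\<close>
definition deg_conds :: "nat \<Rightarrow> nat \<Rightarrow> nat \<Rightarrow> nat \<Rightarrow> nat \<Rightarrow> cpoly mat \<Rightarrow> cpoly mat \<Rightarrow> bool" where
  "deg_conds m n r d a L R \<longleftrightarrow> L \<in> carrier_mat m r \<and> R \<in> carrier_mat r n \<and>
     (\<forall>i<r. pvdeg (row R i) = (if i < a mod r then ereal (real (a div r + 1))
                                  else ereal (real (a div r)))) \<and>
     (\<forall>i<r. pvdeg (col L i) = ereal (real d) - pvdeg (row R i))"

definition Bset :: "nat \<Rightarrow> nat \<Rightarrow> nat \<Rightarrow> nat \<Rightarrow> nat \<Rightarrow> cpoly mat set" where
  "Bset m n r d a = {L * R | L R. deg_conds m n r d a L R}"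

definition Mset :: "nat \<Rightarrow> nat \<Rightarrow> nat \<Rightarrow> nat \<Rightarrow> nat \<Rightarrow> cpoly mat set" where
  "Mset m n r d a = {L * R | L R. deg_conds m n r d a L R \<and>
      cols_minimal_basis L \<and> rows_minimal_basis R}"

definition MHset :: "nat \<Rightarrow> nat \<Rightarrow> nat \<Rightarrow> nat \<Rightarrow> nat \<Rightarrow> cpoly mat set" where
  "MHset m n r d a = {L * R | L R. deg_conds m n r d a L R \<and>
      cols_minimal_basis L \<and> rows_minimal_basis R \<and>
      (let \<alpha> = a div (n - r); s = a mod (n - r);
           \<beta> = (r * d - a) div (m - r); t = (r * d - a) mod (m - r) in
       has_minimal_indices m (left_null L)
         (replicate_mset t (ereal (real (\<beta> + 1))) + replicate_mset (m - r - t) (ereal (real \<beta>))) \<and>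
       has_minimal_indices n (right_null R)
         (replicate_mset s (ereal (real (\<alpha> + 1))) + replicate_mset (n - r - s) (ereal (real \<alpha>))))}"

end

theory Submission
  imports Defs "HOL-Computational_Algebra.Fundamental_Theorem_Algebra"
begin

text \<open>
  Write \<open>F(f)\<close> for the set of sums of \<open>r\<close> rank-one products \<open>l\<^sub>k r\<^sub>k\<close> with \<open>deg r\<^sub>k \<le> f\<^sub>k\<close> and
  \<open>deg l\<^sub>k \<le> d - f\<^sub>k\<close>.  A polynomial matrix of degree at most \<open>d\<close> and normal rank at most \<open>r\<close> lies in
  some \<open>F(f)\<close>: start from a rational rank factorization, remove the roots of the common denominator one
  at a time, and then cancel leading coefficients as long as some product has degree above \<open>d\<close>.  If
  \<open>f\<^sub>1 \<ge> f\<^sub>2 + 2\<close>, an explicit one-parameter deformation shows that \<open>F(f)\<close> is contained in the closure of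
  \<open>F(f')\<close>, where \<open>f'\<^sub>1 = f\<^sub>1 - 1\<close> and \<open>f'\<^sub>2 = f\<^sub>2 + 1\<close>; iterating, one reaches the balanced degrees
  with the same sum \<open>a\<close>.

  It remains to approximate elements of a balanced \<open>F(f)\<close> by elements of \<open>MH\<^sub>a\<close>.  All conditions on
  a factor \<open>R\<close> follow from the nonvanishing of three minors of its convolution matrix: one makes
  \<open>x \<mapsto> R x\<close> surjective in degree \<open>\<alpha>\<close>, one makes it injective below degree \<open>\<alpha>\<close>, and one says that
  the leading row coefficients are nonsingular on the first \<open>r\<close> columns.  These give
  predictable degrees for the rows of \<open>R\<close> and an explicit basis of the null space, and minimality is then a
  count of the vectors of the smallest possible degree.  Adding to the coefficients of \<open>R\<close> powers of a
  parameter \<open>t\<close> with exponents of Monge type makes each minor a nonzero polynomial in \<open>t\<close>, so it vanishes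
  for finitely many \<open>t\<close> only.  The same applies to the transpose of \<open>L\<close> with its rows reversed.

  Conversely, the minors of size \<open>r + 1\<close> of an element of \<open>F(f)\<close> vanish, hence so do those of a limit.
\<close>

section \<open>Closures and balancing of degrees\<close>

lemma polymats_coeff_eq_0:
  "P \<in> polymats m n d \<Longrightarrow> i < m \<Longrightarrow> j < n \<Longrightarrow> d < k \<Longrightarrow> coeff (P $$ (i,j)) k = 0"
  by (intro coeff_eq_0) (auto simp: polymats_def intro: le_less_trans)

text \<open>Each coefficient difference is bounded by \<open>pm_dist\<close>, which in turn sums
  finitely many squared differences. Coefficients above \<open>d\<close> vanish on both sides, so
  \<open>k\<close> needs no bound.\<close>

lemma pm_closure_iff:
  "P \<in> pm_closure m n d S \<longleftrightarrow> P \<in> polymats m n d \<and>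
     (\<forall>e>0. \<exists>Q\<in>S \<inter> polymats m n d. \<forall>i<m. \<forall>j<n. \<forall>k.
        cmod (coeff (P $$ (i,j)) k - coeff (Q $$ (i,j)) k) < e)" (is "_ \<longleftrightarrow> ?pm P \<and> ?near")
proof (intro iffI conjI)
  assume P: "P \<in> pm_closure m n d S"
  then show pm: "?pm P" by (auto simp: pm_closure_def)
  show ?near
  proof (intro allI impI)
    fix e :: real assume "e > 0"
    with P obtain Q where Q: "Q \<in> S \<inter> polymats m n d" "pm_dist d P Q < e"
      by (auto simp: pm_closure_def)
    have "cmod (coeff (P $$ (i,j)) k - coeff (Q $$ (i,j)) k) < e" if ij: "i < m" "j < n" for i j k
    proof (cases "k \<le> d")
      case True
      define T where "T k i j = (cmod (coeff (P $$ (i,j)) k - coeff (Q $$ (i,j)) k))\<^sup>2" for k i j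
      have "T k i j \<le> (\<Sum>j<n. T k i j)"
        using ij by (intro member_le_sum) (auto simp: T_def)
      also have "\<dots> \<le> (\<Sum>i<m. \<Sum>j<n. T k i j)"
        using ij by (intro member_le_sum) (auto simp: T_def intro!: sum_nonneg)
      also have "\<dots> \<le> (\<Sum>k\<le>d. \<Sum>i<m. \<Sum>j<n. T k i j)"
        using True by (intro member_le_sum) (auto simp: T_def intro!: sum_nonneg)
      finally have "cmod (coeff (P $$ (i,j)) k - coeff (Q $$ (i,j)) k) \<le> pm_dist d P Q"
        using pm by (auto simp: pm_dist_def T_def polymats_def intro!: real_le_rsqrt)
      then show ?thesis using Q by simp
    next
      case False
      then show ?thesis using ij pm Q \<open>e > 0\<close> by (auto simp: polymats_coeff_eq_0)
    qed
    then show "\<exists>Q\<in>S \<inter> polymats m n d. \<forall>i<m. \<forall>j<n. \<forall>k.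
        cmod (coeff (P $$ (i,j)) k - coeff (Q $$ (i,j)) k) < e" using Q by blast
  qed
next
  assume A: "?pm P \<and> ?near"
  have "\<exists>Q\<in>S \<inter> polymats m n d. pm_dist d P Q < e" if "e > 0" for e :: real
  proof -
    define M where "M = real (Suc d * m * n)"
    have M: "M \<ge> 0" by (simp add: M_def)
    \<comment> \<open>\<open>M\<close> counts the summands of \<open>pm_dist\<close>;
      \<open>M + 1\<close> keeps the estimate strict even when \<open>M\<close> is 0.\<close>
    define e' where "e' = e / (M + 1)"
    have "e' > 0" using that M by (simp add: e'_def)
    with A obtain Q where Q: "Q \<in> S \<inter> polymats m n d"
      "\<And>i j k. i < m \<Longrightarrow> j < n \<Longrightarrow> cmod (coeff (P $$ (i,j)) k - coeff (Q $$ (i,j)) k) < e'"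
      by blast
    have "(\<Sum>k\<le>d. \<Sum>i<m. \<Sum>j<n. (cmod (coeff (P $$ (i,j)) k - coeff (Q $$ (i,j)) k))\<^sup>2)
       \<le> (\<Sum>k\<le>d. \<Sum>i<m. \<Sum>j<n. e'\<^sup>2)"
      using Q by (intro sum_mono power_mono) (auto simp: less_imp_le)
    also have "\<dots> = M * e'\<^sup>2" by (simp add: M_def algebra_simps)
    also have "\<dots> < (M + 1)\<^sup>2 * e'\<^sup>2"
      using M \<open>e' > 0\<close> by (intro mult_strict_right_mono) (auto simp: power2_eq_square algebra_simps add_pos_nonneg)
    also have "\<dots> = e\<^sup>2" using M by (simp add: e'_def power_divide)
    finally have "pm_dist d P Q < sqrt (e\<^sup>2)"
      using A unfolding pm_dist_def by (intro real_sqrt_less_mono) (auto simp: polymats_def)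
    then show ?thesis using Q that by auto
  qed
  then show "P \<in> pm_closure m n d S" using A by (auto simp: pm_closure_def)
qed

lemma pm_closure_mono: "S \<subseteq> T \<Longrightarrow> pm_closure m n d S \<subseteq> pm_closure m n d T"
  unfolding pm_closure_def by blast

lemma pm_closure_idem: "pm_closure m n d (pm_closure m n d S) \<subseteq> pm_closure m n d S"
proof
  fix P assume P: "P \<in> pm_closure m n d (pm_closure m n d S)"
  show "P \<in> pm_closure m n d S"
    unfolding pm_closure_iff
  proof (intro conjI allI impI)
    show "P \<in> polymats m n d" using P by (simp add: pm_closure_iff)
    fix e :: real assume "e > 0"
    then have e2: "e / 2 > 0" by simp
    with P obtain Q where Q: "Q \<in> pm_closure m n d S"
       "\<And>i j k. i < m \<Longrightarrow> j < n \<Longrightarrow> cmod (coeff (P $$ (i,j)) k - coeff (Q $$ (i,j)) k) < e / 2"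
      unfolding pm_closure_iff[of P] by blast
    with e2 obtain Q' where Q': "Q' \<in> S \<inter> polymats m n d"
       "\<And>i j k. i < m \<Longrightarrow> j < n \<Longrightarrow> cmod (coeff (Q $$ (i,j)) k - coeff (Q' $$ (i,j)) k) < e / 2"
      unfolding pm_closure_iff[of Q] by blast
    have "cmod (coeff (P $$ (i,j)) k - coeff (Q' $$ (i,j)) k) < e" if "i < m" "j < n" for i j k
      using norm_diff_triangle_less[OF Q(2)[OF that] Q'(2)[OF that]] by simp
    with Q' show "\<exists>Q\<in>S \<inter> polymats m n d. \<forall>i<m. \<forall>j<n. \<forall>k.
        cmod (coeff (P $$ (i,j)) k - coeff (Q $$ (i,j)) k) < e" by blast
  qed
qed

lemma pm_closure_subset_closureI:
  "S \<subseteq> pm_closure m n d T \<Longrightarrow> pm_closure m n d S \<subseteq> pm_closure m n d T"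
  using pm_closure_mono pm_closure_idem by blast

text \<open>Only the finitely many coefficients up to \<open>d\<close> can differ, so
  coefficientwise convergence is already uniform. The filter will be the punctured neighbourhood of
  0 for a deformation parameter.\<close>

lemma pm_closure_limitI:
  fixes F :: "'a filter"
  assumes P: "P \<in> polymats m n d" and F: "F \<noteq> bot"
    and ev: "\<forall>\<^sub>F t in F. Q t \<in> S \<inter> polymats m n d"
    and lim: "\<And>i j k. i < m \<Longrightarrow> j < n \<Longrightarrow> ((\<lambda>t. coeff (Q t $$ (i,j)) k) \<longlongrightarrow> coeff (P $$ (i,j)) k) F"
  shows "P \<in> pm_closure m n d S"
  unfolding pm_closure_iff
proof (intro conjI allI impI)
  fix e :: real assume "e > 0"
  have "\<forall>\<^sub>F t in F. \<forall>i\<in>{..<m}. \<forall>j\<in>{..<n}. \<forall>k\<in>{..d}. dist (coeff (Q t $$ (i,j)) k) (coeff (P $$ (i,j)) k) < e"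
    using lim \<open>e > 0\<close> by (intro eventually_ball_finite ballI finite_lessThan finite_atMost) (auto intro: tendstoD)
  with ev have "\<forall>\<^sub>F t in F. Q t \<in> S \<inter> polymats m n d \<and> 
     (\<forall>i\<in>{..<m}. \<forall>j\<in>{..<n}. \<forall>k\<in>{..d}. dist (coeff (Q t $$ (i,j)) k) (coeff (P $$ (i,j)) k) < e)"
    by eventually_elim simp
  then obtain t where t: "Q t \<in> S \<inter> polymats m n d"
     "\<And>i j k. i < m \<Longrightarrow> j < n \<Longrightarrow> k \<le> d \<Longrightarrow> dist (coeff (Q t $$ (i,j)) k) (coeff (P $$ (i,j)) k) < e"
    using eventually_happens'[OF F] by (metis (no_types, lifting) atMost_iff lessThan_iff)
  have "cmod (coeff (P $$ (i,j)) k - coeff (Q t $$ (i,j)) k) < e" if "i < m" "j < n" for i j k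
  proof (cases "k \<le> d")
    case True
    then show ?thesis using t(2)[OF that True] by (simp add: dist_norm norm_minus_commute)
  next
    case False
    then show ?thesis using that P t(1) \<open>e > 0\<close> by (auto simp: polymats_coeff_eq_0)
  qed
  with t(1) show "\<exists>Q\<in>S \<inter> polymats m n d. \<forall>i<m. \<forall>j<n. \<forall>k.
        cmod (coeff (P $$ (i,j)) k - coeff (Q $$ (i,j)) k) < e" by blast
qed (use P in auto)

text \<open>Only upper bounds are imposed on the degrees, unlike in \<open>deg_conds\<close>, so
  leading coefficients may vanish. The subtraction is truncated and meaningful only for
  \<open>f k\<close> at most \<open>d\<close>.\<close>

definition facs :: "nat \<Rightarrow> nat \<Rightarrow> nat \<Rightarrow> nat \<Rightarrow> (nat \<Rightarrow> nat) \<Rightarrow> cpoly mat set" where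
  "facs m n r d f = {mat m n (\<lambda>(i,j). \<Sum>k<r. L i k * R k j) | L R.
     (\<forall>i<m. \<forall>k<r. degree (L i k) \<le> d - f k) \<and> (\<forall>k<r. \<forall>j<n. degree (R k j) \<le> f k)}"

lemma facsI:
  assumes "P = mat m n (\<lambda>(i,j). \<Sum>k<r. L i k * R k j)"
    and "\<And>i k. i < m \<Longrightarrow> k < r \<Longrightarrow> degree (L i k) \<le> d - f k"
    and "\<And>k j. k < r \<Longrightarrow> j < n \<Longrightarrow> degree (R k j) \<le> f k"
  shows "P \<in> facs m n r d f"
  unfolding facs_def using assms by blast

lemma facs_subset_polymats:
  assumes "\<And>k. k < r \<Longrightarrow> f k \<le> d"
  shows "facs m n r d f \<subseteq> polymats m n d"
proof
  fix P assume "P \<in> facs m n r d f"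
  then obtain L R where P: "P = mat m n (\<lambda>(i,j). \<Sum>k<r. L i k * R k j)"
    and L: "\<And>i k. i < m \<Longrightarrow> k < r \<Longrightarrow> degree (L i k) \<le> d - f k"
    and R: "\<And>k j. k < r \<Longrightarrow> j < n \<Longrightarrow> degree (R k j) \<le> f k"
    unfolding facs_def by blast
  have "degree (\<Sum>k<r. L i k * R k j) \<le> d" if "i < m" "j < n" for i j
  proof (intro degree_sum_le)
    fix k assume "k \<in> {..<r}"
    then have "k < r" by simp
    from degree_mult_le[of "L i k" "R k j"] L[OF that(1) this] R[OF this that(2)] assms[OF this]
    show "degree (L i k * R k j) \<le> d" by linarith
  qed auto
  then show "P \<in> polymats m n d" by (auto simp: P polymats_def)
qed

lemma facs_cong:
  assumes "\<And>k. k < r \<Longrightarrow> f k = g k"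
  shows "facs m n r d f = facs m n r d g"
proof -
  have "facs m n r d f \<subseteq> facs m n r d g" if fg: "\<And>k. k < r \<Longrightarrow> f k = g k" for f g
  proof
    fix P assume "P \<in> facs m n r d f"
    then obtain L R where "P = mat m n (\<lambda>(i,j). \<Sum>k<r. L i k * R k j)"
      "\<And>i k. i < m \<Longrightarrow> k < r \<Longrightarrow> degree (L i k) \<le> d - f k"
      "\<And>k j. k < r \<Longrightarrow> j < n \<Longrightarrow> degree (R k j) \<le> f k"
      unfolding facs_def by blast
    then show "P \<in> facs m n r d g" by (intro facsI) (auto simp: fg)
  qed
  from this[of f g] this[of g f] show ?thesis using assms by auto
qed

lemma facs_permute:
  assumes p: "bij_betw p {..<r} {..<r}"
  shows "facs m n r d f \<subseteq> facs m n r d (\<lambda>k. f (p k))"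
proof
  fix P assume "P \<in> facs m n r d f"
  then obtain L R where P: "P = mat m n (\<lambda>(i,j). \<Sum>k<r. L i k * R k j)"
    and L: "\<And>i k. i < m \<Longrightarrow> k < r \<Longrightarrow> degree (L i k) \<le> d - f k"
    and R: "\<And>k j. k < r \<Longrightarrow> j < n \<Longrightarrow> degree (R k j) \<le> f k"
    unfolding facs_def by blast
  have pl: "p k < r" if "k < r" for k using p that by (auto simp: bij_betw_def)
  have "(\<Sum>k<r. L i k * R k j) = (\<Sum>k<r. L i (p k) * R (p k) j)" for i j
    using sum.reindex_bij_betw[OF p, of "\<lambda>k. L i k * R k j"] by simp
  then have "P = mat m n (\<lambda>(i,j). \<Sum>k<r. L i (p k) * R (p k) j)" by (simp add: P)
  then show "P \<in> facs m n r d (\<lambda>k. f (p k))"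
    by (rule facsI) (use L R pl in auto)
qed

lemma degree_le_pred:
  assumes "degree p \<le> n" "coeff p n = 0"
  shows "degree p \<le> n - 1"
proof (rule degree_le, intro allI impI)
  fix i assume "n - 1 < i"
  then show "coeff p i = 0" using assms by (cases "i = n") (auto intro: coeff_eq_0)
qed

text \<open>The two perturbations of order \<open>e\<close> are chosen so that the leading terms that would exceed the new
  degree bounds cancel against each other after a shear by \<open>\<lambda>\<^sup>\<kappa> / e\<close>.\<close>

lemma facs_move:
  assumes k: "k1 < r" "k2 < r" and f12: "f k1 \<ge> f k2 + 2"
    and fd: "\<And>k. k < r \<Longrightarrow> f k \<le> d"
  shows "facs m n r d f \<subseteq> pm_closure m n d (facs m n r d (f(k1 := f k1 - 1, k2 := f k2 + 1)))"
    (is "_ \<subseteq> pm_closure m n d (facs m n r d ?f')")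
proof
  fix P assume PS: "P \<in> facs m n r d f"
  then obtain L R where P: "P = mat m n (\<lambda>(i,j). \<Sum>k<r. L i k * R k j)"
    and L: "\<And>i k. i < m \<Longrightarrow> k < r \<Longrightarrow> degree (L i k) \<le> d - f k"
    and R: "\<And>k j. k < r \<Longrightarrow> j < n \<Longrightarrow> degree (R k j) \<le> f k"
    unfolding facs_def by blast
  have ne: "k1 \<noteq> k2" using f12 by auto
  have fd1: "f k1 \<le> d" and fd2: "f k2 \<le> d" using fd k by auto
  define x where "x j = coeff (R k1 j) (f k1)" for j
  define y where "y i = coeff (L i k2) (d - f k2)" for i
  \<comment> \<open>This shift lifts degree \<open>f k2 + 1\<close> to \<open>f k1\<close> and also
    degree \<open>d - f k1 + 1\<close> to \<open>d - f k2\<close>.\<close>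
  define \<kappa> where "\<kappa> = f k1 - f k2 - 1"
  define R2 where "R2 e j = R k2 j + monom (e * x j) (f k2 + 1)" for e j
  define R1 where "R1 e j = R k1 j - smult (1/e) (monom 1 \<kappa> * R2 e j)" for e j
  define L1 where "L1 e i = L i k1 - monom (e * y i) (d - f k1 + 1)" for e i
  define L2 where "L2 e i = L i k2 + smult (1/e) (monom 1 \<kappa> * L1 e i)" for e i
  \<comment> \<open>The terms with factor \<open>1/e\<close> cancel between the two products. What
    remains is the change \<open>e * E\<close> with \<open>E\<close> independent of
    \<open>e\<close>, hence convergence as \<open>e\<close> tends to 0.\<close>
  define E where "E i j = L i k2 * monom (x j) (f k2 + 1) - monom (y i) (d - f k1 + 1) * R k1 j" for i j
  define L' where "L' e i k = (if k = k1 then L1 e i else if k = k2 then L2 e i else L i k)" for e i k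
  define R' where "R' e k j = (if k = k1 then R1 e j else if k = k2 then R2 e j else R k j)" for e k j
  have dR2: "degree (R2 e j) \<le> f k2 + 1" if "j < n" for e j
    unfolding R2_def using R[OF k(2) that] by (intro degree_add_le) (auto intro: order_trans[OF degree_monom_le])
  have dR1: "degree (R1 e j) \<le> f k1 - 1" if "j < n" "e \<noteq> 0" for e j
  proof (rule degree_le_pred)
    have "degree (monom 1 \<kappa> * R2 e j) \<le> \<kappa> + (f k2 + 1)"
      using degree_mult_le[of "monom 1 \<kappa>" "R2 e j"] degree_monom_le[of "1::complex" \<kappa>] dR2[OF that(1), of e] by linarith
    also have "\<dots> = f k1" using f12 by (simp add: \<kappa>_def)
    finally show "degree (R1 e j) \<le> f k1"
      unfolding R1_def using R[OF k(1) that(1)] by (intro degree_diff_le) (auto intro: order_trans[OF degree_smult_le])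
    have "coeff (R k2 j) (f k2 + 1) = 0" using R[OF k(2) that(1)] by (intro coeff_eq_0) auto
    moreover have "f k1 - \<kappa> = f k2 + 1" "\<not> f k1 < \<kappa>" using f12 by (auto simp: \<kappa>_def)
    ultimately show "coeff (R1 e j) (f k1) = 0"
      using that by (simp add: R1_def coeff_monom_mult R2_def x_def)
  qed
  have dL1: "degree (L1 e i) \<le> d - f k1 + 1" if "i < m" for e i
    unfolding L1_def using L[OF that k(1)] by (intro degree_diff_le) (auto intro: order_trans[OF degree_monom_le])
  have dL2: "degree (L2 e i) \<le> d - f k2 - 1" if "i < m" "e \<noteq> 0" for e i
  proof (rule degree_le_pred)
    have "degree (monom 1 \<kappa> * L1 e i) \<le> \<kappa> + (d - f k1 + 1)"
      using degree_mult_le[of "monom 1 \<kappa>" "L1 e i"] degree_monom_le[of "1::complex" \<kappa>] dL1[OF that(1), of e] by linarith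
    also have "\<dots> = d - f k2" using f12 fd1 by (simp add: \<kappa>_def)
    finally show "degree (L2 e i) \<le> d - f k2"
      unfolding L2_def using L[OF that(1) k(2)] by (intro degree_add_le) (auto intro: order_trans[OF degree_smult_le])
    have "coeff (L i k1) (d - f k1 + 1) = 0" using L[OF that(1) k(1)] by (intro coeff_eq_0) auto
    moreover have "d - f k2 - \<kappa> = d - f k1 + 1" "\<not> d - f k2 < \<kappa>" using f12 fd1 by (auto simp: \<kappa>_def)
    ultimately show "coeff (L2 e i) (d - f k2) = 0"
      using that by (simp add: L2_def coeff_monom_mult L1_def y_def)
  qed
  have prod: "(\<Sum>k<r. L' e i k * R' e k j) = (\<Sum>k<r. L i k * R k j) + smult e (E i j)" if "e \<noteq> 0" for e i j
  proof -
    have split: "sum g {..<r} = g k1 + g k2 + sum g ({..<r} - {k1,k2})" for g :: "nat \<Rightarrow> cpoly"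
    proof -
      have "{..<r} = insert k1 (insert k2 ({..<r} - {k1,k2}))" using k by auto
      then have "sum g {..<r} = sum g (insert k1 (insert k2 ({..<r} - {k1,k2})))" by simp
      also have "\<dots> = g k1 + g k2 + sum g ({..<r} - {k1,k2})" using ne by (simp add: algebra_simps)
      finally show ?thesis .
    qed
    have "L1 e i * R1 e j + L2 e i * R2 e j = L1 e i * R k1 j + L i k2 * R2 e j"
      by (simp add: R1_def L2_def algebra_simps)
    also have "\<dots> = L i k1 * R k1 j + L i k2 * R k2 j + smult e (E i j)"
      by (simp add: L1_def R2_def E_def algebra_simps smult_monom[symmetric] del: smult_monom)
         (simp add: smult_diff_right smult_monom[symmetric] del: smult_monom)
    finally have "L1 e i * R1 e j + L2 e i * R2 e j = L i k1 * R k1 j + L i k2 * R k2 j + smult e (E i j)" .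
    moreover have "sum (\<lambda>k. L' e i k * R' e k j) ({..<r} - {k1,k2}) = sum (\<lambda>k. L i k * R k j) ({..<r} - {k1,k2})"
      by (intro sum.cong) (auto simp: L'_def R'_def)
    ultimately show ?thesis unfolding split[of "\<lambda>k. L' e i k * R' e k j"] split[of "\<lambda>k. L i k * R k j"]
      using ne by (simp add: L'_def R'_def algebra_simps)
  qed
  define Q where "Q e = mat m n (\<lambda>(i,j). \<Sum>k<r. L' e i k * R' e k j)" for e :: complex
  have QS: "Q e \<in> facs m n r d ?f'" if "e \<noteq> 0" for e
  proof (rule facsI[OF Q_def])
    show "degree (L' e i k) \<le> d - ?f' k" if "i < m" "k < r" for i k
      using L[OF that] dL1[OF that(1), of e] dL2[OF that(1) \<open>e \<noteq> 0\<close>] f12 fd1 fd2 ne by (auto simp: L'_def)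
    show "degree (R' e k j) \<le> ?f' k" if "k < r" "j < n" for k j
      using R[OF that] dR1[OF that(2) \<open>e \<noteq> 0\<close>] dR2[OF that(2), of e] ne by (auto simp: R'_def)
  qed
  have f'd: "?f' k \<le> d" if "k < r" for k using fd[OF that] f12 fd1 fd2 by (auto)
  have *: "\<forall>\<^sub>F e in at 0. Q e \<in> facs m n r d ?f' \<inter> polymats m n d"
    using eventually_neq_at_within[of "0::complex" 0 UNIV]
  proof eventually_elim
    case (elim e)
    then show ?case using QS[of e] facs_subset_polymats[of r ?f' d m n] f'd by blast
  qed
  show "P \<in> pm_closure m n d (facs m n r d ?f')"
  proof (rule pm_closure_limitI[OF _ _ *])
    show "P \<in> polymats m n d" using PS facs_subset_polymats[of r f d m n] fd by auto
    fix i j l assume ij: "i < m" "j < n"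
    have "((\<lambda>e. coeff (P $$ (i,j)) l + e * coeff (E i j) l) \<longlongrightarrow> coeff (P $$ (i,j)) l + 0 * coeff (E i j) l) (at 0)"
      by (intro tendsto_intros)
    moreover have "\<forall>\<^sub>F e in at 0. coeff (P $$ (i,j)) l + e * coeff (E i j) l = coeff (Q e $$ (i,j)) l"
      using eventually_neq_at_within[of "0::complex" 0 UNIV]
      by eventually_elim (use ij prod in \<open>auto simp: Q_def P\<close>)
    ultimately show "((\<lambda>e. coeff (Q e $$ (i,j)) l) \<longlongrightarrow> coeff (P $$ (i,j)) l) (at 0)"
      by (simp add: Lim_transform_eventually)
  qed simp
qed

text \<open>The row degrees demanded by \<open>deg_conds\<close>: the most even distribution of the
  sum \<open>a\<close> over \<open>r\<close> rows, larger values first.\<close>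

definition bal :: "nat \<Rightarrow> nat \<Rightarrow> nat \<Rightarrow> nat" where
  "bal r a i = (if i < a mod r then a div r + 1 else a div r)"

text \<open>Values that differ by at most one are \<open>c\<close> or \<open>c + 1\<close>. Dividing
  their sum by \<open>r\<close> recovers \<open>c\<close> as quotient and the number of larger
  values as remainder, so sorting yields \<open>bal\<close>.\<close>

lemma balanced_permute:
  assumes r: "0 < r" and bl: "\<And>k l. k < r \<Longrightarrow> l < r \<Longrightarrow> f k \<le> f l + 1"
  obtains p where "bij_betw p {..<r} {..<r}" "\<And>k. k < r \<Longrightarrow> f (p k) = bal r (sum f {..<r}) k"
proof -
  define c where "c = Min (f ` {..<r})"
  define A where "A = {k\<in>{..<r}. f k = c + 1}"
  define B where "B = {k\<in>{..<r}. f k = c}"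
  define a where "a = sum f {..<r}"
  have cmin: "c \<le> f k" if "k < r" for k using that by (simp add: c_def)
  have "c \<in> f ` {..<r}" unfolding c_def using r by (intro Min_in) (auto simp: lessThan_empty_iff)
  then obtain k0 where k0: "k0 < r" "f k0 = c" by auto
  have le: "f k \<le> c + 1" if "k < r" for k using bl[OF that k0(1)] k0 by simp
  have cc: "f k = c \<or> f k = c + 1" if "k < r" for k using cmin[OF that] le[OF that] by linarith
  have AB: "A \<union> B = {..<r}" "A \<inter> B = {}" "finite A" "finite B"
    using cc by (auto simp: A_def B_def)
  \<comment> \<open>An index attaining the minimum keeps \<open>card A\<close> below
    \<open>r\<close>, which makes it a genuine remainder.\<close>
  have "k0 \<notin> A" "A \<subseteq> {..<r}" using k0(2) unfolding A_def by auto
  then have "A \<subset> {..<r}" using k0(1) by blast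
  then have cA: "card A < r" using psubset_card_mono[of "{..<r}" A] by simp
  have "a = sum f A + sum f B" unfolding a_def AB(1)[symmetric] using AB by (intro sum.union_disjoint)
  also have "sum f A = (\<Sum>k\<in>A. c + 1)" by (intro sum.cong) (auto simp: A_def)
  also have "sum f B = (\<Sum>k\<in>B. c)" by (intro sum.cong) (auto simp: B_def)
  finally have "a = (card A + card B) * c + card A" by (simp add: algebra_simps)
  moreover have rAB: "card A + card B = r"
    using card_Un_disjoint[OF AB(3,4,2)] by (simp add: AB(1))
  ultimately have ar: "a = r * c + card A" by (simp only:)
  have div: "a div r = c" "a mod r = card A" using cA r by (auto simp: ar)
  have "card {..<card A} = card A" by simp
  then obtain p1 where p1: "bij_betw p1 {..<card A} A" using AB finite_same_card_bij by blast
  have "card {card A..<r} = card B" using rAB by simp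
  then obtain p2 where p2: "bij_betw p2 {card A..<r} B" using AB finite_same_card_bij by blast
  define p where "p k = (if k < card A then p1 k else p2 k)" for k
  have "bij_betw p {..<card A} A" using p1 by (rule bij_betw_cong[THEN iffD1, rotated]) (auto simp: p_def)
  moreover have "bij_betw p {card A..<r} B" using p2 by (rule bij_betw_cong[THEN iffD1, rotated]) (auto simp: p_def)
  ultimately have "bij_betw p ({..<card A} \<union> {card A..<r}) (A \<union> B)"
    using AB by (intro bij_betw_combine) auto
  moreover have "{..<card A} \<union> {card A..<r} = {..<r}" using cA by auto
  ultimately have "bij_betw p {..<r} {..<r}" using AB by simp
  moreover have "f (p k) = bal r a k" if "k < r" for k
  proof (cases "k < card A")
    case True
    then have "p k \<in> A" using p1 by (auto simp: p_def bij_betw_def)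
    then show ?thesis using True by (simp add: bal_def div A_def)
  next
    case False
    then have "p k \<in> B" using p2 that by (auto simp: p_def bij_betw_def)
    then show ?thesis using False by (simp add: bal_def div B_def)
  qed
  ultimately show ?thesis using that unfolding a_def by blast
qed

text \<open>A move by \<open>facs_move\<close> preserves the sum of the degrees and lowers the sum
  of their squares, so repeated moves end in degrees that differ by at most one. Idempotence of the
  closure composes the moves.\<close>

lemma facs_balance:
  assumes r: "0 < r" and fd: "\<And>k. k < r \<Longrightarrow> f k \<le> d"
  shows "facs m n r d f \<subseteq> pm_closure m n d (facs m n r d (bal r (sum f {..<r})))"
  using fd
proof (induction "\<Sum>k<r. (f k)\<^sup>2" arbitrary: f rule: less_induct)
  case less
  show ?case
  proof (cases "\<forall>k<r. \<forall>l<r. f k \<le> f l + 1")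
    case True
    then obtain p where p: "bij_betw p {..<r} {..<r}" "\<And>k. k < r \<Longrightarrow> f (p k) = bal r (sum f {..<r}) k"
      using balanced_permute[OF r, of f] by blast
    have "facs m n r d f \<subseteq> facs m n r d (\<lambda>k. f (p k))" by (rule facs_permute[OF p(1)])
    also have "\<dots> = facs m n r d (bal r (sum f {..<r}))" using p(2) by (intro facs_cong)
    finally have *: "facs m n r d f \<subseteq> facs m n r d (bal r (sum f {..<r}))" .
    show ?thesis
    proof
      fix P assume "P \<in> facs m n r d f"
      with * facs_subset_polymats[of r f d] less.prems
      have "P \<in> polymats m n d" "P \<in> facs m n r d (bal r (sum f {..<r}))" by blast+
      then show "P \<in> pm_closure m n d (facs m n r d (bal r (sum f {..<r})))"
        unfolding pm_closure_iff by (auto intro!: bexI[of _ P])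
    qed
  next
    case False
    then obtain k1 k2 where k: "k1 < r" "k2 < r" "f k1 \<ge> f k2 + 2" by force
    then have ne: "k1 \<noteq> k2" by auto
    define f' where "f' = f(k1 := f k1 - 1, k2 := f k2 + 1)"
    have split: "sum g {..<r} = g k1 + g k2 + sum g ({..<r} - {k1,k2})" for g :: "nat \<Rightarrow> nat"
    proof -
      have "{..<r} = insert k1 (insert k2 ({..<r} - {k1,k2}))" using k by auto
      then have "sum g {..<r} = sum g (insert k1 (insert k2 ({..<r} - {k1,k2})))" by simp
      also have "\<dots> = g k1 + g k2 + sum g ({..<r} - {k1,k2})" using ne by (simp add: algebra_simps)
      finally show ?thesis .
    qed
    have rest: "(\<Sum>k\<in>{..<r} - {k1,k2}. h (f' k)) = (\<Sum>k\<in>{..<r} - {k1,k2}. h (f k))" for h :: "nat \<Rightarrow> nat"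
      by (intro sum.cong) (auto simp: f'_def)
    have s: "sum f' {..<r} = sum f {..<r}"
      using rest[of "\<lambda>x. x"] k ne unfolding split[of f] split[of f'] by (simp add: f'_def)
    obtain u where u: "f k1 = f k2 + 2 + u" using k(3) le_Suc_ex by blast
    have "(\<Sum>k<r. (f' k)\<^sup>2) < (\<Sum>k<r. (f k)\<^sup>2)"
      using rest[of "\<lambda>x. x\<^sup>2"] ne u unfolding split[of "\<lambda>k. (f k)\<^sup>2"] split[of "\<lambda>k. (f' k)\<^sup>2"]
      by (simp add: f'_def power2_eq_square algebra_simps)
    moreover have f'd: "f' k \<le> d" if "k < r" for k
      using less.prems[OF that] less.prems[OF k(1)] k(3) by (auto simp: f'_def)
    ultimately have "facs m n r d f' \<subseteq> pm_closure m n d (facs m n r d (bal r (sum f {..<r})))"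
      using less.hyps[of f'] s by simp
    moreover have "facs m n r d f \<subseteq> pm_closure m n d (facs m n r d f')"
      unfolding f'_def using k less.prems by (intro facs_move) auto
    ultimately show ?thesis using pm_closure_subset_closureI by blast
  qed
qed

text \<open>An elementary column operation on \<open>L\<close>, compensated by the inverse row
  operation on \<open>R\<close>: column \<open>k0\<close> is traded for a combination
  \<open>A\<close> of all columns in which it has weight 1.\<close>

lemma sum_mult_replace:
  fixes L :: "'a \<Rightarrow> 'k \<Rightarrow> 'c::comm_ring_1"
  assumes "finite K" "k0 \<in> K"
    and "L i k0 = A i - (\<Sum>k\<in>K - {k0}. G k * L i k)"
  shows "(\<Sum>k\<in>K. L i k * R k j) = A i * R k0 j + (\<Sum>k\<in>K - {k0}. L i k * (R k j - G k * R k0 j))"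
proof -
  have "(\<Sum>k\<in>K. L i k * R k j) = L i k0 * R k0 j + (\<Sum>k\<in>K - {k0}. L i k * R k j)"
    using assms by (simp add: sum.remove)
  then show ?thesis
    by (simp add: assms(3) algebra_simps sum_distrib_left sum_distrib_right sum_subtractf)
qed

lemma sum_mult_replace':
  fixes L :: "'a \<Rightarrow> nat \<Rightarrow> 'c::comm_ring_1"
  assumes "k0 < r" and "L i k0 = A i - (\<Sum>k\<in>{..<r} - {k0}. G k * L i k)"
  shows "(\<Sum>k<r. L i k * R k j) = 
    (\<Sum>k<r. (if k = k0 then A i else L i k) * (if k = k0 then R k0 j else R k j - G k * R k0 j))"
proof -
  have "(\<Sum>k<r. (if k = k0 then A i else L i k) * (if k = k0 then R k0 j else R k j - G k * R k0 j))
     = A i * R k0 j + (\<Sum>k\<in>{..<r} - {k0}. L i k * (R k j - G k * R k0 j))"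
    using assms(1) by (subst sum.remove[of _ k0]) (auto intro!: sum.cong)
  then show ?thesis using sum_mult_replace[of "{..<r}" k0 L i A G R j] assms by simp
qed

section \<open>Polynomial rank factorizations\<close>

lemma coeff_mult_at_bounds:
  fixes p q :: "'a::comm_semiring_0 poly"
  assumes "degree p \<le> a" "degree q \<le> b"
  shows "coeff (p * q) (a + b) = coeff p a * coeff q b"
proof -
  have "coeff p i * coeff q (a + b - i) = (if i = a then coeff p a * coeff q b else 0)" if "i \<le> a + b" for i
  proof (cases i a rule: linorder_cases)
    case less
    then have "degree q < a + b - i" using assms by linarith
    then show ?thesis using less by (simp add: coeff_eq_0)
  next
    case greater
    then have "degree p < i" using assms by linarith
    then show ?thesis using greater by (simp add: coeff_eq_0)
  qed simp
  then have "coeff (p * q) (a + b) = (\<Sum>i\<le>a + b. if i = a then coeff p a * coeff q b else 0)"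
    unfolding coeff_mult by (intro sum.cong) auto
  then show ?thesis by simp
qed

lemma finite_has_maximal_value:
  fixes e :: "'a \<Rightarrow> 'b::linorder"
  assumes "finite J" "J \<noteq> {}"
  obtains k0 where "k0 \<in> J" "\<And>k. k \<in> J \<Longrightarrow> e k \<le> e k0"
proof -
  have "Max (e ` J) \<in> e ` J" using assms by (intro Max_in) auto
  then obtain k0 where "k0 \<in> J" "e k0 = Max (e ` J)" by auto
  with that show ?thesis using assms(1) by (metis Max_ge finite_imageI imageI)
qed

text \<open>If the largest \<open>e k + f k\<close> exceeds \<open>d\<close>, the leading coefficients satisfy a linear relation, which
  lowers one of the factors without raising the other degrees.\<close>

lemma degree_reduction:
  fixes L :: "nat \<Rightarrow> nat \<Rightarrow> 'a::field poly"
  assumes P: "\<And>i j. i < m \<Longrightarrow> j < n \<Longrightarrow> P i j = (\<Sum>k<r. L i k * R k j)"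
    and dP: "\<And>i j. i < m \<Longrightarrow> j < n \<Longrightarrow> degree (P i j) \<le> d"
    and dL: "\<And>i k. i < m \<Longrightarrow> k < r \<Longrightarrow> degree (L i k) \<le> e k"
    and dR: "\<And>k j. k < r \<Longrightarrow> j < n \<Longrightarrow> degree (R k j) \<le> f k"
  shows "\<exists>L' R' f'. (\<forall>i<m. \<forall>j<n. P i j = (\<Sum>k<r. L' i k * R' k j)) \<and>
     (\<forall>k<r. f' k \<le> d \<and> (\<forall>i<m. degree (L' i k) \<le> d - f' k) \<and> (\<forall>j<n. degree (R' k j) \<le> f' k))"
  using P dL dR
proof (induction "\<Sum>k<r. e k + f k" arbitrary: e f L R rule: less_induct)
  case less
  note P = less.prems(1) and dL = less.prems(2) and dR = less.prems(3)
  show ?case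
  proof (cases "\<forall>k<r. e k + f k \<le> d")
    case True
    then have "degree (L i k) \<le> d - f k" if "i < m" "k < r" for i k
      using dL[OF that] that by (metis add_le_imp_le_diff order_trans)
    moreover have "f k \<le> d" if "k < r" for k using True that by force
    ultimately show ?thesis using P dR by blast
  next
    case False
    have dec: "(\<Sum>k<r. e' k + f' k) < (\<Sum>k<r. e k + f k)"
      if "k0 < r" "e' k0 + f' k0 < e k0 + f k0" "\<And>k. k \<noteq> k0 \<Longrightarrow> e' k + f' k \<le> e k + f k" for e' f' k0
      using that by (intro sum_strict_mono_ex1) (auto, metis le_less)
    define D where "D = Max ((\<lambda>k. e k + f k) ` {..<r})"
    have Dle: "e k + f k \<le> D" if "k < r" for k using that by (simp add: D_def)
    have "(\<lambda>k. e k + f k) ` {..<r} \<noteq> {}" using False by auto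
    then have "D \<in> (\<lambda>k. e k + f k) ` {..<r}" unfolding D_def by (intro Max_in) auto
    then obtain k1 where k1: "k1 < r" "e k1 + f k1 = D" by auto
    have Dd: "D > d" using False Dle by (meson le_trans not_le)
    define I where "I = {k\<in>{..<r}. e k + f k = D}"
    have [simp]: "finite I" by (simp add: I_def)
    have rel: "(\<Sum>k\<in>I. coeff (L i k) (e k) * coeff (R k j) (f k)) = 0" if ij: "i < m" "j < n" for i j
    proof -
      have "coeff (L i k * R k j) D = (if k \<in> I then coeff (L i k) (e k) * coeff (R k j) (f k) else 0)" if "k < r" for k
      proof (cases "k \<in> I")
        case True
        then show ?thesis using coeff_mult_at_bounds[OF dL[OF ij(1) that] dR[OF that ij(2)]] by (simp add: I_def)
      next
        case False
        then have "e k + f k < D" using Dle[OF that] that by (auto simp: I_def)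
        then have "degree (L i k * R k j) < D"
          using degree_mult_le[of "L i k" "R k j"] dL[OF ij(1) that] dR[OF that ij(2)] by linarith
        then show ?thesis using False by (simp add: coeff_eq_0)
      qed
      then have "coeff (P i j) D = (\<Sum>k<r. if k \<in> I then coeff (L i k) (e k) * coeff (R k j) (f k) else 0)"
        by (simp add: P[OF ij] coeff_sum)
      also have "\<dots> = (\<Sum>k\<in>I. coeff (L i k) (e k) * coeff (R k j) (f k))"
        by (subst sum.inter_restrict[symmetric]) (auto simp: I_def intro!: sum.cong)
      finally show ?thesis using dP[OF ij] Dd by (simp add: coeff_eq_0)
    qed
    show ?thesis
    proof (cases "\<exists>j<n. coeff (R k1 j) (f k1) \<noteq> 0")
      case False
      \<comment> \<open>The vanishing leading coefficients allow \<open>f k1\<close> to be lowered.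
        At \<open>f k1 = 0\<close> this is impossible, but then row \<open>k1\<close> is zero and
        the bound \<open>e k1\<close> can be set to 0 instead.\<close>
      show ?thesis
      proof (cases "f k1 = 0")
        case True
        have z: "R k1 j = 0" if "j < n" for j
          using False dR[OF k1(1) that] True that by (metis degree_0_id coeff_0 degree_eq_zeroE le_zero_eq pCons_0_0 coeff_pCons_0)
        define L' where "L' i k = (if k = k1 then 0 else L i k)" for i k
        have "P i j = (\<Sum>k<r. L' i k * R k j)" if "i < m" "j < n" for i j
          unfolding P[OF that] by (intro sum.cong) (auto simp: L'_def z that)
        moreover have "degree (L' i k) \<le> (e(k1 := 0)) k" if "i < m" "k < r" for i k
          using dL[OF that] by (simp add: L'_def)
        moreover have "(\<Sum>k<r. (e(k1 := 0)) k + f k) < (\<Sum>k<r. e k + f k)"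
          using k1 Dd True by (intro dec[OF k1(1)]) auto
        ultimately show ?thesis using less.hyps[of "e(k1 := 0)" f L' R] dR by blast
      next
        case fk: False
        have "degree (R k j) \<le> (f(k1 := f k1 - 1)) k" if "k < r" "j < n" for k j
          using dR[OF that] False that degree_le_pred by auto
        moreover have "(\<Sum>k<r. e k + (f(k1 := f k1 - 1)) k) < (\<Sum>k<r. e k + f k)"
          using k1 fk by (intro dec[OF k1(1)]) auto
        ultimately show ?thesis using less.hyps[of e "f(k1 := f k1 - 1)" L R] P dL by blast
      qed
    next
      case True
      then obtain j0 where j0: "j0 < n" "coeff (R k1 j0) (f k1) \<noteq> 0" by auto
      define c where "c k = coeff (R k j0) (f k)" for k
      define J where "J = {k\<in>I. c k \<noteq> 0}"
      have [simp]: "finite J" by (simp add: J_def)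
      have "k1 \<in> J" using k1 j0 by (simp add: J_def I_def c_def)
      \<comment> \<open>Maximality of \<open>e k0\<close> makes the exponents in \<open>G\<close>
        nonnegative. Since \<open>e k + f k = D\<close> on \<open>J\<close>, subtracting
        \<open>G k\<close> times row \<open>k0\<close> respects the bound
        \<open>f k\<close>.\<close>
      then obtain k0 where k0: "k0 \<in> J" "\<And>k. k \<in> J \<Longrightarrow> e k \<le> e k0"
        using finite_has_maximal_value[of J e] by auto
      have k0r: "k0 < r" and ck0: "c k0 \<noteq> 0" and k0D: "e k0 + f k0 = D" using k0(1) by (auto simp: J_def I_def)
      define G where "G k = (if k \<in> J then monom (c k / c k0) (e k0 - e k) else 0)" for k
      define A where "A i = (\<Sum>k<r. G k * L i k)" for i
      have dGL: "degree (G k * L i k) \<le> e k0" if "i < m" "k < r" for i k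
      proof (cases "k \<in> J")
        case True
        have "degree (G k) \<le> e k0 - e k" by (simp add: G_def degree_monom_le)
        then show ?thesis using degree_mult_le[of "G k" "L i k"] dL[OF that] k0(2)[OF True] by linarith
      qed (simp add: G_def)
      have dA: "degree (A i) \<le> e k0" if "i < m" for i
        unfolding A_def using dGL[OF that] by (intro degree_sum_le) auto
      have cA: "coeff (A i) (e k0) = 0" if "i < m" for i
      proof -
        have "coeff (G k * L i k) (e k0) = (if k \<in> I then c k / c k0 * coeff (L i k) (e k) else 0)" if "k < r" for k
          using k0(2)[of k] by (auto simp: G_def coeff_monom_mult J_def)
        then have "coeff (A i) (e k0) = (\<Sum>k<r. if k \<in> I then c k / c k0 * coeff (L i k) (e k) else 0)"
          by (simp add: A_def coeff_sum)
        also have "\<dots> = (\<Sum>k\<in>I. c k / c k0 * coeff (L i k) (e k))"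
          by (subst sum.inter_restrict[symmetric]) (auto simp: I_def intro!: sum.cong)
        also have "\<dots> = (\<Sum>k\<in>I. coeff (L i k) (e k) * coeff (R k j0) (f k)) / c k0"
          by (simp add: c_def sum_divide_distrib mult.commute)
        finally show ?thesis using rel[OF that j0(1)] by simp
      qed
      have dA': "degree (A i) \<le> e k0 - 1" if "i < m" for i
        using degree_le_pred[OF dA[OF that] cA[OF that]] .
      have A0: "A i = 0" if "i < m" "e k0 = 0" for i
        using dA[OF that(1)] cA[OF that(1)] that(2) by (metis degree_eq_zeroE le_zero_eq pCons_0_0 coeff_pCons_0)
      have "G k0 = 1" using k0(1) ck0 by (simp add: G_def)
      then have LA: "L i k0 = A i - (\<Sum>k\<in>{..<r} - {k0}. G k * L i k)" for i
        unfolding A_def using k0r by (subst sum.remove[of _ k0]) auto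
      define L' where "L' i k = (if k = k0 then A i else L i k)" for i k
      \<comment> \<open>If \<open>e k0 = 0\<close>, the new column \<open>A\<close> is zero and its
        bound cannot drop; the matching row is then erased and \<open>f k0\<close> drops to
        0.\<close>
      define R0 where "R0 j = (if e k0 = 0 then 0 else R k0 j)" for j
      define R' where "R' k j = (if k = k0 then R0 j else R k j - G k * R k0 j)" for k j
      define e' where "e' = e(k0 := e k0 - 1)"
      define f' where "f' = f(k0 := if e k0 = 0 then 0 else f k0)"
      have "P i j = (\<Sum>k<r. L' i k * R' k j)" if "i < m" "j < n" for i j
        unfolding P[OF that] sum_mult_replace'[where A = A and G = G and L = L, OF k0r LA]
        by (intro sum.cong) (auto simp: L'_def R'_def R0_def A0 that)
      moreover have "degree (L' i k) \<le> e' k" if "i < m" "k < r" for i k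
        using dL[OF that] dA'[OF that(1)] by (simp add: L'_def e'_def)
      moreover have "degree (R' k j) \<le> f' k" if "k < r" "j < n" for k j
      proof (cases "k = k0")
        case True
        then show ?thesis using dR[OF that] by (simp add: R'_def R0_def f'_def)
      next
        case False
        have "degree (G k * R k0 j) \<le> f k"
        proof (cases "k \<in> J")
          case True
          then have "e k + f k = D" by (simp add: J_def I_def)
          then have "e k0 - e k + f k0 = f k" using k0D k0(2)[OF True] by linarith
          moreover have "degree (G k) \<le> e k0 - e k" by (simp add: G_def degree_monom_le)
          ultimately show ?thesis using degree_mult_le[of "G k" "R k0 j"] dR[OF k0r that(2)] by linarith
        qed (simp add: G_def)
        then show ?thesis using dR[OF that] False by (simp add: R'_def f'_def degree_diff_le)
      qed
      moreover have "(\<Sum>k<r. e' k + f' k) < (\<Sum>k<r. e k + f k)"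
        using k0D Dd by (intro dec[OF k0r]) (auto simp: e'_def f'_def)
      ultimately show ?thesis using less.hyps[of e' f' L' R'] by blast
    qed
  qed
qed

lemma degree_linear_mult:
  fixes p :: "'a::idom poly"
  assumes "p \<noteq> 0"
  shows "degree ([:-z, 1:] * p) = degree p + 1"
  using degree_mult_eq[of "[:-z, 1:]" p] assms by simp

text \<open>At a root \<open>z\<close> of \<open>q\<close> either all relevant \<open>R k j\<close> vanish, and \<open>q\<close> loses the root, or the
  columns of \<open>L\<close> are dependent at \<open>z\<close>, and one of maximal degree is replaced by a quotient by
  \<open>\<lambda> - z\<close>.  The bounds \<open>e\<close> are strict so that a column can also drop from degree 0 to zero.\<close>

lemma polynomial_factorization:
  fixes L :: "nat \<Rightarrow> nat \<Rightarrow> 'a::alg_closed_field poly"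
  assumes "q \<noteq> 0" and "\<And>i j. i < m \<Longrightarrow> j < n \<Longrightarrow> q * P i j = (\<Sum>k<r. L i k * R k j)"
    and "\<And>i k. i < m \<Longrightarrow> k < r \<Longrightarrow> L i k = 0 \<or> degree (L i k) < e k"
  shows "\<exists>L' R'. \<forall>i<m. \<forall>j<n. P i j = (\<Sum>k<r. L' i k * R' k j)"
  using assms
proof (induction "degree q + (\<Sum>k<r. e k)" arbitrary: q e L R rule: less_induct)
  case less
  note q0 = less.prems(1) and P = less.prems(2) and dL = less.prems(3)
  show ?case
  proof (cases "degree q = 0")
    case True
    then obtain c where c: "q = [:c:]" by (metis degree_eq_zeroE)
    with q0 have c0: "c \<noteq> 0" by auto
    have "P i j = (\<Sum>k<r. L i k * smult (1 / c) (R k j))" if "i < m" "j < n" for i j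
    proof -
      have "(\<Sum>k<r. L i k * smult (1 / c) (R k j)) = smult (1 / c) (\<Sum>k<r. L i k * R k j)"
        by (induction r) (simp_all add: smult_add_right)
      also have "\<dots> = P i j" using P[OF that, symmetric] c0 by (simp add: c)
      finally show ?thesis by simp
    qed
    then show ?thesis by (intro exI[of _ L] exI[of _ "\<lambda>k j. smult (1 / c) (R k j)"]) simp
  next
    case False
    then obtain z where z: "poly q z = 0" using alg_closed_imp_poly_has_root[of q] by auto
    \<comment> \<open>Products with \<open>[:-z, 1:]\<close> have to stay factored so that the root
      can be cancelled.\<close>
    note [simp del] = mult_pCons_left
    from z obtain q' where q': "q = [:-z, 1:] * q'" by (auto simp: poly_eq_0_iff_dvd)
    have q'0: "q' \<noteq> 0" using q0 q' by auto
    have dq': "degree q = degree q' + 1" unfolding q' by (rule degree_linear_mult[OF q'0])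
    show ?thesis
    proof (cases "\<exists>k<r. \<exists>j<n. (\<exists>i<m. L i k \<noteq> 0) \<and> poly (R k j) z \<noteq> 0")
      case False
      define R' where "R' k j = R k j div [:-z, 1:]" for k j
      have "q' * P i j = (\<Sum>k<r. L i k * R' k j)" if ij: "i < m" "j < n" for i j
      proof -
        have "L i k * R k j = [:-z, 1:] * (L i k * R' k j)" if "k < r" for k
        proof (cases "L i k = 0")
          case nz: False
          then have "poly (R k j) z = 0" using False that ij by blast
          then have "[:-z, 1:] dvd R k j" by (simp add: poly_eq_0_iff_dvd)
          then have "R k j = [:-z, 1:] * R' k j" by (simp add: R'_def)
          then show ?thesis by (metis mult.left_commute)
        qed simp
        then have "(\<Sum>k<r. L i k * R k j) = [:-z, 1:] * (\<Sum>k<r. L i k * R' k j)"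
          unfolding sum_distrib_left by (intro sum.cong) auto
        then have "[:-z, 1:] * (q' * P i j) = [:-z, 1:] * (\<Sum>k<r. L i k * R' k j)"
          using P[OF ij] by (simp only: q' mult.assoc)
        then show ?thesis by (subst (asm) mult_cancel_left) simp
      qed
      then show ?thesis using less.hyps[of q' e L R'] q'0 dL dq' by simp
    next
      case True
      then obtain k1 j0 where k1: "k1 < r" "j0 < n" "\<exists>i<m. L i k1 \<noteq> 0" "poly (R k1 j0) z \<noteq> 0" by auto
      \<comment> \<open>Zero columns get weight 0, so the column \<open>k0\<close> chosen below is
        nonzero and its strict bound \<open>e k0\<close> is positive, which leaves room for the
        decrease.\<close>
      define c where "c k = (if \<exists>i<m. L i k \<noteq> 0 then poly (R k j0) z else 0)" for k
      define J where "J = {k\<in>{..<r}. c k \<noteq> 0}"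
      have [simp]: "finite J" by (simp add: J_def)
      have "k1 \<in> J" using k1 by (auto simp: J_def c_def)
      then obtain k0 where k0: "k0 \<in> J" "\<And>k. k \<in> J \<Longrightarrow> e k \<le> e k0"
        using finite_has_maximal_value[of J e] by auto
      have k0r: "k0 < r" and ck0: "c k0 \<noteq> 0" using k0(1) by (auto simp: J_def)
      obtain i0 where "i0 < m" "L i0 k0 \<noteq> 0" using ck0 by (auto simp: c_def split: if_splits)
      then have e0: "e k0 > 0" using dL[of i0 k0] k0r by auto
      define G where "G k = [:c k / c k0:]" for k
      define N where "N i = (\<Sum>k<r. G k * L i k)" for i
      define A where "A i = N i div [:-z, 1:]" for i
      have dN: "degree (N i) \<le> e k0 - 1" if "i < m" for i
        unfolding N_def
      proof (intro degree_sum_le)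
        fix k assume "k \<in> {..<r}"
        then have k: "k < r" by simp
        show "degree (G k * L i k) \<le> e k0 - 1"
        proof (cases "k \<in> J")
          case True
          then show ?thesis using k0(2)[OF True] dL[OF that k] by (auto simp: G_def mult_pCons_left intro: order_trans[OF degree_smult_le])
        next
          case False
          then show ?thesis using k by (simp add: G_def J_def)
        qed
      qed simp
      have "poly (N i) z = 0" if "i < m" for i
      proof -
        have "poly (N i) z = (\<Sum>k<r. poly (L i k) z * poly (R k j0) z) / c k0"
          unfolding N_def poly_sum sum_divide_distrib
          using that by (intro sum.cong) (auto simp: G_def c_def)
        also have "(\<Sum>k<r. poly (L i k) z * poly (R k j0) z) = poly (q * P i j0) z"
          by (simp add: P[OF that k1(2)] poly_sum)
        also have "\<dots> = 0" using z by simp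
        finally show ?thesis by simp
      qed
      then have NA: "N i = [:-z, 1:] * A i" if "i < m" for i
        using that by (simp add: A_def poly_eq_0_iff_dvd)
      have dA: "A i = 0 \<or> degree (A i) < e k0 - 1" if "i < m" for i
        using dN[OF that] unfolding NA[OF that] by (cases "A i = 0") (auto simp: degree_linear_mult)
      have "G k0 = 1" using ck0 by (simp add: G_def one_pCons)
      then have LA: "L i k0 = N i - (\<Sum>k\<in>{..<r} - {k0}. G k * L i k)" for i
        unfolding N_def using k0r by (subst sum.remove[of _ k0]) auto
      define L' where "L' i k = (if k = k0 then A i else L i k)" for i k
      define R' where "R' k j = (if k = k0 then [:-z, 1:] * R k0 j else R k j - G k * R k0 j)" for k j
      have "q * P i j = (\<Sum>k<r. L' i k * R' k j)" if "i < m" "j < n" for i j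
        unfolding P[OF that] sum_mult_replace'[where A = N and G = G and L = L, OF k0r LA]
        by (intro sum.cong) (auto simp: L'_def R'_def NA that algebra_simps)
      moreover have "L' i k = 0 \<or> degree (L' i k) < (e(k0 := e k0 - 1)) k" if "i < m" "k < r" for i k
        using dL[OF that] dA[OF that(1)] by (simp add: L'_def)
      moreover have "(\<Sum>k<r. (e(k0 := e k0 - 1)) k) < (\<Sum>k<r. e k)"
        using e0 k0r by (intro sum_strict_mono_ex1) auto
      ultimately show ?thesis using less.hyps[of q "e(k0 := e k0 - 1)" L' R'] q0 by simp
    qed
  qed
qed

section \<open>Generic minors of convolution matrices\<close>

text \<open>The infinite convolution matrix of \<open>R\<close>: the index \<open>q = i + r e\<close> stands for \<open>\<lambda>\<^sup>e\<close> in row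
  \<open>i\<close> and \<open>J = j + n l\<close> for \<open>\<lambda>\<^sup>l\<close> in column \<open>j\<close>.  With these orderings the balanced degree bounds
  \<^const>\<open>bal\<close> become the single bound \<open>q < a + r\<close>.\<close>

definition sylv :: "nat \<Rightarrow> nat \<Rightarrow> (nat \<Rightarrow> nat \<Rightarrow> 'a::zero poly) \<Rightarrow> nat \<Rightarrow> nat \<Rightarrow> 'a" where
  "sylv r n R q J =
     (if J div n \<le> q div r then coeff (R (q mod r) (J mod n)) (q div r - J div n) else 0)"

text \<open>The only quadratic form in \<open>(q, J)\<close>, up to scaling, that is invariant under the shift
  \<open>(q + r, J + n)\<close>, so that it is a function of the coefficients of \<open>R\<close>; by its cross term the
  identity is the unique permutation of maximal weight.  The constant makes it positive.\<close>

definition weight :: "nat \<Rightarrow> nat \<Rightarrow> nat \<Rightarrow> nat \<Rightarrow> nat \<Rightarrow> int" where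
  "weight r n a q J = (int n * int (a + r))\<^sup>2 + (int r * int n)\<^sup>2 + 1 - (int n * int q - int r * int J)\<^sup>2"

lemma weight_shift:
  "weight r n a (q + r * l) (J + n * l) = weight r n a q J"
  by (simp add: weight_def algebra_simps)

text \<open>Positive exponents make the added powers of \<open>t\<close> vanish at 0 and keep them
  apart from the constant terms in \<open>sylv_poly\<close>.\<close>

lemma weight_pos:
  assumes "q \<le> a + r" "J \<le> n"
  shows "weight r n a q J \<ge> 1"
proof -
  have "(int n * int q - int r * int J)\<^sup>2 \<le> (int n * int q)\<^sup>2 + (int r * int J)\<^sup>2"
    by (simp add: power2_diff)
  also have "(int n * int q)\<^sup>2 \<le> (int n * int (a + r))\<^sup>2"
    using assms by (intro power_mono mult_left_mono) auto
  also have "(int r * int J)\<^sup>2 \<le> (int r * int n)\<^sup>2"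
    using assms by (intro power_mono mult_left_mono) auto
  finally show ?thesis by (simp add: weight_def)
qed

text \<open>A permutation preserves the sums of \<open>J\<close> and of its squares, so only the
  product of \<open>i\<close> and \<open>p i\<close> matters. As in the rearrangement inequality,
  the loss is \<open>n * r\<close> times the sum of the squares of \<open>i - p i\<close>.\<close>

lemma weight_diagonal_max:
  assumes p: "p permutes {0..<k}" and "p \<noteq> id" and "0 < n" "0 < r"
  shows "(\<Sum>i=0..<k. weight r n a (q0 + i) (p i)) < (\<Sum>i=0..<k. weight r n a (q0 + i) i)"
proof -
  let ?S = "{0..<k}"
  have sq: "(\<Sum>i\<in>?S. (int (p i))\<^sup>2) = (\<Sum>i\<in>?S. (int i)\<^sup>2)"
    using sum.permute[OF p, of "\<lambda>i. (int i)\<^sup>2"] by (simp add: o_def)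
  have li: "(\<Sum>i\<in>?S. int (p i)) = (\<Sum>i\<in>?S. int i)"
    using sum.permute[OF p, of "\<lambda>i. int i"] by (simp add: o_def)
  obtain i0 where i0: "p i0 \<noteq> i0" using \<open>p \<noteq> id\<close> by (auto simp: fun_eq_iff)
  then have i0S: "i0 \<in> ?S" using p by (meson permutes_not_in)
  have pt: "weight r n a (q0 + i) i - weight r n a (q0 + i) (p i) =
      (int r)\<^sup>2 * (int (p i))\<^sup>2 - (int r)\<^sup>2 * (int i)\<^sup>2
      + 2 * int n * int r * int q0 * int i - 2 * int n * int r * int q0 * int (p i)
      + int n * int r * (int i)\<^sup>2 - int n * int r * (int (p i))\<^sup>2
      + int n * int r * (int i - int (p i))\<^sup>2" for i
    by (simp add: weight_def power2_eq_square algebra_simps)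
  have "(\<Sum>i\<in>?S. weight r n a (q0 + i) i) - (\<Sum>i\<in>?S. weight r n a (q0 + i) (p i))
     = int n * int r * (\<Sum>i\<in>?S. (int i - int (p i))\<^sup>2)"
    unfolding sum_subtractf[symmetric] pt
    by (simp add: sum.distrib sum_subtractf sum_distrib_left[symmetric] sq li)
  moreover have "(\<Sum>i\<in>?S. (int i - int (p i))\<^sup>2) > 0"
    using i0 i0S by (intro sum_pos2[of _ i0]) auto
  then have "int n * int r * (\<Sum>i\<in>?S. (int i - int (p i))\<^sup>2) > 0"
    using assms by (intro mult_pos_pos) auto
  ultimately show ?thesis by linarith
qed

lemma coeff_prod_at_bounds:
  fixes g :: "'b \<Rightarrow> 'a::comm_semiring_1 poly"
  assumes "finite A" "\<And>i. i \<in> A \<Longrightarrow> degree (g i) \<le> w i"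
  shows "coeff (\<Prod>i\<in>A. g i) (\<Sum>i\<in>A. w i) = (\<Prod>i\<in>A. coeff (g i) (w i))"
    and "degree (\<Prod>i\<in>A. g i) \<le> (\<Sum>i\<in>A. w i)"
proof -
  have "coeff (\<Prod>i\<in>A. g i) (\<Sum>i\<in>A. w i) = (\<Prod>i\<in>A. coeff (g i) (w i)) \<and> degree (\<Prod>i\<in>A. g i) \<le> (\<Sum>i\<in>A. w i)"
    using assms
  proof (induction A rule: finite_induct)
    case (insert x F)
    then have F: "coeff (\<Prod>i\<in>F. g i) (\<Sum>i\<in>F. w i) = (\<Prod>i\<in>F. coeff (g i) (w i))"
      "degree (\<Prod>i\<in>F. g i) \<le> (\<Sum>i\<in>F. w i)" "degree (g x) \<le> w x" by auto
    show ?case using insert.hyps coeff_mult_at_bounds[OF F(3,2)] F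
        degree_mult_le[of "g x" "\<Prod>i\<in>F. g i"] by simp
  qed simp
  then show "coeff (\<Prod>i\<in>A. g i) (\<Sum>i\<in>A. w i) = (\<Prod>i\<in>A. coeff (g i) (w i))"
    and "degree (\<Prod>i\<in>A. g i) \<le> (\<Sum>i\<in>A. w i)" by auto
qed

text \<open>The convolution matrix of the perturbed factor with the parameter \<open>t\<close> as
  indeterminate. The condition describes the band of positions that hold a coefficient within the
  bounds \<open>bal r a\<close>.\<close>

definition sylv_poly :: "nat \<Rightarrow> nat \<Rightarrow> nat \<Rightarrow> (nat \<Rightarrow> nat \<Rightarrow> complex poly) \<Rightarrow> nat \<Rightarrow> nat \<Rightarrow> complex poly" where
  "sylv_poly r n a R q J =
     (if r * (J div n) \<le> q \<and> q < a + r + r * (J div n)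
      then [:sylv r n R q J:] + monom 1 (nat (weight r n a q J)) else 0)"

text \<open>In the Leibniz expansion the diagonal product has coefficient 1 at degree
  \<open>E\<close>; every other product has smaller degree or contains an entry outside the band. It
  suffices that the diagonal stays in the band.\<close>

lemma sylv_poly_minor_nonzero:
  assumes "0 < n" "0 < r"
    and supp: "\<And>i. i < k \<Longrightarrow> r * (i div n) \<le> q0 + i \<and> q0 + i < a + r + r * (i div n)"
  shows "det (mat k k (\<lambda>(i,J). sylv_poly r n a R (q0 + i) J)) \<noteq> 0"
proof -
  define A where "A = mat k k (\<lambda>(i,J). sylv_poly r n a R (q0 + i) J)"
  define E where "E = (\<Sum>i=0..<k. nat (weight r n a (q0 + i) i))"
  define T where "T p = (\<Prod>i=0..<k. A $$ (i, p i))" for p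
  have wpos: "weight r n a q J \<ge> 1" if "r * (J div n) \<le> q" "q < a + r + r * (J div n)" for q J
  proof -
    \<comment> \<open>Positivity is known for the first block of columns only; shift invariance
      moves \<open>J\<close> there.\<close>
    have "weight r n a q J = weight r n a ((q - r * (J div n)) + r * (J div n)) (J mod n + n * (J div n))"
      using that by simp
    also have "\<dots> = weight r n a (q - r * (J div n)) (J mod n)" by (rule weight_shift)
    also have "\<dots> \<ge> 1" using that assms(1) by (intro weight_pos) auto
    finally show ?thesis .
  qed
  have dS: "degree (sylv_poly r n a R q J) \<le> nat (weight r n a q J)" for q J
    by (auto simp: sylv_poly_def intro!: degree_add_le degree_monom_le)
  have cid: "coeff (T id) E = 1"
  proof -
    have "coeff (T id) E = (\<Prod>i=0..<k. coeff (A $$ (i, i)) (nat (weight r n a (q0 + i) i)))"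
      unfolding T_def E_def by (subst coeff_prod_at_bounds) (auto simp: A_def dS)
    also have "\<dots> = (\<Prod>i=0..<k. 1)"
    proof (intro prod.cong refl)
      fix i assume "i \<in> {0..<k}"
      then have i: "i < k" by simp
      have "weight r n a (q0 + i) i \<ge> 1" using supp[OF i] by (intro wpos) auto
      then have "nat (weight r n a (q0 + i) i) = Suc (nat (weight r n a (q0 + i) i - 1))" by simp
      then show "coeff (A $$ (i, i)) (nat (weight r n a (q0 + i) i)) = 1"
        using i supp[OF i] by (simp add: A_def sylv_poly_def coeff_pCons)
    qed
    finally show ?thesis by simp
  qed
  have cnid: "coeff (T p) E = 0" if p: "p permutes {0..<k}" "p \<noteq> id" for p
  proof (cases "\<forall>i<k. r * (p i div n) \<le> q0 + i \<and> q0 + i < a + r + r * (p i div n)")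
    case True
    have pk: "p i < k" if "i < k" for i using permutes_in_image[OF p(1), of i] that by simp
    have "degree (T p) \<le> (\<Sum>i=0..<k. nat (weight r n a (q0 + i) (p i)))"
      unfolding T_def using pk by (intro coeff_prod_at_bounds) (auto simp: A_def dS)
    moreover have "(\<Sum>i=0..<k. nat (weight r n a (q0 + i) (p i))) < E"
    proof -
      have "int (\<Sum>i=0..<k. nat (weight r n a (q0 + i) (p i))) = (\<Sum>i=0..<k. weight r n a (q0 + i) (p i))"
        unfolding of_nat_sum using True wpos by (intro sum.cong) (auto intro: order_trans[of 0 1])
      also have "\<dots> < (\<Sum>i=0..<k. weight r n a (q0 + i) i)"
        using weight_diagonal_max[OF p assms(1,2)] .
      also have "\<dots> = int E"
        unfolding E_def of_nat_sum using supp wpos by (intro sum.cong) (auto intro: order_trans[of 0 1])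
      finally show ?thesis by (simp only: of_nat_less_iff)
    qed
    ultimately show ?thesis by (intro coeff_eq_0) simp
  next
    case False
    then obtain i where i: "i < k" "\<not> (r * (p i div n) \<le> q0 + i \<and> q0 + i < a + r + r * (p i div n))" by auto
    have "p i < k" using permutes_in_image[OF p(1), of i] i by simp
    then have "A $$ (i, p i) = 0" using i by (auto simp: A_def sylv_poly_def)
    then have "T p = 0" unfolding T_def using i by (intro prod_zero) auto
    then show ?thesis by simp
  qed
  have [simp]: "finite {p. p permutes {0..<k}}" by (rule finite_permutations) simp
  have "coeff (signof p * T p) E = (if p = id then 1 else 0)" if "p permutes {0..<k}" for p
    using cid cnid[OF that] by (auto simp: sign_def)
  moreover have "det A = (\<Sum>p | p permutes {0..<k}. signof p * T p)"
    unfolding T_def by (rule det_def') (simp add: A_def)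
  ultimately have "coeff (det A) E = (\<Sum>p | p permutes {0..<k}. if p = id then 1 else 0)"
    by (simp add: coeff_sum)
  also have "\<dots> = 1" by (simp add: permutes_id)
  finally show ?thesis unfolding A_def by auto
qed

text \<open>A coefficient of \<open>R\<close> recurs in the convolution matrix under block shifts.
  The weight is shift invariant, so one power of \<open>t\<close> added to the coefficient is the
  right one in all these places.\<close>

definition perturb :: "nat \<Rightarrow> nat \<Rightarrow> nat \<Rightarrow> (nat \<Rightarrow> nat) \<Rightarrow> (nat \<Rightarrow> nat \<Rightarrow> complex poly) \<Rightarrow> complex \<Rightarrow> nat \<Rightarrow> nat \<Rightarrow> complex poly" where
  "perturb r n a f R t i j = R i j + (\<Sum>e\<le>f i. monom (t ^ nat (weight r n a (i + r * e) j)) e)"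

lemma coeff_perturb:
  "coeff (perturb r n a f R t i j) e =
     coeff (R i j) e + (if e \<le> f i then t ^ nat (weight r n a (i + r * e) j) else 0)"
  by (simp add: perturb_def coeff_sum if_distrib cong: if_cong)

lemma degree_perturb: "degree (R i j) \<le> f i \<Longrightarrow> degree (perturb r n a f R t i j) \<le> f i"
  unfolding perturb_def by (intro degree_add_le degree_sum_le) (auto intro: order_trans[OF degree_monom_le])

text \<open>The numbers below \<open>a + r\<close>, read as \<open>i + r * e\<close>, enumerate
  exactly the coefficients permitted by the balanced bounds.\<close>

lemma bal_le_iff:
  assumes "0 < r" "i < r"
  shows "e \<le> bal r a i \<longleftrightarrow> i + r * e < a + r"
proof -
  define c where "c = a div r"
  define t where "t = a mod r"
  have a: "a = r * c + t" by (simp add: c_def t_def)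
  have t: "t < r" using assms by (simp add: t_def)
  show ?thesis
  proof (cases "i < t")
    case True
    have "e \<le> c + 1 \<longleftrightarrow> r * e \<le> r * (c + 1)" using nat_mult_le_cancel1[of r e "c + 1"] assms by blast
    moreover have "r * e \<le> r * (c + 1) \<longleftrightarrow> r * e < r * (c + 1) + (t - i)"
    proof
      assume "r * e < r * (c + 1) + (t - i)"
      then have "r * e < r * (c + 1) + r" using t by linarith
      then have "r * e < r * (c + 2)" by (simp add: algebra_simps)
      then have "e < c + 2" using nat_mult_less_cancel1[of r e "c + 2"] assms by blast
      then show "r * e \<le> r * (c + 1)" by (intro mult_le_mono2) simp
    qed (use True in auto)
    moreover have "i + r * e < a + r \<longleftrightarrow> r * e < r * (c + 1) + (t - i)"
      using True by (auto simp: a distrib_left)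
    moreover have "bal r a i = c + 1" using True by (simp add: bal_def c_def t_def)
    ultimately show ?thesis by simp
  next
    case False
    have "e \<le> c \<longleftrightarrow> r * e < r * (c + 1)" using nat_mult_less_cancel1[of r e "c + 1"] assms by auto
    moreover have "r * e < r * (c + 1) \<longleftrightarrow> i + r * e < r * c + t + r"
    proof
      assume "r * e < r * (c + 1)"
      then have "e < c + 1" using nat_mult_less_cancel1[of r e "c + 1"] assms by blast
      then have "r * e \<le> r * c" by simp
      then show "i + r * e < r * c + t + r" using assms by linarith
    next
      assume "i + r * e < r * c + t + r"
      then show "r * e < r * (c + 1)" using False by (simp add: algebra_simps)
    qed
    moreover have "bal r a i = c" using False by (simp add: bal_def c_def t_def)
    ultimately show ?thesis by (simp add: a)
  qed
qed

text \<open>Inside the band, shifting back by \<open>l\<close> blocks turns the weight into the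
  exponent used by \<open>perturb\<close>. Outside it both sides vanish: the power would be negative
  or exceed the degree bound.\<close>

lemma poly_sylv_poly:
  assumes nr: "0 < n" "0 < r"
    and dR: "\<And>i j. i < r \<Longrightarrow> j < n \<Longrightarrow> degree (R i j) \<le> bal r a i"
  shows "poly (sylv_poly r n a R q J) t = sylv r n (perturb r n a (bal r a) R t) q J"
proof -
  define l where "l = J div n"
  define i where "i = q mod r"
  define e where "e = q div r - l"
  have i: "i < r" and j: "J mod n < n" using nr by (auto simp: i_def)
  have q: "q = i + r * (q div r)" by (simp add: i_def)
  show ?thesis
  proof (cases "l \<le> q div r")
    case False
    then have "q < r * l" using nr by (metis div_less_iff_less_mult mult.commute not_le)
    then show ?thesis using False by (simp add: sylv_poly_def sylv_def l_def)
  next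
    case True
    then have "r * l \<le> r * (q div r)" by simp
    then have rl: "r * l \<le> q" using times_div_less_eq_dividend[of r q] by linarith
    have "q div r = e + l" using True by (simp add: e_def)
    then have qe: "q = i + r * e + r * l" using q by (simp add: distrib_left)
    have "weight r n a q J = weight r n a (i + r * e + r * l) (J mod n + n * l)" using qe by (simp add: l_def)
    also have "\<dots> = weight r n a (i + r * e) (J mod n)" by (rule weight_shift)
    finally have w: "weight r n a q J = weight r n a (i + r * e) (J mod n)" .
    have iff: "q < a + r + r * l \<longleftrightarrow> e \<le> bal r a i" using bal_le_iff[OF nr(2) i, of e a] qe by simp
    show ?thesis
    proof (cases "e \<le> bal r a i")
      case True
      then show ?thesis using rl iff \<open>l \<le> q div r\<close> w
        by (simp add: sylv_poly_def sylv_def coeff_perturb l_def[symmetric] i_def[symmetric] e_def[symmetric] poly_monom)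
    next
      case False
      then have "coeff (R i (J mod n)) e = 0" using dR[OF i j] by (intro coeff_eq_0) linarith
      then show ?thesis using rl iff \<open>l \<le> q div r\<close> False
        by (simp add: sylv_poly_def sylv_def coeff_perturb l_def[symmetric] i_def[symmetric] e_def[symmetric])
    qed
  qed
qed

lemma poly_det: "poly (det A) t = det (map_mat (\<lambda>p. poly p t) A)"
proof -
  interpret comm_ring_hom "\<lambda>p. poly p t" by unfold_locales auto
  show ?thesis by (rule hom_det[symmetric])
qed

lemma perturb_minor_finite:
  assumes nr: "0 < n" "0 < r"
    and dR: "\<And>i j. i < r \<Longrightarrow> j < n \<Longrightarrow> degree (R i j) \<le> bal r a i"
    and supp: "\<And>i. i < k \<Longrightarrow> r * (i div n) \<le> q0 + i \<and> q0 + i < a + r + r * (i div n)"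
  shows "finite {t. det (mat k k (\<lambda>(i,J). sylv r n (perturb r n a (bal r a) R t) (q0 + i) J)) = 0}"
proof -
  let ?A = "mat k k (\<lambda>(i,J). sylv_poly r n a R (q0 + i) J)"
  have "map_mat (\<lambda>p. poly p t) ?A = mat k k (\<lambda>(i,J). sylv r n (perturb r n a (bal r a) R t) (q0 + i) J)" for t
    by (rule eq_matI) (auto simp: poly_sylv_poly[OF nr dR])
  then have "poly (det ?A) t = det (mat k k (\<lambda>(i,J). sylv r n (perturb r n a (bal r a) R t) (q0 + i) J))" for t
    by (simp add: poly_det)
  moreover have "finite {t. poly (det ?A) t = 0}"
    using sylv_poly_minor_nonzero[OF nr supp, where R = R] by (intro poly_roots_finite)
  ultimately show ?thesis by simp
qed

text \<open>The diagonals of the three minors lie in the band. A diagonal advances by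
  \<open>n\<close> rows per block of columns and the band by \<open>r\<close>; because
  \<open>(n - r) * \<alpha>\<close> is at most \<open>a\<close>, the diagonal has not left the band
  in the blocks before \<alpha>.\<close>

lemma sylv_minor_support:
  fixes n r a :: nat
  assumes "0 < r" "r < n"
  defines "\<alpha> \<equiv> a div (n - r)"
  shows "i < a + r * (\<alpha> + 1) \<Longrightarrow> r * (i div n) \<le> 0 + i \<and> 0 + i < a + r + r * (i div n)"
    and "i < n * \<alpha> \<Longrightarrow> r * (i div n) \<le> 0 + i \<and> 0 + i < a + r + r * (i div n)"
    and "i < r \<Longrightarrow> r * (i div n) \<le> a + i \<and> a + i < a + r + r * (i div n)"
    and "n * \<alpha> \<le> a + r * (\<alpha> + 1)"
proof -
  have \<alpha>: "(n - r) * \<alpha> \<le> a" by (simp add: \<alpha>_def)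
  have nr: "n * x = (n - r) * x + r * x" for x :: nat using assms by (simp add: algebra_simps)
  have lower: "r * (i div n) \<le> i" for i
  proof -
    have "r * (i div n) \<le> n * (i div n)" using assms by simp
    then show ?thesis using times_div_less_eq_dividend[of n i] by linarith
  qed
  have early: "i < a + r + r * (i div n)" if "i div n < \<alpha>" for i
  proof -
    have "i < n * (i div n + 1)" using assms
      by (metis add.commute div_less_iff_less_mult less_add_one mult.commute less_trans)
    also have "\<dots> = (n - r) * (i div n + 1) + r * (i div n) + r" by (subst nr) (simp add: algebra_simps)
    also have "(n - r) * (i div n + 1) \<le> (n - r) * \<alpha>" using that by (intro mult_le_mono) auto
    finally show ?thesis using \<alpha> by linarith
  qed
  show A: "n * \<alpha> \<le> a + r * (\<alpha> + 1)" using \<alpha> nr[of \<alpha>] by (simp add: algebra_simps)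
  show "r * (i div n) \<le> 0 + i \<and> 0 + i < a + r + r * (i div n)" if "i < a + r * (\<alpha> + 1)"
  proof (cases "i div n < \<alpha>")
    case True
    then show ?thesis using lower early by simp
  next
    case False
    then have "r * \<alpha> \<le> r * (i div n)" by simp
    moreover have "i < a + r * \<alpha> + r" using that by simp
    ultimately show ?thesis using lower[of i] by linarith
  qed
  show "r * (i div n) \<le> 0 + i \<and> 0 + i < a + r + r * (i div n)" if "i < n * \<alpha>"
    using early[of i] lower[of i] that assms(1,2) by (simp add: div_less_iff_less_mult mult.commute)
  show "r * (i div n) \<le> a + i \<and> a + i < a + r + r * (i div n)" if "i < r"
    using that assms by simp
qed

section \<open>Vector spaces of rational functions and minimal bases\<close>

lemma rf_eq_to_fract: "rf = to_fract"
  by (simp add: fun_eq_iff rf_def to_fract_def)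

lemma clear_denominators:
  fixes u :: "'b \<Rightarrow> 'a::idom fract"
  assumes "finite I"
  obtains q p where "q \<noteq> 0" "\<And>i. i \<in> I \<Longrightarrow> to_fract q * u i = to_fract (p i)"
proof -
  have "\<exists>q p. q \<noteq> 0 \<and> (\<forall>i\<in>I. to_fract q * u i = to_fract (p i))"
    using assms
  proof (induction I rule: finite_induct)
    case (insert x F)
    then obtain q p where q: "q \<noteq> 0" "\<And>i. i \<in> F \<Longrightarrow> to_fract q * u i = to_fract (p i)" by blast
    obtain a b where ab: "u x = Fract a b" "b \<noteq> 0" by (cases "u x") auto
    have "to_fract (q * b) * u i = to_fract ((if i = x then q * a else p i * b))" if "i \<in> insert x F" for i
    proof (cases "i = x")
      case True
      then show ?thesis using ab by (simp add: Fract_conv_to_fract)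
    next
      case False
      then have "to_fract q * u i = to_fract (p i)" using q(2) that by simp
      then show ?thesis using False by (simp add: mult_ac)
    qed
    moreover have "q * b \<noteq> 0" using q ab by simp
    ultimately show ?case
      by (intro exI[of _ "q * b"] exI[of _ "\<lambda>i. if i = x then q * a else p i * b"]) blast
  qed (auto intro: exI[of _ 1])
  then obtain q p where "q \<noteq> 0" "\<And>i. i \<in> I \<Longrightarrow> to_fract q * u i = to_fract (p i)" by auto
  then show ?thesis by (rule that)
qed

section \<open>Square linear systems and determinants\<close>

lemma mat_times_vec_index:
  "i < k \<Longrightarrow> (mat k p (\<lambda>(i,j). M i j) *\<^sub>v vec p x) $ i = (\<Sum>j<p. M i j * x j)"
  by (simp add: scalar_prod_def lessThan_atLeast0)

lemma det_nonzero_solvable: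
  fixes M :: "nat \<Rightarrow> nat \<Rightarrow> 'a::field"
  assumes "det (mat k k (\<lambda>(i,j). M i j)) \<noteq> 0"
  shows "\<exists>x. \<forall>i<k. (\<Sum>j<k. M i j * x j) = b i"
proof -
  let ?A = "mat k k (\<lambda>(i,j). M i j)"
  have A: "?A \<in> carrier_mat k k" by simp
  define y where "y = adj_mat ?A *\<^sub>v (1 / det ?A \<cdot>\<^sub>v vec k b)"
  have y: "y \<in> carrier_vec k" using adj_mat(1)[OF A] by (auto simp: y_def)
  have "?A *\<^sub>v y = (?A * adj_mat ?A) *\<^sub>v (1 / det ?A \<cdot>\<^sub>v vec k b)"
    unfolding y_def using adj_mat(1)[OF A] by (intro assoc_mult_mat_vec[symmetric, where n\<^sub>2 = k and n\<^sub>3 = k]) auto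
  also have "\<dots> = vec k b"
    unfolding adj_mat(2)[OF A] using assms by (intro eq_vecI) (auto simp: row_smult)
  finally have "?A *\<^sub>v y = vec k b" .
  moreover have "y = vec k (\<lambda>j. y $ j)" using y by auto
  ultimately have "?A *\<^sub>v vec k (\<lambda>j. y $ j) = vec k b" by simp
  then have "(\<Sum>j<k. M i j * y $ j) = b i" if "i < k" for i
    using mat_times_vec_index[of i k k M "\<lambda>j. y $ j"] that by simp
  then show ?thesis by blast
qed

lemma det_zero_iff_kernel:
  fixes M :: "nat \<Rightarrow> nat \<Rightarrow> 'a::idom"
  shows "det (mat k k (\<lambda>(i,j). M i j)) = 0 \<longleftrightarrow> (\<exists>x. (\<forall>i<k. (\<Sum>j<k. M i j * x j) = 0) \<and> (\<exists>j<k. x j \<noteq> 0))"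
proof -
  let ?A = "mat k k (\<lambda>(i,j). M i j)"
  have A: "?A \<in> carrier_mat k k" by simp
  show ?thesis unfolding det_0_iff_vec_prod_zero[OF A]
  proof
    assume "\<exists>v. v \<in> carrier_vec k \<and> v \<noteq> 0\<^sub>v k \<and> ?A *\<^sub>v v = 0\<^sub>v k"
    then obtain v where v: "v \<in> carrier_vec k" "v \<noteq> 0\<^sub>v k" "?A *\<^sub>v v = 0\<^sub>v k" by auto
    have "v = vec k (\<lambda>j. v $ j)" using v(1) by auto
    then have "(\<Sum>j<k. M i j * v $ j) = 0" if "i < k" for i
      using mat_times_vec_index[of i k k M "\<lambda>j. v $ j"] that v(3) by simp
    moreover have "\<exists>j<k. v $ j \<noteq> 0" using v(1,2) by (metis carrier_vecD eq_vecI index_zero_vec)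
    ultimately show "\<exists>x. (\<forall>i<k. (\<Sum>j<k. M i j * x j) = 0) \<and> (\<exists>j<k. x j \<noteq> 0)"
      by (intro exI[of _ "\<lambda>j. v $ j"]) simp
  next
    assume "\<exists>x. (\<forall>i<k. (\<Sum>j<k. M i j * x j) = 0) \<and> (\<exists>j<k. x j \<noteq> 0)"
    then obtain x j where x: "\<And>i. i < k \<Longrightarrow> (\<Sum>j<k. M i j * x j) = 0" "j < k" "x j \<noteq> 0" by auto
    have "?A *\<^sub>v vec k x = 0\<^sub>v k" using x(1) mat_times_vec_index[of _ k k M x] by (intro eq_vecI) auto
    moreover have "vec k x \<noteq> 0\<^sub>v k" using x(2,3) by (metis index_vec index_zero_vec(1))
    ultimately show "\<exists>v. v \<in> carrier_vec k \<and> v \<noteq> 0\<^sub>v k \<and> ?A *\<^sub>v v = 0\<^sub>v k" by (intro exI[of _ "vec k x"]) auto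
  qed
qed

text \<open>After clearing denominators, the coefficient of largest nominal degree in a relation is
  itself a relation between the leading coefficient vectors.\<close>

lemma independent_if_leading_independent:
  fixes b :: "'b \<Rightarrow> 'c \<Rightarrow> 'a::idom poly"
  assumes fin: "finite I"
    and db: "\<And>j i. j \<in> I \<Longrightarrow> i \<in> T \<Longrightarrow> degree (b j i) \<le> h j"
    and lead: "\<And>c. (\<And>i. i \<in> T \<Longrightarrow> (\<Sum>j\<in>I. c j * coeff (b j i) (h j)) = 0) \<Longrightarrow> \<forall>j\<in>I. c j = 0"
    and zero: "\<And>i. i \<in> T \<Longrightarrow> (\<Sum>j\<in>I. u j * to_fract (b j i)) = 0"
    and j: "j \<in> I"
  shows "u j = 0"
proof -
  obtain q p where q: "q \<noteq> 0" and p: "\<And>i. i \<in> I \<Longrightarrow> to_fract q * u i = to_fract (p i)"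
    using clear_denominators[OF fin] by blast
  have rel: "(\<Sum>j\<in>I. p j * b j i) = 0" if "i \<in> T" for i
  proof -
    have "to_fract (\<Sum>j\<in>I. p j * b j i) = (\<Sum>j\<in>I. to_fract q * u j * to_fract (b j i))"
      by (simp add: p)
    also have "\<dots> = to_fract q * (\<Sum>j\<in>I. u j * to_fract (b j i))" by (simp add: sum_distrib_left mult.assoc)
    finally have "to_fract (\<Sum>j\<in>I. p j * b j i) = 0" by (simp only: zero[OF that] mult_zero_right)
    then show ?thesis by (simp only: to_fract_eq_0_iff)
  qed
  have "p j = 0"
  proof (rule ccontr)
    assume pj: "p j \<noteq> 0"
    define J where "J = {j\<in>I. p j \<noteq> 0}"
    have "finite J" "J \<noteq> {}" using fin j pj by (auto simp: J_def)
    then obtain k where k: "k \<in> J" "\<And>j. j \<in> J \<Longrightarrow> degree (p j) + h j \<le> degree (p k) + h k"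
      using finite_has_maximal_value[of J "\<lambda>j. degree (p j) + h j"] by blast
    define D where "D = degree (p k) + h k"
    \<comment> \<open>Only the terms attaining \<open>D\<close> contribute, each with its leading
      coefficient; for \<open>k\<close> this is nonzero, which contradicts
      \<open>lead\<close>.\<close>
    define c where "c j = (if p j \<noteq> 0 \<and> degree (p j) + h j = D then lead_coeff (p j) else 0)" for j
    have "coeff (p j * b j i) D = c j * coeff (b j i) (h j)" if "j \<in> I" "i \<in> T" for i j
    proof (cases "p j = 0")
      case False
      then have "degree (p j) + h j \<le> D" using k(2)[of j] that by (simp add: J_def D_def)
      then consider "degree (p j) + h j = D" | "degree (p j) + h j < D" by linarith
      then show ?thesis
      proof cases
        case 1
        then show ?thesis using coeff_mult_at_bounds[OF order_refl[of "degree (p j)"] db[OF that]] False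
          by (simp add: c_def)
      next
        case 2
        then have "degree (p j * b j i) < D" using degree_mult_le[of "p j" "b j i"] db[OF that] by linarith
        then show ?thesis using 2 by (simp add: c_def coeff_eq_0)
      qed
    qed (simp add: c_def)
    then have "(\<Sum>j\<in>I. c j * coeff (b j i) (h j)) = 0" if "i \<in> T" for i
      using arg_cong[OF rel[OF that], of "\<lambda>x. coeff x D"] that by (simp add: coeff_sum)
    from lead[OF this] have "c k = 0" using k(1) by (simp add: J_def)
    then show False using k(1) by (simp add: c_def D_def J_def)
  qed
  then show ?thesis using p[OF j] q by simp
qed

text \<open>The Steinitz bound, read off from the rank of the matrix with columns
  \<open>A \<union> B\<close>: \<open>A\<close> is a maximal independent set of its columns.\<close>

lemma (in vec_space) card_indpt_le:
  assumes A: "finite A" "A \<subseteq> carrier_vec n" "lin_indpt A"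
    and B: "finite B" "B \<subseteq> span A" "lin_indpt B"
  shows "card B \<le> card A"
proof -
  have Bc: "B \<subseteq> carrier_vec n" using B(2) A(2) span_closed by blast
  obtain vs where vs: "set vs = A \<union> B" using finite_list[of "A \<union> B"] A B by auto
  define M where "M = mat_of_cols n vs"
  have M: "M \<in> carrier_mat n (length vs)" by (simp add: M_def)
  have cols: "set (cols M) = A \<union> B" using A B Bc vs by (simp add: M_def cols_mat_of_cols)
  have "maximal A (\<lambda>T. T \<subseteq> set (cols M) \<and> lin_indpt T)"
    unfolding maximal_def cols
  proof (intro conjI allI impI)
    fix T assume T: "A \<subseteq> T \<and> T \<subseteq> A \<union> B \<and> lin_indpt T"
    show "T = A"
    proof (rule ccontr)
      assume "T \<noteq> A"
      then obtain t where t: "t \<in> T" "t \<notin> A" using T by auto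
      then have "t \<in> span A" "t \<in> carrier_vec n" using T B Bc by auto
      then have "lin_dep (A \<union> {t})" using lin_dep_iff_in_span[of A t] A t by simp
      moreover have "lin_indpt (A \<union> {t})" by (rule subset_li_is_li[of T]) (use T t in auto)
      ultimately show False by simp
    qed
  qed (use A in auto)
  then have "rank M = card A" by (rule rank_card_indpt[OF M])
  moreover have "card B \<le> rank M" using B by (intro rank_ge_card_indpt[OF M]) (auto simp: cols)
  ultimately show ?thesis by simp
qed

text \<open>Passes from indexed families to the set based notion of independence. Injectivity comes
  along, since two equal vectors give a relation with coefficients 1 and -1.\<close>

lemma (in vec_space) indexed_lin_indpt:
  assumes fin: "finite I" and w: "\<And>j. j \<in> I \<Longrightarrow> w j \<in> carrier_vec n"
    and ind: "\<And>u. (\<And>i. i < n \<Longrightarrow> (\<Sum>j\<in>I. u j * w j $ i) = 0) \<Longrightarrow> \<forall>j\<in>I. u j = 0"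
  shows "inj_on w I" "lin_indpt (w ` I)"
proof -
  show inj: "inj_on w I"
  proof (rule inj_onI, rule ccontr)
    fix j k assume jk: "j \<in> I" "k \<in> I" "w j = w k" "j \<noteq> k"
    have "(\<Sum>l\<in>I. (if l = j then 1 else if l = k then -1 else 0) * w l $ i) = 0" for i
    proof -
      have "(\<Sum>l\<in>I. (if l = j then 1 else if l = k then -1 else 0) * w l $ i)
         = (\<Sum>l\<in>I. (if l = j then w j $ i else 0) + (if l = k then - (w k $ i) else 0))"
        using jk by (intro sum.cong) auto
      also have "\<dots> = w j $ i - w k $ i" using jk fin by (simp add: sum.distrib)
      finally show ?thesis by (simp only: jk(3) diff_self)
    qed
    from bspec[OF ind[OF this] jk(1)] show False by simp
  qed
  show "lin_indpt (w ` I)"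
  proof (rule finite_lin_indpt2)
    fix a assume "lincomb a (w ` I) = 0\<^sub>v n"
    then have "(\<Sum>x\<in>w ` I. a x * x $ i) = 0" if "i < n" for i
      using lincomb_index[OF that, of "w ` I" a] w that by auto
    then have "(\<Sum>j\<in>I. a (w j) * w j $ i) = 0" if "i < n" for i
      using that by (simp add: sum.reindex[OF inj])
    from ind[OF this] show "\<forall>v\<in>w ` I. a v = 0" by auto
  qed (use fin w in auto)
qed

lemma (in vec_space) indexed_span_iff:
  assumes fin: "finite I" and w: "\<And>j. j \<in> I \<Longrightarrow> w j \<in> carrier_vec n" and inj: "inj_on w I"
  shows "v \<in> span (w ` I) \<longleftrightarrow> v \<in> carrier_vec n \<and> (\<exists>u. \<forall>i<n. v $ i = (\<Sum>j\<in>I. u j * w j $ i))"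
proof -
  have wI: "w ` I \<subseteq> carrier_vec n" using w by auto
  have ix: "lincomb a (w ` I) $ i = (\<Sum>j\<in>I. a (w j) * w j $ i)" if "i < n" for a i
    using lincomb_index[OF that wI] by (simp add: sum.reindex[OF inj])
  have dim: "lincomb a (w ` I) \<in> carrier_vec n" for a by (rule lincomb_closed[OF wI])
  have "v \<in> span (w ` I) \<longleftrightarrow> (\<exists>a. v = lincomb a (w ` I))"
    using finite_span[of "w ` I"] fin wI by auto
  also have "\<dots> \<longleftrightarrow> v \<in> carrier_vec n \<and> (\<exists>u. \<forall>i<n. v $ i = (\<Sum>j\<in>I. u j * w j $ i))"
  proof safe
    fix a show "lincomb a (w ` I) \<in> carrier_vec n" by (rule dim)
    show "\<exists>u. \<forall>i<n. lincomb a (w ` I) $ i = (\<Sum>j\<in>I. u j * w j $ i)"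
      by (intro exI[of _ "\<lambda>j. a (w j)"]) (simp add: ix)
  next
    fix u assume v: "v \<in> carrier_vec n" "\<forall>i<n. v $ i = (\<Sum>j\<in>I. u j * w j $ i)"
    have "v = lincomb (\<lambda>x. u (inv_into I w x)) (w ` I)"
    proof (rule eq_vecI)
      fix i assume "i < dim_vec (lincomb (\<lambda>x. u (inv_into I w x)) (w ` I))"
      then have "i < n" using dim carrier_vecD by metis
      then show "v $ i = lincomb (\<lambda>x. u (inv_into I w x)) (w ` I) $ i"
        using v(2) by (auto simp: ix inj intro!: sum.cong)
    qed (use v(1) dim carrier_vecD in metis)
    then show "\<exists>a. v = lincomb a (w ` I)" by blast
  qed
  finally show ?thesis .
qed

section \<open>Degrees of polynomial vectors and a criterion for minimality\<close>

lemma pvdeg_le_iff: "pvdeg v \<le> ereal (real D) \<longleftrightarrow> (\<forall>i<dim_vec v. degree (v $ i) \<le> D)"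
proof (cases "\<forall>i<dim_vec v. v $ i = 0")
  case False
  let ?S = "{degree (v $ i) | i. i < dim_vec v \<and> v $ i \<noteq> 0}"
  have S: "finite ?S" "?S \<noteq> {}" using False by auto
  have "pvdeg v \<le> ereal (real D) \<longleftrightarrow> Max ?S \<le> D" unfolding pvdeg_def using False by auto
  also have "\<dots> \<longleftrightarrow> (\<forall>x\<in>?S. x \<le> D)" using S by simp
  also have "\<dots> \<longleftrightarrow> (\<forall>i<dim_vec v. degree (v $ i) \<le> D)" by (auto, metis degree_0 le0)
  finally show ?thesis .
qed (auto simp: pvdeg_def)

lemma pvdeg_nat: "\<not> (\<forall>i<dim_vec v. v $ i = 0) \<Longrightarrow> \<exists>D::nat. pvdeg v = ereal (real D)"
  unfolding pvdeg_def by auto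

lemma pvdeg_eqI:
  assumes "\<And>i. i < dim_vec v \<Longrightarrow> degree (v $ i) \<le> D" and "k < dim_vec v" "coeff (v $ k) D \<noteq> 0"
  shows "pvdeg v = ereal (real D)"
proof -
  have "v $ k \<noteq> 0" using assms by auto
  then obtain E :: nat where E: "pvdeg v = ereal (real E)" using pvdeg_nat assms by blast
  have "E \<le> D" using assms(1) pvdeg_le_iff[of v D] E by auto
  moreover have "D \<le> degree (v $ k)" using assms by (intro le_degree)
  moreover have "degree (v $ k) \<le> E" using pvdeg_le_iff[of v E] E assms by auto
  ultimately show ?thesis using E by simp
qed

lemma rf_vec_simps [simp]:
  "dim_vec (rf_vec v) = dim_vec v" "i < dim_vec v \<Longrightarrow> rf_vec v $ i = to_fract (v $ i)"
  "rf_vec v \<in> carrier_vec k \<longleftrightarrow> v \<in> carrier_vec k"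
  by (auto simp: rf_vec_def rf_eq_to_fract)

lemma inj_rf_vec: "inj rf_vec"
proof (rule injI, rule eq_vecI)
  fix x y assume xy: "rf_vec x = rf_vec y"
  from arg_cong[OF this, of dim_vec] show d: "dim_vec x = dim_vec y" by simp
  fix i assume "i < dim_vec y"
  then show "x $ i = y $ i" using arg_cong[OF xy, of "\<lambda>v. v $ i"] d by simp
qed

lemma sum_list_degrees:
  assumes "distinct bs"
  shows "(\<Sum>b\<leftarrow>bs. ereal (real (c + (if P b then 0 else 1)))) =
    ereal (real (c * length bs + (length bs - card {b\<in>set bs. P b})))"
proof -
  have 1: "(\<Sum>b\<leftarrow>bs. ereal (real (g b))) = ereal (real (\<Sum>b\<leftarrow>bs. g b))" for g :: "'a \<Rightarrow> nat"
    by (induction bs) auto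
  have 2: "(\<Sum>b\<leftarrow>bs. c + (if P b then 0 else 1)) = c * length bs + (length bs - card {b\<in>set bs. P b})"
  proof -
    have "(\<Sum>b\<leftarrow>bs. c + (if P b then 0 else 1)) = (\<Sum>b\<in>set bs. c + (if P b then 0 else 1))"
      using assms by (simp add: sum_list_distinct_conv_sum_set)
    also have "\<dots> = c * card (set bs) + card {b\<in>set bs. \<not> P b}"
      by (simp add: sum.distrib sum.If_cases Collect_neg_eq[symmetric] Int_def mult.commute)
    also have "card {b\<in>set bs. \<not> P b} = card (set bs) - card {b\<in>set bs. P b}"
    proof -
      have "{b\<in>set bs. \<not> P b} = set bs - {b\<in>set bs. P b}" by auto
      then show ?thesis by (simp add: card_Diff_subset)
    qed
    finally show ?thesis using distinct_card[OF assms] by simp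
  qed
  show ?thesis using 1[of "\<lambda>b. c + (if P b then 0 else 1)"] by (simp only: 2)
qed

text \<open>Any other polynomial basis has the same length and no vector of degree below
  \<open>c\<close>. Its vectors of degree \<open>c\<close> are independent in the span of those of
  \<open>bs\<close>, so they are not more numerous, and all others have degree at least
  \<open>c + 1\<close>.\<close>

lemma minimal_basisI:
  assumes bs: "poly_basis k V bs"
    and two: "\<And>b. b \<in> set bs \<Longrightarrow> pvdeg b = ereal (real c) \<or> pvdeg b = ereal (real (c + 1))"
    and low: "\<And>v. v \<in> carrier_vec k \<Longrightarrow> rf_vec v \<in> V \<Longrightarrow> pvdeg v < ereal (real c) \<Longrightarrow> v = 0\<^sub>v k"
    and eq: "\<And>v. v \<in> carrier_vec k \<Longrightarrow> rf_vec v \<in> V \<Longrightarrow> pvdeg v \<le> ereal (real c) \<Longrightarrow>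
        rf_vec v \<in> rat_span k (rf_vec ` {b\<in>set bs. pvdeg b = ereal (real c)})"
  shows "minimal_basis k V bs"
  unfolding minimal_basis_def
proof (intro conjI allI impI bs)
  fix bs' assume bs': "poly_basis k V bs'"
  interpret vec_space "TYPE(cratf)" k .
  note defs = poly_basis_def rat_lin_indpt_def rat_span_def
  define A where "A = {b\<in>set bs. pvdeg b = ereal (real c)}"
  define A' where "A' = {b\<in>set bs'. pvdeg b = ereal (real c)}"
  have c: "set bs \<subseteq> carrier_vec k" "set bs' \<subseteq> carrier_vec k"
    and d: "distinct bs" "distinct bs'"
    using bs bs' by (auto simp: poly_basis_def distinct_map)
  have li: "lin_indpt (rf_vec ` set bs)" "lin_indpt (rf_vec ` set bs')"
    and sp: "span (rf_vec ` set bs) = V" "span (rf_vec ` set bs') = V"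
    using bs bs' by (auto simp: defs)
  have cr: "rf_vec ` set bs \<subseteq> carrier_vec k" "rf_vec ` set bs' \<subseteq> carrier_vec k" using c by auto
  have inV: "rf_vec ` set bs \<subseteq> V" "rf_vec ` set bs' \<subseteq> V"
    using span_mem[OF cr(1)] span_mem[OF cr(2)] sp by auto
  have card: "card (rf_vec ` X) = card X" for X :: "cpoly vec set"
    by (rule card_image) (rule inj_on_subset[OF inj_rf_vec], simp)
  have len: "length bs = length bs'"
  proof (rule antisym)
    show "length bs \<le> length bs'"
      using card_indpt_le[OF _ cr(2) li(2) _ _ li(1)] inV sp d by (simp add: card distinct_card)
    show "length bs' \<le> length bs"
      using card_indpt_le[OF _ cr(1) li(1) _ _ li(2)] inV sp d by (simp add: card distinct_card)
  qed
  have "rf_vec ` A' \<subseteq> span (rf_vec ` A)"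
    using eq inV(2) c(2) by (fastforce simp: A_def A'_def rat_span_def)
  moreover have "lin_indpt (rf_vec ` A)" "lin_indpt (rf_vec ` A')"
    using subset_li_is_li[OF li(1)] subset_li_is_li[OF li(2)] by (auto simp: A_def A'_def image_mono)
  ultimately have "card (rf_vec ` A') \<le> card (rf_vec ` A)"
    using c by (intro card_indpt_le) (auto simp: A_def A'_def)
  then have cA: "card A' \<le> card A" by (simp add: card)
  have nz: "rf_vec b \<noteq> 0\<^sub>v k" if "b \<in> set bs'" for b
  proof -
    have "(UNIV :: cratf set) \<noteq> {0}" by (metis UNIV_I singletonD zero_neq_one)
    then have "0\<^sub>v k \<notin> rf_vec ` set bs'" using zero_nin_lin_indpt[OF cr(2) li(2)] by simp
    then show ?thesis using that by (metis imageI)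
  qed
  have "deg_sum bs = (\<Sum>b\<leftarrow>bs. ereal (real (c + (if pvdeg b = ereal (real c) then 0 else 1))))"
    unfolding deg_sum_def using two by (intro arg_cong[of _ _ sum_list] map_cong) (auto simp: add.commute)
  also have "\<dots> = ereal (real (c * length bs + (length bs - card A)))"
    unfolding A_def by (rule sum_list_degrees[OF d(1)])
  also have "\<dots> \<le> ereal (real (c * length bs' + (length bs' - card A')))"
    using len cA by (simp add: diff_le_mono2)
  also have "\<dots> = (\<Sum>b\<leftarrow>bs'. ereal (real (c + (if pvdeg b = ereal (real c) then 0 else 1))))"
    unfolding A'_def by (rule sum_list_degrees[OF d(2), symmetric])
  also have "\<dots> \<le> deg_sum bs'"
    unfolding deg_sum_def
  proof (rule sum_list_mono)
    fix b assume b: "b \<in> set bs'"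
    have bk: "b \<in> carrier_vec k" using b c by auto
    have "b \<noteq> 0\<^sub>v k" using nz[OF b] by (auto intro!: eq_vecI)
    then have "\<not> pvdeg b < ereal (real c)" using low[OF bk] inV(2) b by auto
    moreover obtain D :: nat where "pvdeg b = ereal (real D)"
      using \<open>b \<noteq> 0\<^sub>v k\<close> bk pvdeg_nat[of b] by (metis carrier_vecD eq_vecI index_zero_vec)
    ultimately show "ereal (real (c + (if pvdeg b = ereal (real c) then 0 else 1))) \<le> pvdeg b"
      by auto
  qed
  finally show "deg_sum bs \<le> deg_sum bs'" .
qed

section \<open>Factors with nonvanishing minors\<close>

lemma det_nonzero_kernel:
  fixes M :: "nat \<Rightarrow> nat \<Rightarrow> 'a::idom"
  assumes "det (mat k k (\<lambda>(i,j). M i j)) \<noteq> 0" and "\<And>i. i < k \<Longrightarrow> (\<Sum>j<k. M i j * x j) = 0" and "j < k"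
  shows "x j = 0"
proof (rule ccontr)
  assume "x j \<noteq> 0"
  then have "det (mat k k (\<lambda>(i,j). M i j)) = 0"
    unfolding det_zero_iff_kernel using assms(2,3) by (intro exI[of _ x]) auto
  then show False using assms(1) by contradiction
qed

text \<open>Rows of the convolution matrix stand for coefficients of \<open>R x\<close>, columns for
  those of \<open>x\<close>. \<open>det_rows\<close> uses all rows that occur for \<open>x\<close>
  of degree at most \<open>a div (n - r)\<close>, \<open>det_cols\<close> all columns for smaller
  degree. The rows of \<open>det_lead\<close> hold the leading coefficients of
  \<open>R\<close>.\<close>

locale regular_factor =
  fixes n r a :: nat and R :: "nat \<Rightarrow> nat \<Rightarrow> complex poly"
  assumes r: "0 < r" and rn: "r < n"
    and deg_R: "\<And>i j. i < r \<Longrightarrow> j < n \<Longrightarrow> degree (R i j) \<le> bal r a i"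
    and det_rows: "det (mat (a + r * (a div (n - r) + 1)) (a + r * (a div (n - r) + 1)) (\<lambda>(i,J). sylv r n R i J)) \<noteq> 0"
    and det_cols: "det (mat (n * (a div (n - r))) (n * (a div (n - r))) (\<lambda>(i,J). sylv r n R i J)) \<noteq> 0"
    and det_lead: "det (mat r r (\<lambda>(i,J). sylv r n R (a + i) J)) \<noteq> 0"
begin

definition "\<alpha> = a div (n - r)"
definition "s = a mod (n - r)"
definition "N = a + r * (\<alpha> + 1)"
abbreviation "f \<equiv> bal r a"
abbreviation app :: "(nat \<Rightarrow> complex poly) \<Rightarrow> nat \<Rightarrow> complex poly" where
  "app x i \<equiv> \<Sum>j<n. R i j * x j"

lemma a_eq: "a = (n - r) * \<alpha> + s" by (simp add: \<alpha>_def s_def)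
lemma s_less: "s < n - r" using rn by (simp add: s_def)
text \<open>The \<open>N\<close> unknowns are thus all coefficients of \<open>x\<close> below degree
  \<alpha> and those of degree \<alpha> in its first \<open>r + s\<close> entries.\<close>

lemma N_eq: "N = n * \<alpha> + (r + s)"
proof -
  have "n * \<alpha> = (n - r) * \<alpha> + r * \<alpha>" using rn by (simp add: add_mult_distrib[symmetric])
  then show ?thesis using a_eq by (simp add: N_def)
qed

text \<open>The \<open>N\<close> equations are thus the coefficients of \<open>R x\<close> in every
  degree it can reach when \<open>x\<close> has degree at most \<alpha>.\<close>

lemma row_lt_N: "i < r \<Longrightarrow> i + r * e < N \<longleftrightarrow> e \<le> f i + \<alpha>"
proof -
  assume i: "i < r"
  show ?thesis
  proof (cases "\<alpha> \<le> e")
    case True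
    then obtain e' where "e = e' + \<alpha>" by (metis add.commute le_Suc_ex)
    then show ?thesis using bal_le_iff[OF r i, of e' a] by (simp add: N_def algebra_simps)
  next
    case False
    then have "r * (e + 1) \<le> r * \<alpha>" by (intro mult_le_mono2) simp
    then show ?thesis using False i by (simp add: N_def)
  qed
qed

lemma coeff_app:
  assumes i: "i < r" and van: "\<And>J. K \<le> J \<Longrightarrow> coeff (x (J mod n)) (J div n) = 0"
  shows "coeff (app x i) e = (\<Sum>J<K. sylv r n R (i + r * e) J * coeff (x (J mod n)) (J div n))"
proof -
  have n: "n > 0" using rn by simp
  \<comment> \<open>Enough blocks to contain the first \<open>K\<close> columns and all exponents up
    to \<open>e\<close>.\<close>
  define k where "k = Suc e + K"
  define g where "g J = sylv r n R (i + r * e) J * coeff (x (J mod n)) (J div n)" for J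
  have "K \<le> n * K" using n by simp
  also have "\<dots> \<le> n * k" by (intro mult_le_mono2) (simp add: k_def)
  finally have "(\<Sum>J<K. g J) = (\<Sum>J<n * k. g J)"
    by (intro sum.mono_neutral_left) (auto simp: g_def van)
  also have "\<dots> = (\<Sum>l<k. sum g {l * n..<l * n + n})"
    by (simp add: sum.nat_group mult.commute)
  also have "\<dots> = (\<Sum>l<k. \<Sum>j<n. g (j + l * n))"
  proof (rule sum.cong[OF refl])
    fix l show "sum g {l * n..<l * n + n} = (\<Sum>j<n. g (j + l * n))"
      using sum.shift_bounds_nat_ivl[of g 0 "l * n" n] by (simp only: add_0 lessThan_atLeast0 add.commute[of n])
  qed
  also have "\<dots> = (\<Sum>j<n. \<Sum>l<k. g (j + l * n))" by (rule sum.swap)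
  also have "\<dots> = (\<Sum>j<n. \<Sum>l\<le>e. coeff (x j) l * coeff (R i j) (e - l))"
  proof (rule sum.cong[OF refl])
    fix j assume "j \<in> {..<n}"
    then have j: "j < n" by simp
    have "g (j + l * n) = (if l \<le> e then coeff (x j) l * coeff (R i j) (e - l) else 0)" for l
      using j i n by (simp add: g_def sylv_def)
    then have "(\<Sum>l<k. g (j + l * n)) = (\<Sum>l<k. if l \<le> e then coeff (x j) l * coeff (R i j) (e - l) else 0)"
      by simp
    also have "\<dots> = (\<Sum>l\<le>e. coeff (x j) l * coeff (R i j) (e - l))"
      by (intro sum.mono_neutral_cong_right) (auto simp: k_def)
    finally show "(\<Sum>l<k. g (j + l * n)) = (\<Sum>l\<le>e. coeff (x j) l * coeff (R i j) (e - l))" .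
  qed
  also have "\<dots> = coeff (app x i) e"
    by (simp add: coeff_sum coeff_mult mult.commute[of "R i _"])
  finally show ?thesis by (simp add: g_def)
qed

lemma kernel_zero:
  assumes det: "det (mat K K (\<lambda>(q,J). sylv r n R q J)) \<noteq> 0"
    and van: "\<And>J. K \<le> J \<Longrightarrow> coeff (x (J mod n)) (J div n) = 0"
    and zero: "\<And>i. i < r \<Longrightarrow> app x i = 0" and j: "j < n"
  shows "x j = 0"
proof (rule poly_eqI)
  fix l
  have "(\<Sum>J<K. sylv r n R q J * coeff (x (J mod n)) (J div n)) = 0" for q
    using coeff_app[where i = "q mod r" and e = "q div r" and x = x and K = K] van zero[of "q mod r"] r by simp
  then have "coeff (x (J mod n)) (J div n) = 0" if "J < K" for J
    using det_nonzero_kernel[OF det, of "\<lambda>J. coeff (x (J mod n)) (J div n)"] that by blast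
  then have "coeff (x (J mod n)) (J div n) = 0" for J using van by (cases "J < K") auto
  from this[of "j + n * l"] show "coeff (x j) l = coeff 0 l" using j by simp
qed

lemma kernel_low_degree:
  assumes "\<And>j. j < n \<Longrightarrow> degree (x j) < \<alpha>" and "\<And>i. i < r \<Longrightarrow> app x i = 0" "j < n"
  shows "x j = 0"
proof (rule kernel_zero[OF det_cols[folded \<alpha>_def]])
  fix J assume "n * \<alpha> \<le> J"
  then have "\<alpha> \<le> J div n" using rn by (metis div_le_mono nonzero_mult_div_cancel_left not_less_zero)
  then show "coeff (x (J mod n)) (J div n) = 0" using assms(1)[of "J mod n"] rn by (intro coeff_eq_0) simp
qed (use assms in auto)

lemma le_J_cases:
  assumes "N \<le> J"
  shows "\<alpha> < J div n \<or> J div n = \<alpha> \<and> r + s \<le> J mod n"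
proof -
  have "n * \<alpha> \<le> J" using assms N_eq by simp
  then have "\<alpha> \<le> J div n" using rn by (metis div_le_mono nonzero_mult_div_cancel_left not_less_zero)
  moreover have "r + s \<le> J mod n" if "J div n = \<alpha>"
  proof -
    have "J = n * \<alpha> + J mod n" using that by (metis mult_div_mod_eq)
    then show ?thesis using assms N_eq by linarith
  qed
  ultimately show ?thesis by linarith
qed

text \<open>Consequently a null vector of degree at most \<alpha> is determined by its coefficients
  of degree \<alpha> in the entries from \<open>r + s\<close> on, which the square system leaves
  out.\<close>

lemma kernel_supported:
  assumes "\<And>j. j < n \<Longrightarrow> degree (x j) \<le> \<alpha>" and "\<And>i. i < r \<Longrightarrow> app x i = 0"
    and "\<And>j. r + s \<le> j \<Longrightarrow> j < n \<Longrightarrow> coeff (x j) \<alpha> = 0" "j < n"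
  shows "x j = 0"
proof (rule kernel_zero[OF det_rows[folded \<alpha>_def, folded N_def]])
  fix J assume J: "N \<le> J"
  have j: "J mod n < n" using rn by simp
  from le_J_cases[OF J] show "coeff (x (J mod n)) (J div n) = 0"
  proof
    assume "\<alpha> < J div n"
    then show ?thesis using assms(1)[OF j] by (intro coeff_eq_0) linarith
  qed (use assms(3) j in auto)
qed (use assms in auto)

lemma degree_app_le:
  assumes "\<And>j. j < n \<Longrightarrow> degree (x j) \<le> k" "i < r"
  shows "degree (app x i) \<le> f i + k"
proof (intro degree_sum_le)
  fix j assume "j \<in> {..<n}"
  then show "degree (R i j * x j) \<le> f i + k"
    using degree_mult_le[of "R i j" "x j"] deg_R[OF assms(2), of j] assms(1)[of j] by simp
qed simp

text \<open>The nonsingular system of \<open>det_rows\<close> is solved and the unknowns outside it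
  are set to 0, which gives the last clause. Coefficients of \<open>R x\<close> beyond the equations
  vanish by degree.\<close>

lemma surjective:
  assumes g: "\<And>i. i < r \<Longrightarrow> degree (g i) \<le> f i + \<alpha>"
  shows "\<exists>x. (\<forall>j<n. degree (x j) \<le> \<alpha>) \<and> (\<forall>i<r. app x i = g i) \<and>
    (\<forall>j<n. r + s \<le> j \<longrightarrow> coeff (x j) \<alpha> = 0)"
proof -
  obtain \<xi> where \<xi>: "\<And>q. q < N \<Longrightarrow> (\<Sum>J<N. sylv r n R q J * \<xi> J) = coeff (g (q mod r)) (q div r)"
    using det_nonzero_solvable[OF det_rows[folded \<alpha>_def, folded N_def], of "\<lambda>q. coeff (g (q mod r)) (q div r)"] by blast
  define x where "x j = (\<Sum>l\<le>\<alpha>. monom (if j + n * l < N then \<xi> (j + n * l) else 0) l)" for j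
  have cx: "coeff (x j) l = (if l \<le> \<alpha> \<and> j + n * l < N then \<xi> (j + n * l) else 0)" for j l
    by (simp add: x_def coeff_sum)
  have dx: "degree (x j) \<le> \<alpha>" for j by (rule degree_le) (simp add: cx)
  have cJ: "coeff (x (J mod n)) (J div n) = (if J < N then \<xi> J else 0)" for J
  proof (cases "J < N")
    case True
    then have "J < (\<alpha> + 1) * n" using N_eq s_less by (simp add: algebra_simps)
    then have "J div n < \<alpha> + 1" by (rule less_mult_imp_div_less)
    then show ?thesis using True by (simp add: cx)
  qed (simp add: cx)
  have "app x i = g i" if i: "i < r" for i
  proof (rule poly_eqI)
    fix e
    show "coeff (app x i) e = coeff (g i) e"
    proof (cases "i + r * e < N")
      case True
      have "coeff (app x i) e = (\<Sum>J<N. sylv r n R (i + r * e) J * \<xi> J)"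
        by (subst coeff_app[OF i, of N]) (auto simp: cJ)
      then show ?thesis using \<xi>[OF True] i by simp
    next
      case False
      then have e: "f i + \<alpha> < e" using row_lt_N[OF i] by simp
      then have "degree (app x i) < e" using degree_app_le[of x \<alpha> i] dx i by (meson le_less_trans)
      then show ?thesis using e g[OF i] by (simp add: coeff_eq_0)
    qed
  qed
  moreover have "coeff (x j) \<alpha> = 0" if "r + s \<le> j" "j < n" for j
    using that N_eq by (simp add: cx)
  ultimately show ?thesis using dx by blast
qed

section \<open>Leading row coefficients\<close>

definition lead :: "nat \<Rightarrow> nat \<Rightarrow> complex" where "lead i j = coeff (R i j) (f i)"

text \<open>The indices from \<open>a\<close> to \<open>a + r - 1\<close> are the last permitted
  ones in their residue classes modulo \<open>r\<close>, so they select the leading coefficient of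
  every row, in cyclically shifted order.\<close>

lemma top_row:
  assumes "i' < r"
  shows "(a + i') div r = f ((a + i') mod r)"
proof -
  define i where "i = (a + i') mod r"
  define e where "e = (a + i') div r"
  have i: "i < r" using r by (simp add: i_def)
  have q: "a + i' = i + r * e" by (simp add: i_def e_def)
  have "e \<le> f i" using bal_le_iff[OF r i, of e a] q assms by linarith
  moreover have "\<not> e + 1 \<le> f i" using bal_le_iff[OF r i, of "e + 1" a] q assms by (simp add: algebra_simps)
  ultimately show ?thesis by (simp add: i_def e_def)
qed

lemma sylv_top:
  assumes "i' < r" "j < r"
  shows "sylv r n R (a + i') j = lead ((a + i') mod r) j"
  using assms rn top_row[OF assms(1)] by (simp add: sylv_def lead_def)

lemma top_row_surj:
  assumes "i < r"
  obtains i' where "i' < r" "(a + i') mod r = i"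
proof -
  have "i + r * f i < a + r" using bal_le_iff[OF r assms, of "f i" a] by simp
  moreover have "\<not> i + r * (f i + 1) < a + r" using bal_le_iff[OF r assms, of "f i + 1" a] by simp
  ultimately have "a \<le> i + r * f i" "i + r * f i - a < r" by auto
  then show ?thesis using that[of "i + r * f i - a"] assms by simp
qed

lemma lead_solvable: "\<exists>w. \<forall>i<r. (\<Sum>j<r. lead i j * w j) = b i"
proof -
  obtain w where w: "\<And>i'. i' < r \<Longrightarrow> (\<Sum>j<r. sylv r n R (a + i') j * w j) = b ((a + i') mod r)"
    using det_nonzero_solvable[OF det_lead, of "\<lambda>i'. b ((a + i') mod r)"] by blast
  have "(\<Sum>j<r. lead i j * w j) = b i" if "i < r" for i
  proof -
    obtain i' where i': "i' < r" "(a + i') mod r = i" using top_row_surj[OF \<open>i < r\<close>] .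
    then show ?thesis using w[OF i'(1)] by (simp add: sylv_top)
  qed
  then show ?thesis by blast
qed

lemma lead_rows_independent:
  assumes "\<And>j. j < r \<Longrightarrow> (\<Sum>i<r. c i * lead i j) = 0" "k < r"
  shows "c k = 0"
proof -
  obtain w where w: "\<And>i. i < r \<Longrightarrow> (\<Sum>j<r. lead i j * w j) = (if i = k then 1 else 0)"
    using lead_solvable[of "\<lambda>i. if i = k then 1 else 0"] by blast
  have "c k = (\<Sum>i<r. c i * (if i = k then 1 else 0))"
    using assms(2) by (simp add: if_distrib cong: if_cong)
  also have "\<dots> = (\<Sum>i<r. c i * (\<Sum>j<r. lead i j * w j))" by (simp add: w)
  also have "\<dots> = (\<Sum>j<r. w j * (\<Sum>i<r. c i * lead i j))"
    unfolding sum_distrib_left by (subst sum.swap) (simp add: mult_ac)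
  also have "\<dots> = 0" using assms by simp
  finally show ?thesis .
qed

section \<open>The row space and its minimal basis\<close>

definition "row_vec i = vec n (R i)"

lemma row_vec_carrier [simp]: "row_vec i \<in> carrier_vec n" "dim_vec (row_vec i) = n"
  "j < n \<Longrightarrow> row_vec i $ j = R i j"
  by (auto simp: row_vec_def)

lemma pvdeg_row: "i < r \<Longrightarrow> pvdeg (row_vec i) = ereal (real (f i))"
proof -
  assume i: "i < r"
  obtain w where "(\<Sum>j<r. lead i j * w j) = 1" using lead_solvable[of "\<lambda>i. 1"] i by blast
  then have "\<not> (\<forall>j<r. lead i j = 0)" using sum.neutral[of "{..<r}" "\<lambda>j. lead i j * w j"] by auto
  then obtain j where "j < r" "lead i j \<noteq> 0" by blast
  then show ?thesis using deg_R[OF i] rn by (intro pvdeg_eqI[of _ _ j]) (auto simp: lead_def)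
qed

lemma rows_independent:
  assumes "\<And>j. j < n \<Longrightarrow> (\<Sum>i<r. u i * to_fract (R i j)) = 0" and "k < r"
  shows "u k = 0"
proof (rule independent_if_leading_independent[where I = "{..<r}" and T = "{..<n}" and b = R and h = f])
  fix c assume *: "\<And>j. j \<in> {..<n} \<Longrightarrow> (\<Sum>i<r. c i * coeff (R i j) (f i)) = 0"
  show "\<forall>i\<in>{..<r}. c i = 0"
  proof
    fix i assume "i \<in> {..<r}"
    then have i: "i < r" by simp
    show "c i = 0" by (rule lead_rows_independent[of c, OF _ i]) (use * rn in \<open>simp add: lead_def\<close>)
  qed
qed (use deg_R assms in auto)

text \<open>Pairing \<open>v = u R\<close> with a solution \<open>x\<close> of \<open>R x = \<lambda>\<^sup>e e\<^sub>k\<close> isolates \<open>u k\<close>; the choice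
  \<open>e = 0\<close> shows that it is a polynomial and the largest possible \<open>e\<close> bounds its degree.\<close>

lemma predictable_degree:
  assumes v: "\<And>j. j < n \<Longrightarrow> to_fract (v j) = (\<Sum>i<r. u i * to_fract (R i j))"
    and dv: "\<And>j. j < n \<Longrightarrow> degree (v j) \<le> D" and k: "k < r"
  shows "u k = 0 \<or> f k \<le> D"
proof -
  have pair: "\<exists>p. u k * to_fract (monom 1 e) = to_fract p \<and> degree p \<le> D + \<alpha>" if e: "e \<le> f k + \<alpha>" for e
  proof -
    define g :: "nat \<Rightarrow> complex poly" where "g i = (if i = k then monom 1 e else 0)" for i
    have "degree (g i) \<le> f i + \<alpha>" for i using e by (simp add: g_def degree_monom_eq)
    then obtain x where x: "\<And>j. j < n \<Longrightarrow> degree (x j) \<le> \<alpha>" "\<And>i. i < r \<Longrightarrow> app x i = g i"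
      using surjective[of g] by blast
    have "to_fract (\<Sum>j<n. v j * x j) = (\<Sum>j<n. (\<Sum>i<r. u i * to_fract (R i j)) * to_fract (x j))"
      using v by (simp add: to_fract_sum)
    also have "\<dots> = (\<Sum>i<r. u i * to_fract (app x i))"
      by (simp add: sum_distrib_left sum_distrib_right mult.assoc) (rule sum.swap)
    also have "\<dots> = (\<Sum>i<r. if i = k then u k * to_fract (monom 1 e) else 0)"
      using x(2) by (intro sum.cong) (auto simp: g_def)
    also have "\<dots> = u k * to_fract (monom 1 e)" using k by simp
    finally have "u k * to_fract (monom 1 e) = to_fract (\<Sum>j<n. v j * x j)" by simp
    moreover have "degree (\<Sum>j<n. v j * x j) \<le> D + \<alpha>"
    proof (intro degree_sum_le)
      fix j assume "j \<in> {..<n}"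
      then show "degree (v j * x j) \<le> D + \<alpha>"
        using degree_mult_le[of "v j" "x j"] dv[of j] x(1)[of j] by simp
    qed simp
    ultimately show ?thesis by blast
  qed
  obtain p where p: "u k = to_fract p" using pair[of 0] by (auto simp: monom_0 one_pCons[symmetric])
  obtain p' where p': "u k * to_fract (monom 1 (f k + \<alpha>)) = to_fract p'" "degree p' \<le> D + \<alpha>"
    using pair[of "f k + \<alpha>"] by auto
  then have pp: "p * monom 1 (f k + \<alpha>) = p'" by (simp add: p flip: to_fract_mult)
  show ?thesis
  proof (cases "p = 0")
    case False
    then have "degree p' = degree p + (f k + \<alpha>)"
      unfolding pp[symmetric] by (subst degree_mult_eq) (auto simp: degree_monom_eq)
    then show ?thesis using p' by simp
  qed (simp add: p)
qed

text \<open>By \<open>predictable_degree\<close>, a polynomial vector of the row space with degree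
  below \<open>a div r\<close> is zero, and one of degree at most \<open>a div r\<close> involves
  only rows of that degree, as \<open>minimal_basisI\<close> demands.\<close>

lemma rows_minimal:
  "minimal_basis n (rat_span n (rf_vec ` row_vec ` {..<r})) (map row_vec [0..<r])"
proof -
  interpret vec_space "TYPE(cratf)" n .
  let ?w = "\<lambda>i. rf_vec (row_vec i)"
  let ?V = "rat_span n (rf_vec ` row_vec ` {..<r})"
  have wc: "?w i \<in> carrier_vec n" for i by simp
  have ind: "\<forall>i\<in>{..<r}. u i = 0" if "\<And>j. j < n \<Longrightarrow> (\<Sum>i<r. u i * ?w i $ j) = 0" for u
  proof
    fix i assume i: "i \<in> {..<r}"
    have "(\<Sum>i<r. u i * to_fract (R i j)) = 0" if "j < n" for j
      using \<open>\<And>j. j < n \<Longrightarrow> (\<Sum>i<r. u i * ?w i $ j) = 0\<close>[OF that] that by simp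
    then show "u i = 0" using i rows_independent[of u i] by blast
  qed
  have li: "inj_on ?w {..<r}" "lin_indpt (?w ` {..<r})"
    using indexed_lin_indpt[of "{..<r}" ?w] wc ind by blast+
  have imw: "rf_vec ` row_vec ` {..<r} = ?w ` {..<r}" by (simp add: image_image)
  have span_iff: "v \<in> rat_span n (?w ` I) \<longleftrightarrow> v \<in> carrier_vec n \<and> (\<exists>u. \<forall>j<n. v $ j = (\<Sum>i\<in>I. u i * ?w i $ j))"
    if "I \<subseteq> {..<r}" for v I
    unfolding rat_span_def
    by (rule indexed_span_iff[where I = I and w = ?w]) (use that li(1) in \<open>auto intro: finite_subset inj_on_subset\<close>)
  have rep: "\<exists>u. \<forall>j<n. to_fract (v $ j) = (\<Sum>i<r. u i * to_fract (R i j))"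
    if "v \<in> carrier_vec n" "rf_vec v \<in> ?V" for v
    using that span_iff[of "{..<r}" "rf_vec v"] unfolding imw by auto
  show ?thesis
  proof (rule minimal_basisI[where c = "a div r"])
    have "distinct (map rf_vec (map row_vec [0..<r]))"
      using li(1) by (simp add: distinct_map o_def lessThan_atLeast0)
    then show "poly_basis n ?V (map row_vec [0..<r])"
      using li(2) by (auto simp: poly_basis_def rat_lin_indpt_def image_image lessThan_atLeast0)
  next
    fix b assume "b \<in> set (map row_vec [0..<r])"
    then show "pvdeg b = ereal (real (a div r)) \<or> pvdeg b = ereal (real (a div r + 1))"
      by (auto simp: pvdeg_row bal_def)
  next
    fix v assume v: "v \<in> carrier_vec n" "rf_vec v \<in> ?V" "pvdeg v < ereal (real (a div r))"
    obtain u where u: "\<And>j. j < n \<Longrightarrow> to_fract (v $ j) = (\<Sum>i<r. u i * to_fract (R i j))"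
      using rep[OF v(1,2)] by blast
    show "v = 0\<^sub>v n"
    proof (rule ccontr)
      assume "v \<noteq> 0\<^sub>v n"
      then have "\<not> (\<forall>j<n. v $ j = 0)" using v(1) by (metis carrier_vecD eq_vecI index_zero_vec)
      then obtain D :: nat where D: "pvdeg v = ereal (real D)" using pvdeg_nat[of v] v(1) by auto
      then have "D < a div r" using v(3) by simp
      then have "u i = 0" if "i < r" for i
        using predictable_degree[of "\<lambda>j. v $ j" u D i, OF u] that D v(1) pvdeg_le_iff[of v D]
        by (auto simp: bal_def split: if_splits)
      then have "\<forall>j<n. v $ j = 0" using u by simp
      then show False using \<open>\<not> (\<forall>j<n. v $ j = 0)\<close> by simp
    qed
  next
    fix v assume v: "v \<in> carrier_vec n" "rf_vec v \<in> ?V" "pvdeg v \<le> ereal (real (a div r))"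
    obtain u where u: "\<And>j. j < n \<Longrightarrow> to_fract (v $ j) = (\<Sum>i<r. u i * to_fract (R i j))"
      using rep[OF v(1,2)] by blast
    define I where "I = {i\<in>{..<r}. f i = a div r}"
    have u0: "u i = 0" if "i < r" "i \<notin> I" for i
      using predictable_degree[of "\<lambda>j. v $ j" u "a div r" i, OF u] that v(1,3) pvdeg_le_iff[of v "a div r"]
      by (auto simp: I_def bal_def split: if_splits)
    have "rf_vec v \<in> rat_span n (?w ` I)"
    proof (subst span_iff)
      show "I \<subseteq> {..<r}" by (auto simp: I_def)
      have "to_fract (v $ j) = (\<Sum>i\<in>I. u i * to_fract (R i j))" if "j < n" for j
        unfolding u[OF that] by (intro sum.mono_neutral_right) (auto simp: I_def u0)
      then show "rf_vec v \<in> carrier_vec n \<and> (\<exists>u. \<forall>j<n. rf_vec v $ j = (\<Sum>i\<in>I. u i * ?w i $ j))"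
        using v(1) by (auto intro!: exI[of _ u])
    qed
    moreover have "{b \<in> set (map row_vec [0..<r]). pvdeg b = ereal (real (a div r))} = row_vec ` I"
      by (auto simp: I_def pvdeg_row)
    ultimately show "rf_vec v \<in> rat_span n (rf_vec ` {b \<in> set (map row_vec [0..<r]). pvdeg b = ereal (real (a div r))})"
      by (simp add: image_image)
  qed
qed

section \<open>The null space and its minimal basis\<close>

definition null_space :: "cratf vec set" where
  "null_space = {v \<in> carrier_vec n. \<forall>i<r. (\<Sum>j<n. to_fract (R i j) * v $ j) = 0}"

text \<open>Intended degrees of the basis of the null space. Its members are indexed by the
  \<open>n - r\<close> columns outside the leading minor, the \<open>s\<close> of larger degree
  first.\<close>

definition h :: "nat \<Rightarrow> nat" where "h j = (if r + s \<le> j then \<alpha> else \<alpha> + 1)"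

lemma app_monom: "j < n \<Longrightarrow> app (\<lambda>j'. (if j' = j then p else 0) + z j') i = R i j * p + app z i"
proof -
  assume j: "j < n"
  have "(\<Sum>j'<n. R i j' * (if j' = j then p else 0)) = (\<Sum>j'<n. if j' = j then R i j * p else 0)"
    by (intro sum.cong) auto
  then show ?thesis using j by (simp add: distrib_left sum.distrib)
qed

text \<open>The monomial of degree \<alpha> in entry \<open>j\<close> is corrected by
  \<open>surjective\<close>. The correction has no coefficient of degree \<alpha> in the entries
  from \<open>r + s\<close> on, so the leading pattern survives there.\<close>

lemma null_vector_low:
  assumes j: "r + s \<le> j" "j < n"
  shows "\<exists>x. (\<forall>j'<n. degree (x j') \<le> \<alpha>) \<and> (\<forall>i<r. app x i = 0) \<and>
    (\<forall>j'<n. r + s \<le> j' \<longrightarrow> coeff (x j') \<alpha> = (if j' = j then 1 else 0))"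
proof -
  have "degree (- (R i j * monom 1 \<alpha>)) \<le> f i + \<alpha>" if "i < r" for i
    using degree_mult_le[of "R i j" "monom 1 \<alpha>"] deg_R[OF that j(2)] degree_monom_le[of "1::complex" \<alpha>] by simp
  then obtain z where z: "\<forall>j<n. degree (z j) \<le> \<alpha>" "\<forall>i<r. app z i = - (R i j * monom 1 \<alpha>)"
      "\<forall>j<n. r + s \<le> j \<longrightarrow> coeff (z j) \<alpha> = 0"
    using surjective[of "\<lambda>i. - (R i j * monom 1 \<alpha>)"] by blast
  define x where "x j' = (if j' = j then monom 1 \<alpha> else 0) + z j'" for j'
  have "degree (x j') \<le> \<alpha>" if "j' < n" for j'
    unfolding x_def using z(1) that by (intro degree_add_le) (auto simp: degree_monom_le)
  moreover have "app x i = 0" if "i < r" for i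
    using z(2) that j(2) unfolding x_def by (simp add: app_monom)
  ultimately show ?thesis using z(3) by (intro exI[of _ x]) (auto simp: x_def)
qed

text \<open>The top coefficients in the first \<open>r\<close> entries are chosen to cancel the top
  degree of the image. The rest has degree at most \<open>f i + \<alpha>\<close> and is removed by
  \<open>surjective\<close> with a correction of lower degree.\<close>

lemma null_vector_high:
  assumes j: "r \<le> j" "j < n"
  shows "\<exists>x. (\<forall>j'<n. degree (x j') \<le> \<alpha> + 1) \<and> (\<forall>i<r. app x i = 0) \<and>
    (\<forall>j'<n. r \<le> j' \<longrightarrow> coeff (x j') (\<alpha> + 1) = (if j' = j then 1 else 0))"
proof -
  obtain w where w: "\<And>i. i < r \<Longrightarrow> (\<Sum>j'<r. lead i j' * w j') = - lead i j"
    using lead_solvable[of "\<lambda>i. - lead i j"] by blast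
  define w' where "w' j' = (if j' < r then w j' else if j' = j then 1 else 0)" for j'
  define y where "y j' = monom (w' j') (\<alpha> + 1)" for j'
  have dy: "degree (y j') \<le> \<alpha> + 1" for j' by (simp add: y_def degree_monom_le)
  have "degree (- app y i) \<le> f i + \<alpha>" if i: "i < r" for i
  proof -
    have "coeff (app y i) (f i + (\<alpha> + 1)) = (\<Sum>j'<n. lead i j' * w' j')"
      unfolding coeff_sum
    proof (rule sum.cong[OF refl])
      fix j' assume "j' \<in> {..<n}"
      then show "coeff (R i j' * y j') (f i + (\<alpha> + 1)) = lead i j' * w' j'"
        using coeff_mult_at_bounds[OF deg_R[OF i, of j'] dy[of j']] by (simp add: lead_def y_def)
    qed
    also have "\<dots> = (\<Sum>j'<r. lead i j' * w' j') + (\<Sum>j'=r..<n. lead i j' * w' j')"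
      using rn by (simp add: lessThan_atLeast0 sum.atLeastLessThan_concat)
    also have "(\<Sum>j'<r. lead i j' * w' j') = - lead i j" using w[OF i] by (simp add: w'_def)
    also have "(\<Sum>j'=r..<n. lead i j' * w' j') = (\<Sum>j'=r..<n. if j' = j then lead i j else 0)"
      by (intro sum.cong) (auto simp: w'_def)
    also have "\<dots> = lead i j" using j by simp
    finally have "coeff (app y i) (f i + (\<alpha> + 1)) = 0" by simp
    then have "degree (app y i) \<le> f i + (\<alpha> + 1) - 1"
      using degree_app_le[of y "\<alpha> + 1" i] dy i by (intro degree_le_pred) auto
    then show ?thesis by simp
  qed
  then obtain z where z: "\<forall>j<n. degree (z j) \<le> \<alpha>" "\<forall>i<r. app z i = - app y i"
    using surjective[of "\<lambda>i. - app y i"] by blast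
  define x where "x j' = y j' + z j'" for j'
  have "degree (x j') \<le> \<alpha> + 1" if "j' < n" for j'
    unfolding x_def using z(1) that dy by (intro degree_add_le) (auto intro: le_SucI)
  moreover have "app x i = 0" if "i < r" for i
    using z(2) that by (simp add: x_def distrib_left sum.distrib)
  moreover have "coeff (x j') (\<alpha> + 1) = (if j' = j then 1 else 0)" if "j' < n" "r \<le> j'" for j'
  proof -
    have "degree (z j') < \<alpha> + 1" using z(1) that by (simp add: less_Suc_eq_le)
    then have "coeff (z j') (\<alpha> + 1) = 0" by (rule coeff_eq_0)
    then show ?thesis using that by (simp add: x_def y_def w'_def)
  qed
  ultimately show ?thesis by (intro exI[of _ x]) auto
qed

lemma null_basis_exists:
  "\<exists>B. \<forall>j\<in>{r..<n}. (\<forall>j'<n. degree (B j j') \<le> h j) \<and> (\<forall>i<r. app (B j) i = 0) \<and>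
     (\<forall>j'<n. (if r + s \<le> j then r + s else r) \<le> j' \<longrightarrow> coeff (B j j') (h j) = (if j' = j then 1 else 0))"
proof (rule bchoice, rule ballI)
  fix j assume "j \<in> {r..<n}"
  then show "\<exists>x. (\<forall>j'<n. degree (x j') \<le> h j) \<and> (\<forall>i<r. app x i = 0) \<and>
     (\<forall>j'<n. (if r + s \<le> j then r + s else r) \<le> j' \<longrightarrow> coeff (x j') (h j) = (if j' = j then 1 else 0))"
    using null_vector_low[of j] null_vector_high[of j] by (cases "r + s \<le> j") (simp_all add: h_def)
qed

definition B :: "nat \<Rightarrow> nat \<Rightarrow> complex poly" where
  "B = (SOME B. \<forall>j\<in>{r..<n}. (\<forall>j'<n. degree (B j j') \<le> h j) \<and> (\<forall>i<r. app (B j) i = 0) \<and>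
     (\<forall>j'<n. (if r + s \<le> j then r + s else r) \<le> j' \<longrightarrow> coeff (B j j') (h j) = (if j' = j then 1 else 0)))"

lemma B:
  assumes "j \<in> {r..<n}"
  shows "j' < n \<Longrightarrow> degree (B j j') \<le> h j" and "i < r \<Longrightarrow> app (B j) i = 0"
    and "j' < n \<Longrightarrow> (if r + s \<le> j then r + s else r) \<le> j' \<Longrightarrow> coeff (B j j') (h j) = (if j' = j then 1 else 0)"
  using someI_ex[OF null_basis_exists, folded B_def] assms by blast+

text \<open>On the entries from \<open>r\<close> on, the leading coefficients are block triangular
  with identity diagonal blocks: the entries from \<open>r + s\<close> on eliminate the
  \<open>c j\<close> with \<open>j\<close> in that range, then the other entries eliminate the
  rest.\<close>

lemma B_independent:
  assumes zero: "\<And>i. i \<in> {r..<n} \<Longrightarrow> (\<Sum>j\<in>{r..<n}. u j * to_fract (B j i)) = 0" and k: "k \<in> {r..<n}"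
  shows "u k = 0"
proof (rule independent_if_leading_independent[where I = "{r..<n}" and T = "{r..<n}" and b = B and h = h])
  fix c assume *: "\<And>i. i \<in> {r..<n} \<Longrightarrow> (\<Sum>j\<in>{r..<n}. c j * coeff (B j i) (h j)) = 0"
  have high: "c i = 0" if i: "i \<in> {r..<n}" "r + s \<le> i" for i
  proof -
    have "(\<Sum>j\<in>{r..<n}. c j * coeff (B j i) (h j)) = (\<Sum>j\<in>{r..<n}. if j = i then c i else 0)"
      using B(3)[of _ i] i by (intro sum.cong) auto
    then show ?thesis using *[OF i(1)] i by simp
  qed
  have "c i = 0" if i: "i \<in> {r..<n}" "i < r + s" for i
  proof -
    have "(\<Sum>j\<in>{r..<n}. c j * coeff (B j i) (h j)) = (\<Sum>j\<in>{r..<n}. if j = i then c i else 0)"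
    proof (intro sum.cong refl)
      fix j assume j: "j \<in> {r..<n}"
      show "c j * coeff (B j i) (h j) = (if j = i then c i else 0)"
        using B(3)[OF j, of i] i high[OF j] by (cases "r + s \<le> j") auto
    qed
    then show ?thesis using *[OF i(1)] i by simp
  qed
  with high show "\<forall>j\<in>{r..<n}. c j = 0" by (meson not_le)
qed (use B(1) zero k in auto)

text \<open>The first \<open>r\<close> columns of \<open>R\<close> are nonsingular over the rational
  functions because their leading coefficients are, so a null vector is determined by its other
  entries.\<close>

lemma null_space_coordinates:
  assumes v: "\<And>i. i < r \<Longrightarrow> (\<Sum>j<n. to_fract (R i j) * v j) = 0"
    and z: "\<And>j. r \<le> j \<Longrightarrow> j < n \<Longrightarrow> v j = 0" and j: "j < n"
  shows "v j = 0"
proof -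
  let ?M = "mat r r (\<lambda>(i,j). to_fract (R i j))"
  have "det (mat r r (\<lambda>(j,i). to_fract (R i j))) \<noteq> 0"
  proof
    assume "det (mat r r (\<lambda>(j,i). to_fract (R i j))) = 0"
    then obtain x k where x: "\<And>j. j < r \<Longrightarrow> (\<Sum>i<r. to_fract (R i j) * x i) = 0" and k: "k < r" "x k \<noteq> 0"
      unfolding det_zero_iff_kernel[of r "\<lambda>j i. to_fract (R i j)"] by blast
    have "x k = 0"
    proof (rule independent_if_leading_independent[where I = "{..<r}" and T = "{..<r}" and b = R and h = f])
      fix c assume *: "\<And>j. j \<in> {..<r} \<Longrightarrow> (\<Sum>i<r. c i * coeff (R i j) (f i)) = 0"
      show "\<forall>i\<in>{..<r}. c i = 0"
      proof
        fix i assume "i \<in> {..<r}"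
        then have i: "i < r" by simp
        show "c i = 0" by (rule lead_rows_independent[of c, OF _ i]) (use * in \<open>simp add: lead_def\<close>)
      qed
    qed (use deg_R rn x k in \<open>auto simp: mult.commute\<close>)
    then show False using k by simp
  qed
  moreover have "mat r r (\<lambda>(j,i). to_fract (R i j)) = transpose_mat ?M" by (rule eq_matI) auto
  ultimately have det: "det ?M \<noteq> 0" by (simp add: det_transpose[of _ r])
  have "(\<Sum>j<r. to_fract (R i j) * v j) = 0" if "i < r" for i
  proof -
    have "(\<Sum>j<r. to_fract (R i j) * v j) = (\<Sum>j<n. to_fract (R i j) * v j)"
      using rn z by (intro sum.mono_neutral_left) auto
    then show ?thesis using v[OF that] by simp
  qed
  then have "v j = 0" if "j < r" using det_nonzero_kernel[OF det, of v j] that by blast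
  then show ?thesis using z j by (meson not_le)
qed

definition "null_vec j = vec n (B j)"

lemma null_vec_simps [simp]: "null_vec j \<in> carrier_vec n" "dim_vec (null_vec j) = n"
  "i < n \<Longrightarrow> null_vec j $ i = B j i"
  by (auto simp: null_vec_def)

lemma pvdeg_null_vec: "j \<in> {r..<n} \<Longrightarrow> pvdeg (null_vec j) = ereal (real (h j))"
  using B(1)[of j] B(3)[of j j] by (intro pvdeg_eqI[of _ _ j]) (auto split: if_splits)

lemma B_in_null: "j \<in> {r..<n} \<Longrightarrow> i < r \<Longrightarrow> (\<Sum>k<n. to_fract (R i k) * to_fract (B j k)) = 0"
  using arg_cong[OF B(2)[of j i], of to_fract] by simp

text \<open>The square block of the \<open>B j\<close> on the entries from \<open>r\<close> on is
  nonsingular, so some combination agrees with \<open>v\<close> there; the difference vanishes by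
  \<open>null_space_coordinates\<close>.\<close>

lemma null_space_span:
  assumes v: "v \<in> null_space"
  shows "\<exists>u. \<forall>i<n. v $ i = (\<Sum>j\<in>{r..<n}. u j * to_fract (B j i))"
proof -
  have shift: "sum g {r..<n} = (\<Sum>q<n - r. g (r + q))" for g :: "nat \<Rightarrow> cratf"
    using sum.shift_bounds_nat_ivl[of g 0 r "n - r"] rn by (simp add: lessThan_atLeast0 add.commute)
  have "det (mat (n - r) (n - r) (\<lambda>(p,q). to_fract (B (r + q) (r + p)))) \<noteq> 0"
  proof
    assume "det (mat (n - r) (n - r) (\<lambda>(p,q). to_fract (B (r + q) (r + p)))) = 0"
    then obtain x k where x: "\<And>p. p < n - r \<Longrightarrow> (\<Sum>q<n - r. to_fract (B (r + q) (r + p)) * x q) = 0"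
      and k: "k < n - r" "x k \<noteq> 0"
      unfolding det_zero_iff_kernel[of "n - r" "\<lambda>p q. to_fract (B (r + q) (r + p))"] by blast
    have "(\<Sum>j\<in>{r..<n}. x (j - r) * to_fract (B j i)) = 0" if "i \<in> {r..<n}" for i
      using x[of "i - r"] that diff_less_mono[of i n r] unfolding shift by (simp add: mult.commute)
    from B_independent[of "\<lambda>j. x (j - r)", OF this, of "r + k"] k show False
      by (simp add: less_diff_conv add.commute)
  qed
  then obtain x where x: "\<And>p. p < n - r \<Longrightarrow> (\<Sum>q<n - r. to_fract (B (r + q) (r + p)) * x q) = v $ (r + p)"
    using det_nonzero_solvable[of "n - r" "\<lambda>p q. to_fract (B (r + q) (r + p))" "\<lambda>p. v $ (r + p)"] by blast
  define u where "u j = x (j - r)" for j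
  have u: "(\<Sum>j\<in>{r..<n}. u j * to_fract (B j i)) = v $ i" if "r \<le> i" "i < n" for i
    using x[of "i - r"] that diff_less_mono[of i n r] unfolding shift by (simp add: mult.commute u_def)
  define w where "w i = v $ i - (\<Sum>j\<in>{r..<n}. u j * to_fract (B j i))" for i
  have "w i = 0" if "i < n" for i
  proof (rule null_space_coordinates[OF _ _ that])
    fix i assume i: "i < r"
    have "(\<Sum>k<n. to_fract (R i k) * (\<Sum>j\<in>{r..<n}. u j * to_fract (B j k)))
       = (\<Sum>j\<in>{r..<n}. u j * (\<Sum>k<n. to_fract (R i k) * to_fract (B j k)))"
      unfolding sum_distrib_left by (subst sum.swap) (simp add: mult_ac)
    also have "\<dots> = 0" using B_in_null i by (intro sum.neutral) auto
    finally show "(\<Sum>j<n. to_fract (R i j) * w j) = 0"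
      using v i by (simp add: w_def right_diff_distrib sum_subtractf null_space_def)
  qed (simp add: w_def u)
  then show ?thesis by (auto simp: w_def)
qed

lemma null_minimal: "minimal_basis n null_space (map null_vec [r..<n])"
proof -
  interpret vec_space "TYPE(cratf)" n .
  let ?w = "\<lambda>j. rf_vec (null_vec j)"
  have wc: "?w i \<in> carrier_vec n" for i by simp
  have ind: "\<forall>j\<in>{r..<n}. u j = 0" if *: "\<And>i. i < n \<Longrightarrow> (\<Sum>j\<in>{r..<n}. u j * ?w j $ i) = 0" for u
  proof
    fix k assume k: "k \<in> {r..<n}"
    have "(\<Sum>j\<in>{r..<n}. u j * to_fract (B j i)) = 0" if "i \<in> {r..<n}" for i
      using *[of i] that by simp
    then show "u k = 0" using B_independent[of u, OF _ k] by blast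
  qed
  have li: "inj_on ?w {r..<n}" "lin_indpt (?w ` {r..<n})"
    using indexed_lin_indpt[of "{r..<n}" ?w] wc ind by blast+
  have span_iff: "v \<in> rat_span n (?w ` I) \<longleftrightarrow> v \<in> carrier_vec n \<and> (\<exists>u. \<forall>i<n. v $ i = (\<Sum>j\<in>I. u j * ?w j $ i))"
    if "I \<subseteq> {r..<n}" for v I
    unfolding rat_span_def
    by (rule indexed_span_iff[where I = I and w = ?w]) (use that li(1) in \<open>auto intro: finite_subset inj_on_subset\<close>)
  have sp: "rat_span n (?w ` {r..<n}) = null_space"
  proof (intro subset_antisym subsetI)
    fix v assume "v \<in> null_space"
    then show "v \<in> rat_span n (?w ` {r..<n})"
      using null_space_span[of v] by (simp add: span_iff) (simp add: null_space_def)
  next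
    fix v assume "v \<in> rat_span n (?w ` {r..<n})"
    then obtain u where v: "v \<in> carrier_vec n" "\<And>i. i < n \<Longrightarrow> v $ i = (\<Sum>j\<in>{r..<n}. u j * to_fract (B j i))"
      by (auto simp: span_iff)
    have "(\<Sum>k<n. to_fract (R i k) * v $ k) = 0" if i: "i < r" for i
    proof -
      have "(\<Sum>k<n. to_fract (R i k) * v $ k) = (\<Sum>j\<in>{r..<n}. u j * (\<Sum>k<n. to_fract (R i k) * to_fract (B j k)))"
        unfolding sum_distrib_left by (subst sum.swap) (simp add: v(2) sum_distrib_left mult_ac)
      also have "\<dots> = 0" using B_in_null i by (intro sum.neutral) auto
      finally show ?thesis .
    qed
    then show "v \<in> null_space" using v(1) by (simp add: null_space_def)
  qed
  have poly_null: "app (\<lambda>j. v $ j) i = 0" if "v \<in> carrier_vec n" "rf_vec v \<in> null_space" "i < r" for v i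
  proof -
    have "to_fract (app (\<lambda>j. v $ j) i) = 0" using that by (simp add: null_space_def)
    then show ?thesis by (simp only: to_fract_eq_0_iff)
  qed
  show ?thesis
  proof (rule minimal_basisI[where c = \<alpha>])
    have "distinct (map rf_vec (map null_vec [r..<n]))"
      using li(1) by (simp add: distinct_map o_def)
    then show "poly_basis n null_space (map null_vec [r..<n])"
      using li(2) sp by (auto simp: poly_basis_def rat_lin_indpt_def image_image)
  next
    fix b assume "b \<in> set (map null_vec [r..<n])"
    then show "pvdeg b = ereal (real \<alpha>) \<or> pvdeg b = ereal (real (\<alpha> + 1))"
      by (auto simp: pvdeg_null_vec h_def split: if_splits)
  next
    fix v assume v: "v \<in> carrier_vec n" "rf_vec v \<in> null_space" "pvdeg v < ereal (real \<alpha>)"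
    show "v = 0\<^sub>v n"
    proof (rule ccontr)
      assume "v \<noteq> 0\<^sub>v n"
      then have nz: "\<not> (\<forall>j<n. v $ j = 0)" using v(1) by (metis carrier_vecD eq_vecI index_zero_vec)
      then obtain D :: nat where D: "pvdeg v = ereal (real D)" using pvdeg_nat[of v] v(1) by auto
      then have "D < \<alpha>" using v(3) by simp
      then have "degree (v $ j) < \<alpha>" if "j < n" for j
        using D v(1) pvdeg_le_iff[of v D] that by (auto intro: le_less_trans)
      then have "v $ j = 0" if "j < n" for j
        using kernel_low_degree[of "\<lambda>j. v $ j" j] poly_null[OF v(1,2)] that by blast
      then show False using nz by blast
    qed
  next
    fix v assume v: "v \<in> carrier_vec n" "rf_vec v \<in> null_space" "pvdeg v \<le> ereal (real \<alpha>)"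
    have dv: "degree (v $ j) \<le> \<alpha>" if "j < n" for j using v(1,3) that pvdeg_le_iff[of v \<alpha>] by auto
    define I where "I = {r + s..<n}"
    have I: "I \<subseteq> {r..<n}" by (auto simp: I_def)
    \<comment> \<open>Subtracting the combination that matches the coefficients of degree \<alpha>
      from entry \<open>r + s\<close> on leaves a vector that \<open>kernel_supported\<close> shows
      to be zero.\<close>
    define c where "c j = [:coeff (v $ j) \<alpha>:]" for j
    define x where "x j = v $ j - (\<Sum>k\<in>I. c k * B k j)" for j
    have hI: "h k = \<alpha>" if "k \<in> I" for k using that by (simp add: h_def I_def)
    have dcB: "degree (c k * B k j) \<le> \<alpha>" if "k \<in> I" "j < n" for k j
      using B(1)[of k j] I hI that by (auto simp: c_def intro: order_trans[OF degree_smult_le])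
    have "x j = 0" if j: "j < n" for j
    proof (rule kernel_supported[OF _ _ _ j])
      fix j assume j: "j < n"
      show "degree (x j) \<le> \<alpha>" unfolding x_def
        using dv[OF j] dcB[OF _ j] by (intro degree_diff_le degree_sum_le) (auto simp: I_def)
      show "coeff (x j) \<alpha> = 0" if rs: "r + s \<le> j"
      proof -
        have "coeff (c k * B k j) \<alpha> = (if k = j then coeff (v $ j) \<alpha> else 0)" if "k \<in> I" for k
          using B(3)[of k j] I hI[OF that] that j rs by (auto simp: c_def I_def)
        then have "(\<Sum>k\<in>I. coeff (c k * B k j) \<alpha>) = (\<Sum>k\<in>I. if k = j then coeff (v $ j) \<alpha> else 0)"
          by (intro sum.cong) auto
        also have "\<dots> = coeff (v $ j) \<alpha>" using j rs by (simp add: I_def)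
        finally show ?thesis by (simp add: x_def coeff_sum)
      qed
    next
      fix i assume i: "i < r"
      have "app x i = app (\<lambda>j. v $ j) i - (\<Sum>j<n. \<Sum>k\<in>I. R i j * (c k * B k j))"
        by (simp add: x_def right_diff_distrib sum_subtractf sum_distrib_left)
      also have "(\<Sum>j<n. \<Sum>k\<in>I. R i j * (c k * B k j)) = (\<Sum>k\<in>I. c k * app (B k) i)"
        unfolding sum_distrib_left by (subst sum.swap) (simp only: mult.left_commute)
      also have "\<dots> = 0" using B(2) I i by (intro sum.neutral) auto
      finally show "app x i = 0" using poly_null[OF v(1,2) i] by simp
    qed
    then have "v $ j = (\<Sum>k\<in>I. c k * B k j)" if "j < n" for j using that by (simp add: x_def)
    then have "to_fract (v $ j) = (\<Sum>k\<in>I. to_fract (c k) * to_fract (B k j))" if "j < n" for j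
      using that by simp
    then have "rf_vec v \<in> rat_span n (?w ` I)"
      using v(1) by (auto simp: span_iff[OF I] intro!: exI[of _ "\<lambda>k. to_fract (c k)"])
    moreover have "{b \<in> set (map null_vec [r..<n]). pvdeg b = ereal (real \<alpha>)} = null_vec ` I"
      using I by (auto simp: pvdeg_null_vec h_def I_def split: if_splits)
    ultimately show "rf_vec v \<in> rat_span n (rf_vec ` {b \<in> set (map null_vec [r..<n]). pvdeg b = ereal (real \<alpha>)})"
      by (simp add: image_image)
  qed
qed

lemma null_minimal_indices:
  "has_minimal_indices n null_space
     (replicate_mset s (ereal (real (\<alpha> + 1))) + replicate_mset (n - r - s) (ereal (real \<alpha>)))"
proof -
  have "[r..<n] = [r..<r + s] @ [r + s..<n]"
    using s_less rn upt_add_eq_append[of r "r + s" "n - r - s"] by simp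
  moreover have "map (\<lambda>j. pvdeg (null_vec j)) [r..<r + s] = map (\<lambda>j. ereal (real (\<alpha> + 1))) [r..<r + s]"
    using s_less by (intro map_cong) (auto simp: pvdeg_null_vec h_def)
  moreover have "map (\<lambda>j. pvdeg (null_vec j)) [r + s..<n] = map (\<lambda>j. ereal (real \<alpha>)) [r + s..<n]"
    by (intro map_cong) (auto simp: pvdeg_null_vec h_def)
  ultimately have "mset (map pvdeg (map null_vec [r..<n])) =
     replicate_mset s (ereal (real (\<alpha> + 1))) + replicate_mset (n - r - s) (ereal (real \<alpha>))"
    by (simp add: map_replicate_const o_def)
  then show ?thesis using null_minimal unfolding has_minimal_indices_def by blast
qed

end

section \<open>Density of homogeneous factorizations\<close>

text \<open>Needed because the columns of the left factor come in reversed order.\<close>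

lemma minimal_basis_mset:
  assumes "minimal_basis k V bs" "mset bs' = mset bs"
  shows "minimal_basis k V bs'"
proof -
  have s: "set bs' = set bs" using assms(2) by (metis set_mset_mset)
  have "mset (map rf_vec bs') = mset (map rf_vec bs)" using assms(2) by simp
  then have d: "distinct (map rf_vec bs') = distinct (map rf_vec bs)" by (rule mset_eq_imp_distinct_iff)
  have "deg_sum bs' = deg_sum bs"
    unfolding deg_sum_def using assms(2) by (metis mset_map sum_mset_sum_list)
  then show ?thesis using assms(1) s d by (simp add: minimal_basis_def poly_basis_def)
qed

text \<open>The complementary degrees have their smaller values first and become balanced by
  reversal. The two sides are compared through the numbers \<open>e\<close> below them.\<close>

lemma bal_complement:
  assumes "0 < r" "i < r" "a \<le> r * d"
  shows "bal r a i \<le> d" and "bal r (r * d - a) (r - 1 - i) = d - bal r a i"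
proof -
  have "\<not> d + 1 \<le> bal r a i" using bal_le_iff[of r i "d + 1" a] assms by simp
  then show le: "bal r a i \<le> d" by simp
  have "e \<le> bal r (r * d - a) (r - 1 - i) \<longleftrightarrow> e \<le> d - bal r a i" for e
  proof (cases "e \<le> d")
    case True
    then obtain k where k: "d = e + k" using le_Suc_ex by blast
    have "e \<le> bal r (r * d - a) (r - 1 - i) \<longleftrightarrow> (r - 1 - i) + r * e < r * d - a + r"
      using assms by (intro bal_le_iff) auto
    also have "\<dots> \<longleftrightarrow> \<not> i + r * (k + 1) < a + r" using assms by (auto simp: k algebra_simps)
    also have "\<dots> \<longleftrightarrow> \<not> k + 1 \<le> bal r a i" using bal_le_iff[of r i "k + 1" a] assms by simp
    also have "\<dots> \<longleftrightarrow> e \<le> d - bal r a i" using le k by auto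
    finally show ?thesis .
  next
    case False
    then have "r * (d + 1) \<le> r * e" by (intro mult_le_mono2) simp
    then have "\<not> (r - 1 - i) + r * e < r * d - a + r" by simp
    then show ?thesis using bal_le_iff[of r "r - 1 - i" e "r * d - a"] False assms by simp
  qed
  then show "bal r (r * d - a) (r - 1 - i) = d - bal r a i" by (metis le_antisym order_refl)
qed

text \<open>\<open>L\<close> is the transposed left factor with its rows reversed, so one locale
  supplies the minimal bases and null spaces for both factors.\<close>

lemma MHset_if_regular:
  assumes a: "a \<le> r * d" and RF: "regular_factor n r a R" and LF: "regular_factor m r (r * d - a) L"
  shows "mat m n (\<lambda>(i,j). \<Sum>k<r. L (r - 1 - k) i * R k j) \<in> MHset m n r d a"
proof -
  interpret R: regular_factor n r a R by fact
  interpret L: regular_factor m r "r * d - a" L by fact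
  have r: "0 < r" using R.r .
  define Lm where "Lm = mat m r (\<lambda>(i,k). L (r - 1 - k) i)"
  define Rm where "Rm = mat r n (\<lambda>(k,j). R k j)"
  have prod: "mat m n (\<lambda>(i,j). \<Sum>k<r. L (r - 1 - k) i * R k j) = Lm * Rm"
    by (rule eq_matI) (auto simp: Lm_def Rm_def scalar_prod_def lessThan_atLeast0)
  have row: "row Rm i = R.row_vec i" if "i < r" for i
    using that by (auto simp: Rm_def R.row_vec_def)
  have col: "col Lm i = L.row_vec (r - 1 - i)" if "i < r" for i
    using that by (auto simp: Lm_def L.row_vec_def)
  have rows: "rows Rm = map R.row_vec [0..<r]"
    by (auto simp: rows_def Rm_def[THEN arg_cong, of dim_row] row)
  have "map (\<lambda>i. L.row_vec (r - 1 - i)) [0..<r] = rev (map L.row_vec [0..<r])"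
    by (rule nth_equalityI) (auto simp: rev_nth)
  moreover have "cols Lm = map (\<lambda>i. L.row_vec (r - 1 - i)) [0..<r]"
    by (auto simp: cols_def Lm_def[THEN arg_cong, of dim_col] col)
  ultimately have cols: "cols Lm = rev (map L.row_vec [0..<r])" by simp
  have "deg_conds m n r d a Lm Rm"
    unfolding deg_conds_def
  proof (intro conjI allI impI)
    show "Lm \<in> carrier_mat m r" "Rm \<in> carrier_mat r n" by (auto simp: Lm_def Rm_def)
    fix i assume i: "i < r"
    show "pvdeg (row Rm i) = (if i < a mod r then ereal (real (a div r + 1)) else ereal (real (a div r)))"
      using R.pvdeg_row[OF i] i by (simp add: row bal_def)
    show "pvdeg (col Lm i) = ereal (real d) - pvdeg (row Rm i)"
      using L.pvdeg_row[of "r - 1 - i"] R.pvdeg_row[OF i] bal_complement[OF r i a] i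
      by (simp add: row col of_nat_diff)
  qed
  moreover have "cols_minimal_basis Lm"
    using L.rows_minimal unfolding cols_minimal_basis_def cols
    by (intro minimal_basis_mset[where bs' = "rev _"]) (auto simp: Lm_def lessThan_atLeast0)
  moreover have "rows_minimal_basis Rm"
    using R.rows_minimal unfolding rows_minimal_basis_def rows
    by (auto simp: Rm_def lessThan_atLeast0)
  moreover have "L.null_space = left_null Lm"
  proof -
    have "(transpose_mat (rf_mat Lm) *\<^sub>v v = 0\<^sub>v r) \<longleftrightarrow> (\<forall>i<r. (\<Sum>j<m. to_fract (L i j) * v $ j) = 0)"
      if "v \<in> carrier_vec m" for v
    proof -
      have "(transpose_mat (rf_mat Lm) *\<^sub>v v) $ k = (\<Sum>j<m. to_fract (L (r - 1 - k) j) * v $ j)" if "k < r" for k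
        using that \<open>v \<in> carrier_vec m\<close>
        by (auto simp: rf_mat_def Lm_def scalar_prod_def lessThan_atLeast0 rf_eq_to_fract intro!: sum.cong)
      then have "(transpose_mat (rf_mat Lm) *\<^sub>v v = 0\<^sub>v r) \<longleftrightarrow>
          (\<forall>k<r. (\<Sum>j<m. to_fract (L (r - 1 - k) j) * v $ j) = 0)"
        by (auto simp: vec_eq_iff rf_mat_def Lm_def)
      also have "\<dots> \<longleftrightarrow> (\<forall>i<r. (\<Sum>j<m. to_fract (L i j) * v $ j) = 0)"
      proof (intro iffI allI impI)
        fix i assume "\<forall>k<r. (\<Sum>j<m. to_fract (L (r - 1 - k) j) * v $ j) = 0" "i < r"
        from this(1)[rule_format, of "r - 1 - i"] this(2) show "(\<Sum>j<m. to_fract (L i j) * v $ j) = 0" by simp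
      qed auto
      finally show ?thesis .
    qed
    then show ?thesis by (auto simp: left_null_def L.null_space_def Lm_def)
  qed
  moreover have "R.null_space = right_null Rm"
  proof -
    have "(rf_mat Rm *\<^sub>v v = 0\<^sub>v r) \<longleftrightarrow> (\<forall>i<r. (\<Sum>j<n. to_fract (R i j) * v $ j) = 0)"
      if "v \<in> carrier_vec n" for v
    proof -
      have "(rf_mat Rm *\<^sub>v v) $ k = (\<Sum>j<n. to_fract (R k j) * v $ j)" if "k < r" for k
        using that \<open>v \<in> carrier_vec n\<close>
        by (auto simp: rf_mat_def Rm_def scalar_prod_def lessThan_atLeast0 rf_eq_to_fract intro!: sum.cong)
      then show ?thesis by (auto simp: vec_eq_iff rf_mat_def Rm_def)
    qed
    then show ?thesis by (auto simp: right_null_def R.null_space_def Rm_def)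
  qed
  ultimately show ?thesis
    using L.null_minimal_indices R.null_minimal_indices
    unfolding prod MHset_def Let_def L.\<alpha>_def R.\<alpha>_def L.s_def R.s_def by auto
qed

lemma Bset_subset_facs:
  assumes "0 < r" "a \<le> r * d"
  shows "Bset m n r d a \<subseteq> facs m n r d (bal r a)"
proof
  fix P assume "P \<in> Bset m n r d a"
  then obtain L R where P: "P = L * R" and c: "deg_conds m n r d a L R" by (auto simp: Bset_def)
  have L: "L \<in> carrier_mat m r" and R: "R \<in> carrier_mat r n"
    and dr: "\<And>i. i < r \<Longrightarrow> pvdeg (row R i) = ereal (real (bal r a i))"
    and dc: "\<And>i. i < r \<Longrightarrow> pvdeg (col L i) = ereal (real d) - pvdeg (row R i)"
    using c by (auto simp: deg_conds_def bal_def)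
  show "P \<in> facs m n r d (bal r a)"
  proof (rule facsI[where L = "\<lambda>i k. L $$ (i,k)" and R = "\<lambda>k j. R $$ (k,j)"])
    show "P = mat m n (\<lambda>(i,j). \<Sum>k<r. L $$ (i,k) * R $$ (k,j))"
      unfolding P using L R by (intro eq_matI) (auto simp: scalar_prod_def lessThan_atLeast0)
    show "degree (R $$ (k,j)) \<le> bal r a k" if "k < r" "j < n" for k j
      using dr[OF that(1)] pvdeg_le_iff[of "row R k" "bal r a k"] R that by auto
    show "degree (L $$ (i,k)) \<le> d - bal r a k" if "i < m" "k < r" for i k
    proof -
      have "pvdeg (col L k) = ereal (real (d - bal r a k))"
        using dc[OF that(2)] dr[OF that(2)] bal_complement(1)[OF assms(1) that(2) assms(2)]
        by (simp add: of_nat_diff)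
      then show ?thesis using pvdeg_le_iff[of "col L k" "d - bal r a k"] L that by auto
    qed
  qed
qed

lemma perturb_regular_finite:
  assumes "0 < r" "r < n" and dR: "\<And>i j. i < r \<Longrightarrow> j < n \<Longrightarrow> degree (R i j) \<le> bal r a i"
  shows "finite {t. \<not> regular_factor n r a (perturb r n a (bal r a) R t)}"
proof -
  have n: "0 < n" using assms by simp
  let ?P = "\<lambda>k q0 t. det (mat k k (\<lambda>(i,J). sylv r n (perturb r n a (bal r a) R t) (q0 + i) J)) = 0"
  let ?\<alpha> = "a div (n - r)"
  note supp = sylv_minor_support[OF assms(1,2), where a = a]
  have "finite {t. ?P (a + r * (?\<alpha> + 1)) 0 t}"
    by (rule perturb_minor_finite[OF n assms(1) dR]) (use supp(1) in auto)
  moreover have "finite {t. ?P (n * ?\<alpha>) 0 t}"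
    by (rule perturb_minor_finite[OF n assms(1) dR]) (use supp(2) in auto)
  moreover have "finite {t. ?P r a t}"
    by (rule perturb_minor_finite[OF n assms(1) dR]) (use supp(3) in auto)
  moreover have "{t. \<not> regular_factor n r a (perturb r n a (bal r a) R t)}
      \<subseteq> {t. ?P (a + r * (?\<alpha> + 1)) 0 t} \<union> {t. ?P (n * ?\<alpha>) 0 t} \<union> {t. ?P r a t}"
    unfolding regular_factor_def using assms by (auto intro: degree_perturb)
  ultimately show ?thesis by (meson finite_UnI finite_subset)
qed

lemma perturb_tendsto:
  assumes "0 < r" "i < r" "j < n"
  shows "((\<lambda>t. coeff (perturb r n a (bal r a) R t i j) e) \<longlongrightarrow> coeff (R i j) e) (at 0)"
proof (cases "e \<le> bal r a i")
  case True
  then have "i + r * e \<le> a + r" using bal_le_iff[OF assms(1,2), of e a] by simp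
  then have "weight r n a (i + r * e) j \<ge> 1" using assms by (intro weight_pos) auto
  then have z: "(0::complex) ^ nat (weight r n a (i + r * e) j) = 0" by simp
  have "((\<lambda>t. coeff (R i j) e + t ^ nat (weight r n a (i + r * e) j)) \<longlongrightarrow>
     coeff (R i j) e + 0 ^ nat (weight r n a (i + r * e) j)) (at 0)"
    by (intro tendsto_intros)
  then show ?thesis using True z by (simp add: coeff_perturb)
qed (simp add: coeff_perturb)

lemma eventually_not_in_finite:
  fixes S :: "'a::t1_space set"
  assumes "finite S"
  shows "\<forall>\<^sub>F t in at x. t \<notin> S"
proof -
  have "closed (S - {x})" using assms by (intro finite_imp_closed) auto
  then have "open (- (S - {x}))" by (rule open_Compl)
  then show ?thesis unfolding eventually_at_topological by (intro exI[of _ "- (S - {x})"]) auto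
qed

lemma MHset_subset_facs:
  assumes "0 < r" "a \<le> r * d"
  shows "MHset m n r d a \<subseteq> facs m n r d (bal r a)"
  using Bset_subset_facs[OF assms, of m n] by (auto simp: Bset_def MHset_def)

text \<open>Both factors are perturbed with the same parameter. Apart from finitely many values of
  \<open>t\<close> the product lies in \<open>MHset\<close>, and it converges to \<open>P\<close> as
  \<open>t\<close> tends to 0.\<close>

lemma facs_subset_closure_MHset:
  assumes r: "0 < r" "r < m" "r < n" and a: "a \<le> r * d"
  shows "facs m n r d (bal r a) \<subseteq> pm_closure m n d (MHset m n r d a)"
proof
  fix P assume PS: "P \<in> facs m n r d (bal r a)"
  have bd: "bal r a k \<le> d" if "k < r" for k using bal_complement(1)[OF r(1) that a] .
  obtain L R where P: "P = mat m n (\<lambda>(i,j). \<Sum>k<r. L i k * R k j)"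
    and L: "\<And>i k. i < m \<Longrightarrow> k < r \<Longrightarrow> degree (L i k) \<le> d - bal r a k"
    and R: "\<And>k j. k < r \<Longrightarrow> j < n \<Longrightarrow> degree (R k j) \<le> bal r a k"
    using PS unfolding facs_def by blast
  define L' where "L' k i = L i (r - 1 - k)" for k i
  have L': "degree (L' k i) \<le> bal r (r * d - a) k" if "k < r" "i < m" for k i
    using L[OF that(2), of "r - 1 - k"] bal_complement(2)[OF r(1) _ a, of "r - 1 - k"] that by (simp add: L'_def)
  define Rt where "Rt t = perturb r n a (bal r a) R t" for t
  define Lt where "Lt t = perturb r m (r * d - a) (bal r (r * d - a)) L' t" for t
  define Q where "Q t = mat m n (\<lambda>(i,j). \<Sum>k<r. Lt t (r - 1 - k) i * Rt t k j)" for t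
  have "\<forall>\<^sub>F t in at 0. regular_factor n r a (Rt t)"
    using eventually_not_in_finite[OF perturb_regular_finite[OF r(1,3) R]] by (simp add: Rt_def)
  moreover have "\<forall>\<^sub>F t in at 0. regular_factor m r (r * d - a) (Lt t)"
    using eventually_not_in_finite[OF perturb_regular_finite[OF r(1,2) L']] by (simp add: Lt_def)
  ultimately have "\<forall>\<^sub>F t in at 0. Q t \<in> MHset m n r d a"
    unfolding Q_def by eventually_elim (rule MHset_if_regular[OF a])
  moreover have "MHset m n r d a \<subseteq> polymats m n d"
    using MHset_subset_facs[OF r(1) a] facs_subset_polymats[of r "bal r a" d m n] bd by blast
  ultimately have ev: "\<forall>\<^sub>F t in at 0. Q t \<in> MHset m n r d a \<inter> polymats m n d"
    by (auto elim: eventually_mono)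
  show "P \<in> pm_closure m n d (MHset m n r d a)"
  proof (rule pm_closure_limitI[OF _ _ ev])
    show "P \<in> polymats m n d" using PS facs_subset_polymats[of r "bal r a" d m n] bd by blast
    fix i j l assume ij: "i < m" "j < n"
    have "((\<lambda>t. \<Sum>k<r. \<Sum>e\<le>l. coeff (Lt t (r - 1 - k) i) e * coeff (Rt t k j) (l - e)) \<longlongrightarrow>
        (\<Sum>k<r. \<Sum>e\<le>l. coeff (L i k) e * coeff (R k j) (l - e))) (at 0)"
    proof (intro tendsto_sum tendsto_mult)
      fix k e assume "k \<in> {..<r}"
      then have k: "k < r" by simp
      show "((\<lambda>t. coeff (Rt t k j) (l - e)) \<longlongrightarrow> coeff (R k j) (l - e)) (at 0)"
        unfolding Rt_def using k ij r by (intro perturb_tendsto) auto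
      have "((\<lambda>t. coeff (Lt t (r - 1 - k) i) e) \<longlongrightarrow> coeff (L' (r - 1 - k) i) e) (at 0)"
        unfolding Lt_def using k ij r by (intro perturb_tendsto) auto
      then show "((\<lambda>t. coeff (Lt t (r - 1 - k) i) e) \<longlongrightarrow> coeff (L i k) e) (at 0)"
        using k by (simp add: L'_def)
    qed
    then show "((\<lambda>t. coeff (Q t $$ (i,j)) l) \<longlongrightarrow> coeff (P $$ (i,j)) l) (at 0)"
      using ij by (simp add: Q_def P coeff_sum coeff_mult)
  qed simp
qed

section \<open>Normal rank and closure\<close>

text \<open>If all extensions of a nonzero minor by one row vanish, the cofactors along that row do not
  depend on it and give the relation.\<close>

lemma minor_or_relation:
  fixes c :: "nat \<Rightarrow> nat \<Rightarrow> 'a::idom"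
  shows "(\<exists>\<iota>. (\<forall>t<p. \<iota> t < m) \<and> det (mat p p (\<lambda>(t,k). c k (\<iota> t))) \<noteq> 0) \<or>
    (\<exists>x. (\<exists>k<p. x k \<noteq> 0) \<and> (\<forall>i<m. (\<Sum>k<p. x k * c k i) = 0))"
proof (induction p)
  case 0
  then show ?case by (simp add: det_dim_zero)
next
  case (Suc p)
  then consider \<iota> where "\<forall>t<p. \<iota> t < m" "det (mat p p (\<lambda>(t,k). c k (\<iota> t))) \<noteq> 0"
    | x where "\<exists>k<p. x k \<noteq> 0" "\<forall>i<m. (\<Sum>k<p. x k * c k i) = 0" by blast
  then show ?case
  proof cases
    case 1
    \<comment> \<open>The nonzero minor bordered by row \<open>i\<close> at the bottom and by the
      new column \<open>p\<close>.\<close>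
    define A where "A i = mat (Suc p) (Suc p) (\<lambda>(t,k). c k (if t < p then \<iota> t else i))" for i
    have A: "A i \<in> carrier_mat (Suc p) (Suc p)" for i by (simp add: A_def)
    have cof: "cofactor (A i) p k = cofactor (A 0) p k" if "k < Suc p" for i k
    proof -
      have "mat_delete (A i) p k = mat_delete (A 0) p k"
        unfolding mat_delete_def by (rule eq_matI) (auto simp: A_def)
      then show ?thesis by (simp add: cofactor_def)
    qed
    have "mat_delete (A 0) p p = mat p p (\<lambda>(t,k). c k (\<iota> t))"
      unfolding mat_delete_def by (rule eq_matI) (auto simp: A_def)
    then have cp: "cofactor (A 0) p p \<noteq> 0" using 1(2) by (simp add: cofactor_def)
    have exp: "det (A i) = (\<Sum>k<Suc p. cofactor (A 0) p k * c k i)" for i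
    proof -
      have "A i $$ (p,k) = c k i" if "k < Suc p" for k using that by (simp add: A_def)
      then show ?thesis unfolding laplace_expansion_row[OF A lessI]
        by (intro sum.cong) (auto simp: cof[of _ i] mult.commute)
    qed
    show ?thesis
    proof (cases "\<exists>i<m. det (A i) \<noteq> 0")
      case True
      then obtain i where "i < m" "det (A i) \<noteq> 0" by blast
      then show ?thesis using 1(1)
        by (intro disjI1 exI[of _ "\<lambda>t. if t < p then \<iota> t else i"]) (auto simp: A_def)
    next
      case False
      then show ?thesis using cp exp
        by (intro disjI2 exI[of _ "\<lambda>k. cofactor (A 0) p k"]) auto
    qed
  next
    case 2
    then obtain k where "k < p" "x k \<noteq> 0" by blast
    then show ?thesis using 2
      by (intro disjI2 exI[of _ "\<lambda>k. if k < p then x k else 0"]) (auto intro!: exI[of _ k])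
  qed
qed

text \<open>Padding with a zero column and a zero row makes the factors square, and the padded left
  factor is singular.\<close>

lemma det_low_rank:
  fixes X :: "nat \<Rightarrow> nat \<Rightarrow> 'a::idom"
  shows "det (mat (Suc r) (Suc r) (\<lambda>(t,k). \<Sum>l<r. X t l * Y l k)) = 0"
proof -
  let ?X = "mat (Suc r) (Suc r) (\<lambda>(t,l). if l < r then X t l else 0)"
  let ?Y = "mat (Suc r) (Suc r) (\<lambda>(l,k). if l < r then Y l k else 0)"
  have "mat (Suc r) (Suc r) (\<lambda>(t,k). \<Sum>l<r. X t l * Y l k) = ?X * ?Y"
    by (rule eq_matI) (auto simp: scalar_prod_def lessThan_atLeast0)
  moreover have "det (?X * ?Y) = det ?X * det ?Y" by (rule det_mult) auto
  moreover have "det ?X = 0"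
    unfolding det_zero_iff_kernel[of "Suc r" "\<lambda>t l. if l < r then X t l else 0"]
    by (intro exI[of _ "\<lambda>l. if l = r then 1 else 0"]) auto
  ultimately show ?thesis by simp
qed

text \<open>A maximal independent set of columns of \<open>P\<close> serves as left factor; a common
  denominator \<open>q\<close> of all coordinates makes the right factor polynomial.\<close>

lemma rank_le_factorization:
  assumes P: "P \<in> carrier_mat m n" and rk: "normal_rank P \<le> r"
  shows "\<exists>q L R. q \<noteq> 0 \<and> (\<forall>i<m. \<forall>j<n. q * P $$ (i,j) = (\<Sum>k<r. L i k * R k j))"
proof -
  interpret vec_space "TYPE(cratf)" m .
  define A where "A = rf_mat P"
  have A: "A \<in> carrier_mat m n" using P by (simp add: A_def rf_mat_def)
  have Aij: "A $$ (i,j) = to_fract (P $$ (i,j))" if "i < m" "j < n" for i j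
    using that P by (simp add: A_def rf_mat_def rf_eq_to_fract)
  have cc: "set (cols A) \<subseteq> carrier_vec m" using cols_dim[of A] A by simp
  obtain S where S: "finite S" "maximal S (\<lambda>T. T \<subseteq> set (cols A) \<and> lin_indpt T)"
    using maximal_exists_superset[of "set (cols A)" "\<lambda>T. T \<subseteq> set (cols A) \<and> lin_indpt T" "{}"]
    by (auto simp: finite_lin_indpt2)
  have Sc: "S \<subseteq> set (cols A)" and Sli: "lin_indpt S" using S(2) by (auto simp: maximal_def)
  have cS: "card S \<le> r"
    using rank_card_indpt[OF A S(2)] rk P by (simp add: normal_rank_def A_def)
  obtain w where w: "bij_betw w {..<card S} S"
    using finite_same_card_bij[of "{..<card S}" S] S(1) by auto
  have "\<exists>l<n. w k = col A l" if "k < card S" for k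
  proof -
    have "w k \<in> set (cols A)" using w Sc that by (auto simp: bij_betw_def)
    then show ?thesis using A by (auto simp: cols_def)
  qed
  then obtain \<kappa> where \<kappa>: "\<And>k. k < card S \<Longrightarrow> \<kappa> k < n \<and> w k = col A (\<kappa> k)" by metis
  have "\<exists>u. \<forall>i<m. A $$ (i,j) = (\<Sum>k<card S. u k * A $$ (i, \<kappa> k))" if j: "j < n" for j
  proof -
    have cj: "col A j \<in> set (cols A)" using j A by (auto simp: cols_def)
    have "col A j \<in> span S"
    proof (cases "col A j \<in> S")
      case True
      then show ?thesis using span_mem[of S] Sc cc by auto
    next
      case False
      have "\<not> lin_indpt (S \<union> {col A j})"
      proof
        assume "lin_indpt (S \<union> {col A j})"
        then have "S \<union> {col A j} = S" using S(2) Sc cj unfolding maximal_def by blast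
        then show False using False by blast
      qed
      then show ?thesis using lin_dep_iff_in_span[of S "col A j"] Sli Sc cc cj False by auto
    qed
    then have "col A j \<in> span (w ` {..<card S})" using w by (simp add: bij_betw_def)
    moreover have wc: "w k \<in> carrier_vec m" if "k \<in> {..<card S}" for k
      using w Sc cc that by (auto simp: bij_betw_def)
    moreover have "inj_on w {..<card S}" using w by (simp add: bij_betw_def)
    ultimately obtain u where u: "\<And>i. i < m \<Longrightarrow> col A j $ i = (\<Sum>k<card S. u k * w k $ i)"
      using indexed_span_iff[of "{..<card S}" w "col A j"] by blast
    have "A $$ (i,j) = (\<Sum>k<card S. u k * A $$ (i, \<kappa> k))" if i: "i < m" for i
    proof -
      have "A $$ (i,j) = col A j $ i" using i j A by simp
      also have "\<dots> = (\<Sum>k<card S. u k * A $$ (i, \<kappa> k))"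
        unfolding u[OF i] using i A \<kappa> by (intro sum.cong) auto
      finally show ?thesis .
    qed
    then show ?thesis by blast
  qed
  then obtain u where u: "\<And>i j. i < m \<Longrightarrow> j < n \<Longrightarrow> A $$ (i,j) = (\<Sum>k<card S. u j k * A $$ (i, \<kappa> k))"
    by metis
  obtain q p where q: "q \<noteq> 0" and p: "\<And>x. x \<in> {..<n} \<times> {..<card S} \<Longrightarrow> to_fract q * u (fst x) (snd x) = to_fract (p x)"
    using clear_denominators[of "{..<n} \<times> {..<card S}" "\<lambda>x. u (fst x) (snd x)"] by auto
  \<comment> \<open>The rank may be smaller than \<open>r\<close>; the missing columns are
    zero.\<close>
  define L where "L i k = (if k < card S then P $$ (i, \<kappa> k) else 0)" for i k
  have "q * P $$ (i,j) = (\<Sum>k<r. L i k * p (j,k))" if ij: "i < m" "j < n" for i j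
  proof -
    have "(\<Sum>k<r. L i k * p (j,k)) = (\<Sum>k<card S. L i k * p (j,k))"
      using cS by (intro sum.mono_neutral_right) (auto simp: L_def)
    then have "to_fract (\<Sum>k<r. L i k * p (j,k)) = (\<Sum>k<card S. to_fract (L i k) * to_fract (p (j,k)))"
      by simp
    also have "\<dots> = (\<Sum>k<card S. to_fract q * (u j k * A $$ (i, \<kappa> k)))"
    proof (rule sum.cong[OF refl])
      fix k assume "k \<in> {..<card S}"
      then show "to_fract (L i k) * to_fract (p (j,k)) = to_fract q * (u j k * A $$ (i, \<kappa> k))"
        using p[of "(j,k)"] ij \<kappa>[of k] by (simp add: L_def Aij mult.assoc[symmetric])
    qed
    also have "\<dots> = to_fract (q * P $$ (i,j))"
      using u[OF ij] ij by (simp add: sum_distrib_left[symmetric] Aij)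
    finally show ?thesis by (simp only: to_fract_eq_iff)
  qed
  then show ?thesis using q by (intro exI[of _ q] exI[of _ L] exI[of _ "\<lambda>k j. p (j,k)"]) simp
qed

lemma polymats_rank_subset_facs:
  assumes "P \<in> polymats_rank m n d r"
  obtains f where "\<And>k. k < r \<Longrightarrow> f k \<le> d" "P \<in> facs m n r d f"
proof -
  have P: "P \<in> carrier_mat m n" "\<And>i j. i < m \<Longrightarrow> j < n \<Longrightarrow> degree (P $$ (i,j)) \<le> d" "normal_rank P \<le> r"
    using assms by (auto simp: polymats_rank_def polymats_def)
  obtain q L R where q: "q \<noteq> 0" "\<And>i j. i < m \<Longrightarrow> j < n \<Longrightarrow> q * P $$ (i,j) = (\<Sum>k<r. L i k * R k j)"
    using rank_le_factorization[OF P(1,3)] by blast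
  \<comment> \<open>\<open>Suc\<close> supplies the strict bounds that
    \<open>polynomial_factorization\<close> expects.\<close>
  define e where "e k = Suc (\<Sum>i<m. degree (L i k))" for k
  have "degree (L i k) < e k" if "i < m" for i k
    unfolding e_def using that by (intro le_imp_less_Suc member_le_sum) auto
  then obtain L1 R1 where P1: "\<And>i j. i < m \<Longrightarrow> j < n \<Longrightarrow> P $$ (i,j) = (\<Sum>k<r. L1 i k * R1 k j)"
    using polynomial_factorization[where P = "\<lambda>i j. P $$ (i,j)" and L = L and R = R and e = e and m = m and n = n and r = r, OF q(1)] q(2) by blast
  have "degree (L1 i k) \<le> (\<Sum>i<m. degree (L1 i k))" if "i < m" for i k
    using that by (intro member_le_sum) auto
  moreover have "degree (R1 k j) \<le> (\<Sum>j<n. degree (R1 k j))" if "j < n" for k j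
    using that by (intro member_le_sum) auto
  ultimately obtain L2 R2 f where P2: "\<And>i j. i < m \<Longrightarrow> j < n \<Longrightarrow> P $$ (i,j) = (\<Sum>k<r. L2 i k * R2 k j)"
    and f: "\<And>k. k < r \<Longrightarrow> f k \<le> d \<and> (\<forall>i<m. degree (L2 i k) \<le> d - f k) \<and> (\<forall>j<n. degree (R2 k j) \<le> f k)"
    using degree_reduction[where P = "\<lambda>i j. P $$ (i,j)" and L = L1 and R = R1 and m = m and n = n and r = r and d = d
        and e = "\<lambda>k. \<Sum>i<m. degree (L1 i k)" and f = "\<lambda>k. \<Sum>j<n. degree (R1 k j)"] P1 P(2) by blast
  have "P \<in> facs m n r d f"
  proof (rule facsI[where L = L2 and R = R2])
    show "P = mat m n (\<lambda>(i,j). \<Sum>k<r. L2 i k * R2 k j)" using P(1) P2 by (intro eq_matI) auto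
  qed (use f in auto)
  then show ?thesis using f that by blast
qed

section \<open>The rank bound under limits\<close>

lemma poly_eq_sum_coeff:
  fixes p :: "'a::comm_semiring_1 poly"
  assumes "degree p \<le> d"
  shows "poly p z = (\<Sum>l\<le>d. coeff p l * z ^ l)"
  unfolding poly_altdef using assms by (intro sum.mono_neutral_left) (auto simp: coeff_eq_0)

text \<open>If the rank of \<open>P\<close> exceeded \<open>r\<close>, some minor of size
  \<open>r + 1\<close> would be nonzero at a point \<open>z\<close>. The same minor vanishes for the
  approximating products, and its value at \<open>z\<close> is continuous in the
  coefficients.\<close>

lemma closure_facs_rank:
  assumes fd: "\<And>k. k < r \<Longrightarrow> f k \<le> d"
  shows "pm_closure m n d (facs m n r d f) \<subseteq> polymats_rank m n d r"
proof
  fix P assume Pc: "P \<in> pm_closure m n d (facs m n r d f)"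
  then have Pm: "P \<in> polymats m n d" by (simp add: pm_closure_iff)
  then have P: "P \<in> carrier_mat m n" by (simp add: polymats_def)
  have "normal_rank P \<le> r"
  proof (rule ccontr)
    assume rk: "\<not> normal_rank P \<le> r"
    interpret vec_space "TYPE(cratf)" m .
    define A where "A = rf_mat P"
    have A: "A \<in> carrier_mat m n" using P by (simp add: A_def rf_mat_def)
    have Aij: "A $$ (i,j) = to_fract (P $$ (i,j))" if "i < m" "j < n" for i j
      using that P by (simp add: A_def rf_mat_def rf_eq_to_fract)
    have cc: "set (cols A) \<subseteq> carrier_vec m" using cols_dim[of A] A by simp
    obtain S where S: "finite S" "maximal S (\<lambda>T. T \<subseteq> set (cols A) \<and> lin_indpt T)"
      using maximal_exists_superset[of "set (cols A)" "\<lambda>T. T \<subseteq> set (cols A) \<and> lin_indpt T" "{}"]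
      by (auto simp: finite_lin_indpt2)
    have Sc: "S \<subseteq> set (cols A)" and Sli: "lin_indpt S" using S(2) by (auto simp: maximal_def)
    have "card S = normal_rank P"
      using rank_card_indpt[OF A S(2)] P by (simp add: normal_rank_def A_def)
    then obtain S' where S': "S' \<subseteq> S" "card S' = Suc r" "finite S'"
      using rk obtain_subset_with_card_n[of "Suc r" S] by auto
    obtain w where w: "bij_betw w {..<Suc r} S'"
      using finite_same_card_bij[of "{..<Suc r}" S'] S' by auto
    have "\<exists>l<n. w k = col A l" if "k < Suc r" for k
    proof -
      have "w k \<in> set (cols A)" using w S'(1) Sc that by (auto simp: bij_betw_def)
      then show ?thesis using A by (auto simp: cols_def)
    qed
    then obtain \<kappa> where \<kappa>: "\<And>k. k < Suc r \<Longrightarrow> \<kappa> k < n \<and> w k = col A (\<kappa> k)" by metis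
    have li: "lin_indpt S'" using subset_li_is_li[OF Sli S'(1)] .
    \<comment> \<open>This excludes the second alternative of \<open>minor_or_relation\<close>: a
      polynomial relation between the chosen columns would be a rational one.\<close>
    have no_rel: "\<not> (\<exists>x. (\<exists>k<Suc r. x k \<noteq> 0) \<and> (\<forall>i<m. (\<Sum>k<Suc r. x k * P $$ (i, \<kappa> k)) = 0))"
    proof
      assume "\<exists>x. (\<exists>k<Suc r. x k \<noteq> 0) \<and> (\<forall>i<m. (\<Sum>k<Suc r. x k * P $$ (i, \<kappa> k)) = 0)"
      then obtain x k0 where k0: "k0 < Suc r" "x k0 \<noteq> 0"
        and x: "\<And>i. i < m \<Longrightarrow> (\<Sum>k<Suc r. x k * P $$ (i, \<kappa> k)) = 0" by blast
      have inj: "inj_on w {..<Suc r}" and im: "w ` {..<Suc r} = S'" using w by (auto simp: bij_betw_def)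
      have S'c: "S' \<subseteq> carrier_vec m" using S'(1) Sc cc by blast
      define g where "g v = to_fract (x (inv_into {..<Suc r} w v))" for v
      have "lincomb g S' = 0\<^sub>v m"
      proof (rule eq_vecI)
        fix i assume "i < dim_vec (0\<^sub>v m :: cratf vec)"
        then have i: "i < m" by simp
        have "lincomb g S' $ i = (\<Sum>v\<in>w ` {..<Suc r}. g v * v $ i)"
          using lincomb_index[OF i S'c] im by simp
        also have "\<dots> = (\<Sum>k<Suc r. g (w k) * w k $ i)" by (simp only: sum.reindex[OF inj] o_def)
        also have "\<dots> = (\<Sum>k<Suc r. to_fract (x k * P $$ (i, \<kappa> k)))"
        proof (rule sum.cong[OF refl])
          fix k assume k: "k \<in> {..<Suc r}"
          then show "g (w k) * w k $ i = to_fract (x k * P $$ (i, \<kappa> k))"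
            using \<kappa>[of k] i A inv_into_f_f[OF inj k] by (simp add: g_def Aij)
        qed
        also have "\<dots> = to_fract (\<Sum>k<Suc r. x k * P $$ (i, \<kappa> k))" by simp
        also have "\<dots> = 0" by (simp only: x[OF i] to_fract_0)
        finally show "lincomb g S' $ i = 0\<^sub>v m $ i" using i by simp
      qed (use lincomb_dim[OF S'(3) S'c] in auto)
      moreover have "w k0 \<in> S'" using k0 im by auto
      moreover have "g (w k0) \<noteq> 0" using k0 inv_into_f_f[OF inj, of k0] by (simp add: g_def)
      ultimately have "lin_dep S'" using S'(3) unfolding lin_dep_def by blast
      then show False using li by blast
    qed
    from minor_or_relation[of "Suc r" m "\<lambda>k i. P $$ (i, \<kappa> k)"] no_rel obtain \<iota>
      where \<iota>: "\<And>t. t < Suc r \<Longrightarrow> \<iota> t < m" and det: "det (mat (Suc r) (Suc r) (\<lambda>(t,k). P $$ (\<iota> t, \<kappa> k))) \<noteq> 0"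
      by blast
    define M where "M Q = mat (Suc r) (Suc r) (\<lambda>(t,k). Q $$ (\<iota> t, \<kappa> k))" for Q :: "cpoly mat"
    obtain z where z: "poly (det (M P)) z \<noteq> 0" using det poly_all_0_iff_0[of "det (M P)"] by (auto simp: M_def)
    have "\<forall>N. \<exists>Q. Q \<in> facs m n r d f \<inter> polymats m n d \<and>
        (\<forall>i<m. \<forall>j<n. \<forall>k. cmod (coeff (P $$ (i,j)) k - coeff (Q $$ (i,j)) k) < inverse (real (Suc N)))"
      using Pc unfolding pm_closure_iff by (metis inverse_positive_iff_positive of_nat_0_less_iff zero_less_Suc)
    then obtain Q where Q: "\<And>N. Q N \<in> facs m n r d f \<inter> polymats m n d"
      and near: "\<And>N i j k. i < m \<Longrightarrow> j < n \<Longrightarrow> cmod (coeff (P $$ (i,j)) k - coeff (Q N $$ (i,j)) k) < inverse (real (Suc N))"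
      by metis
    have lim: "(\<lambda>N. poly (Q N $$ (i,j)) z) \<longlonglongrightarrow> poly (P $$ (i,j)) z" if ij: "i < m" "j < n" for i j
    proof -
      have "(\<lambda>N. coeff (Q N $$ (i,j)) k) \<longlonglongrightarrow> coeff (P $$ (i,j)) k" for k
      proof (rule LIM_zero_cancel, rule tendsto_0_le[OF LIMSEQ_inverse_real_of_nat, where K = 1])
        show "\<forall>\<^sub>F N in sequentially. norm (coeff (Q N $$ (i,j)) k - coeff (P $$ (i,j)) k)
            \<le> norm (inverse (real (Suc N))) * 1"
        proof (intro always_eventually allI)
          fix N
          show "norm (coeff (Q N $$ (i,j)) k - coeff (P $$ (i,j)) k) \<le> norm (inverse (real (Suc N))) * 1"
            using near[OF ij, of k N] by (simp add: norm_minus_commute)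
        qed
      qed
      then have "(\<lambda>N. \<Sum>l\<le>d. coeff (Q N $$ (i,j)) l * z ^ l) \<longlonglongrightarrow> (\<Sum>l\<le>d. coeff (P $$ (i,j)) l * z ^ l)"
        by (intro tendsto_intros)
      moreover have "poly (Q N $$ (i,j)) z = (\<Sum>l\<le>d. coeff (Q N $$ (i,j)) l * z ^ l)" for N
        using Q[of N] ij by (intro poly_eq_sum_coeff) (auto simp: polymats_def)
      moreover have "poly (P $$ (i,j)) z = (\<Sum>l\<le>d. coeff (P $$ (i,j)) l * z ^ l)"
        using Pm ij by (intro poly_eq_sum_coeff) (auto simp: polymats_def)
      ultimately show ?thesis by simp
    qed
    \<comment> \<open>The Leibniz formula allows the limit to be taken entry by entry.\<close>
    have detM: "poly (det (M Q)) z = (\<Sum>p | p permutes {0..<Suc r}. signof p * (\<Prod>i=0..<Suc r. poly (Q $$ (\<iota> i, \<kappa> (p i))) z))"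
      for Q
    proof -
      have "poly (det (M Q)) z = det (mat (Suc r) (Suc r) (\<lambda>(t,k). poly (Q $$ (\<iota> t, \<kappa> k)) z))"
        unfolding poly_det by (rule arg_cong[of _ _ det], rule eq_matI) (auto simp: M_def)
      also have "\<dots> = (\<Sum>p | p permutes {0..<Suc r}. signof p *
          (\<Prod>i=0..<Suc r. mat (Suc r) (Suc r) (\<lambda>(t,k). poly (Q $$ (\<iota> t, \<kappa> k)) z) $$ (i, p i)))"
        by (rule det_def') simp
      also have "\<dots> = (\<Sum>p | p permutes {0..<Suc r}. signof p * (\<Prod>i=0..<Suc r. poly (Q $$ (\<iota> i, \<kappa> (p i))) z))"
      proof (rule sum.cong[OF refl])
        fix p assume p: "p \<in> {p. p permutes {0..<Suc r}}"
        have "p i < Suc r" if "i < Suc r" for i using permutes_in_image[of p "{0..<Suc r}" i] p that by simp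
        then show "signof p * (\<Prod>i=0..<Suc r. mat (Suc r) (Suc r) (\<lambda>(t,k). poly (Q $$ (\<iota> t, \<kappa> k)) z) $$ (i, p i)) =
            signof p * (\<Prod>i=0..<Suc r. poly (Q $$ (\<iota> i, \<kappa> (p i))) z)"
          by (intro arg_cong[of _ _ "(*) _"] prod.cong) auto
      qed
      finally show ?thesis .
    qed
    have "(\<lambda>N. poly (det (M (Q N))) z) \<longlonglongrightarrow> poly (det (M P)) z"
      unfolding detM
    proof (intro tendsto_sum tendsto_mult tendsto_const tendsto_prod)
      fix p i assume p: "p \<in> {p. p permutes {0..<Suc r}}" and i: "i \<in> {0..<Suc r}"
      have "p i < Suc r" using permutes_in_image[of p "{0..<Suc r}" i] p i by simp
      then show "(\<lambda>N. poly (Q N $$ (\<iota> i, \<kappa> (p i))) z) \<longlonglongrightarrow> poly (P $$ (\<iota> i, \<kappa> (p i))) z"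
        using \<iota>[of i] \<kappa>[of "p i"] i by (intro lim) auto
    qed
    moreover have "det (M (Q N)) = 0" for N
    proof -
      have "Q N \<in> facs m n r d f" using Q[of N] by simp
      then obtain X Y where "Q N = mat m n (\<lambda>(i,j). \<Sum>k<r. X i k * Y k j)" unfolding facs_def by blast
      then have "M (Q N) = mat (Suc r) (Suc r) (\<lambda>(t,k). \<Sum>l<r. X (\<iota> t) l * Y l (\<kappa> k))"
        unfolding M_def using \<iota> \<kappa> by (intro eq_matI) auto
      then show ?thesis using det_low_rank[of r "\<lambda>t l. X (\<iota> t) l" "\<lambda>l k. Y l (\<kappa> k)"] by simp
    qed
    ultimately have "(\<lambda>N. 0) \<longlonglongrightarrow> poly (det (M P)) z" by simp
    then show False using z by (simp add: LIMSEQ_const_iff)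
  qed
  then show "P \<in> polymats_rank m n d r" using Pm by (simp add: polymats_rank_def)
qed

theorem theorem4p11:
  fixes m n r d :: nat
  assumes "m \<ge> 2" and "n \<ge> 2" and "d \<ge> 1" and "0 < r" and "r < min m n"
  shows "(\<forall>a\<le>r*d. MHset m n r d a \<subseteq> Mset m n r d a \<and> Mset m n r d a \<subseteq> Bset m n r d a)
    \<and> (\<forall>a\<le>r*d. pm_closure m n d (MHset m n r d a) = pm_closure m n d (Mset m n r d a)
                \<and> pm_closure m n d (Mset m n r d a) = pm_closure m n d (Bset m n r d a))
    \<and> polymats_rank m n d r = (\<Union>a\<in>{0..r*d}. pm_closure m n d (MHset m n r d a))
    \<and> polymats_rank m n d r = (\<Union>a\<in>{0..r*d}. pm_closure m n d (Mset m n r d a))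
    \<and> (\<forall>P\<in>polymats_rank m n d r. \<exists>a\<le>r*d.
          P \<in> pm_closure m n d (MHset m n r d a)
          \<and> pm_closure m n d (MHset m n r d a) = pm_closure m n d (Mset m n r d a))"
proof -
  have r: "0 < r" "r < m" "r < n" using assms by auto
  have sub: "MHset m n r d a \<subseteq> Mset m n r d a" "Mset m n r d a \<subseteq> Bset m n r d a" for a
    by (auto simp: MHset_def Mset_def Bset_def)
  have dense: "pm_closure m n d (facs m n r d (bal r a)) \<subseteq> pm_closure m n d (MHset m n r d a)" if "a \<le> r * d" for a
    using facs_subset_closure_MHset[OF r that] by (rule pm_closure_subset_closureI)
  have eq: "pm_closure m n d (MHset m n r d a) = pm_closure m n d (Mset m n r d a)"
     "pm_closure m n d (Mset m n r d a) = pm_closure m n d (Bset m n r d a)" if a: "a \<le> r * d" for a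
  proof -
    \<comment> \<open>\<open>Bset\<close> lies in \<open>facs\<close>, which lies in the closure of
      \<open>MHset\<close>; with the inclusions \<open>sub\<close> all three closures
      coincide.\<close>
    have "pm_closure m n d (Bset m n r d a) \<subseteq> pm_closure m n d (MHset m n r d a)"
      using dense[OF a] pm_closure_mono[OF Bset_subset_facs[OF r(1) a]] by blast
    then show "pm_closure m n d (MHset m n r d a) = pm_closure m n d (Mset m n r d a)"
     "pm_closure m n d (Mset m n r d a) = pm_closure m n d (Bset m n r d a)"
      using pm_closure_mono[OF sub(1)] pm_closure_mono[OF sub(2)] by blast+
  qed
  have cover: "\<exists>a\<le>r*d. P \<in> pm_closure m n d (MHset m n r d a)" if P: "P \<in> polymats_rank m n d r" for P
  proof -
    obtain f where f: "\<And>k. k < r \<Longrightarrow> f k \<le> d" "P \<in> facs m n r d f"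
      using polymats_rank_subset_facs[OF P] by blast
    \<comment> \<open>The degree sum of the factorization is the index \<open>a\<close>
      sought.\<close>
    have "sum f {..<r} \<le> r * d" using sum_bounded_above[of "{..<r}" f d] f(1) by simp
    moreover have "P \<in> pm_closure m n d (facs m n r d (bal r (sum f {..<r})))"
      using facs_balance[of r f d m n, OF r(1) f(1)] f(2) by blast
    ultimately show ?thesis using dense by blast
  qed
  have "pm_closure m n d (MHset m n r d a) \<subseteq> polymats_rank m n d r" if a: "a \<le> r * d" for a
    using pm_closure_mono[OF MHset_subset_facs[OF r(1) a]]
      closure_facs_rank[of r "bal r a" d m n] bal_complement(1)[OF r(1) _ a] by blast
  then have MH: "polymats_rank m n d r = (\<Union>a\<in>{0..r*d}. pm_closure m n d (MHset m n r d a))"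
    using cover by fastforce
  also have "\<dots> = (\<Union>a\<in>{0..r*d}. pm_closure m n d (Mset m n r d a))" using eq(1) by auto
  finally have M: "polymats_rank m n d r = (\<Union>a\<in>{0..r*d}. pm_closure m n d (Mset m n r d a))" .
  show ?thesis
  proof (intro conjI allI impI ballI)
    fix P assume "P \<in> polymats_rank m n d r"
    then obtain a where "a \<le> r * d" "P \<in> pm_closure m n d (MHset m n r d a)" using cover by blast
    then show "\<exists>a\<le>r*d. P \<in> pm_closure m n d (MHset m n r d a)
          \<and> pm_closure m n d (MHset m n r d a) = pm_closure m n d (Mset m n r d a)"
      using eq(1) by blast
  qed (rule sub eq MH M | assumption)+
qed

end
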